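(* Let $q$ be a $Q$-function such that $\sup_{t\in[T_0,s[}q(x,t)<\infty$ for each $s\in\,]T_0,T_1[$ and $x\in\mathbf{X}$. A function $P$ from $\hat{\mathcal{P}}$ satisfies the two properties (i) for all $u\in[T_0,T_1[$, $s\in\,]u,T_1[$, $x\in\mathbf{X}$, and $(q,s)$-bounded sets $B$, $\lim_{t\to u+}P(u,x;t,B)=\mathbf{I}\{x\in B\}$, and the function $t\mapsto P(u,x;t,B)$ is absolutely continuous in $t\in\,]u,s[$; (ii) for all $u\in[T_0,T_1[$, $s\in\,]u,T_1[$, $x\in\mathbf{X}$, and $(q,s)$-bounded sets $B$, Kolmogorov's forward equation $$\frac{\partial}{\partial t}P(u,x;t,B)=-\int_B q(y,t)P(u,x;t,dy)+\int_{\mathbf{X}}q(y,t,B\setminus\{y\})P(u,x;t,dy)$$ holds for almost every $t\in\,]u,s[$; if and only if, for all $u\in[T_0,T_1[$, $t\in\,]u,T_1[$, $x\in\mathbf{X}$, and $B\in\mathfrak{B}(\mathbf{X})$, $$P(u,x;t,B)=\mathbf{I}\{x\in B\}e^{-\int_u^t q(x,\theta)d\theta}+\int_u^t\int_{\mathbf{X}}\int_B e^{-\int_w^t q(y,\theta)d\theta}\,q^+(z,w,dy)\,P(u,x;w,dz)\,dw.$$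
   Context: Intervals: $]a,b[$ and $[a,b[$ denote open and half-open intervals. $(\mathbf{X},\mathfrak{B}(\mathbf{X}))$ is a standard Borel space; $0\le T_0<T_1\le\infty$; measurability means Borel measurability. $Q$-function: a function $q(x,t,B)$, $x\in\mathbf{X}$, $t\in[T_0,T_1[$, $B\in\mathfrak{B}(\mathbf{X})$, such that (a) for all $x,t$, $q(x,t,\cdot)$ is a (finite) signed measure with $q(x,t,\mathbf{X})\le 0$ and $0\le q(x,t,B\setminus\{x\})<\infty$ for all $B$; (b) for each $B$, $q(x,t,B)$ is measurable in $(x,t)$. Standing assumption: $q$ is conservative, i.e. $q(x,t,\mathbf{X})=0$ for all $x,t$. Put $q(x,t):=-q(x,t,\{x\})$ and $q^+(x,t,B):=q(x,t,B\setminus\{x\})$ (the paper writes $q(z,w,dy\setminus\{z\})$ for $q^+(z,w,dy)$). $\hat{\mathcal{P}}$ is the family of real-valued functions $P(u,x;t,B)$, defined for all $u\in[T_0,T_1[$, $t\in\,]u,T_1[$, $x\in\mathbf{X}$, $B\in\mathfrak{B}(\mathbf{X})$, which are (non-negative, finite) measures on $(\mathbf{X},\mathfrak{B}(\mathbf{X}))$ for fixed $u,x,t$ and measurable in $t$ for fixed $u,x,B$. For $s\in\,]T_0,T_1]$, a set $B\in\mathfrak{B}(\mathbf{X})$ is called $(q,s)$-bounded if the function $q(x,t)$ is bounded on $B\times[T_0,s[$. A differential equation "holds" at a point if the derivative exists there and the equality holds between finite numbers (in particular the integrals are finite). *)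

theory Defs
  imports "HOL-Analysis.Analysis"
begin

definition standard_borel :: "'a measure \<Rightarrow> bool" where
  "standard_borel M \<longleftrightarrow>
     (\<exists>T. completely_metrizable_space T \<and> separable_space T \<and>
        space M = topspace T \<and> sets M = sigma_sets (topspace T) {U. openin T U})"

(* The upper end point of the time horizon may be infinity, hence has type ereal. *)
definition ico :: "real \<Rightarrow> ereal \<Rightarrow> real set" where
  "ico a b = {t. a \<le> t \<and> ereal t < b}"

definition ioo :: "real \<Rightarrow> ereal \<Rightarrow> real set" where
  "ioo a b = {t. a < t \<and> ereal t < b}"

(* Real values make the signed measure finite. *)
definition signed_measure :: "'a measure \<Rightarrow> ('a set \<Rightarrow> real) \<Rightarrow> bool" where
  "signed_measure M \<nu> \<longleftrightarrow>
     \<nu> {} = 0 \<and>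
     (\<forall>A. range A \<subseteq> sets M \<and> disjoint_family A \<longrightarrow>
        (\<lambda>i. \<nu> (A i)) sums \<nu> (\<Union>i::nat. A i))"

definition Q_function :: "'a measure \<Rightarrow> real \<Rightarrow> ereal \<Rightarrow> ('a \<Rightarrow> real \<Rightarrow> 'a set \<Rightarrow> real) \<Rightarrow> bool" where
  "Q_function M T0 T1 q \<longleftrightarrow>
     (\<forall>x\<in>space M. \<forall>t\<in>ico T0 T1.
        signed_measure M (q x t) \<and> q x t (space M) \<le> 0 \<and>
        (\<forall>B\<in>sets M. 0 \<le> q x t (B - {x}))) \<and>
     (\<forall>B\<in>sets M.
        (\<lambda>(x, t). q x t B) \<in> borel_measurable (M \<Otimes>\<^sub>M restrict_space borel (ico T0 T1)))"

definition conservative :: "'a measure \<Rightarrow> real \<Rightarrow> ereal \<Rightarrow> ('a \<Rightarrow> real \<Rightarrow> 'a set \<Rightarrow> real) \<Rightarrow> bool" where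
  "conservative M T0 T1 q \<longleftrightarrow> (\<forall>x\<in>space M. \<forall>t\<in>ico T0 T1. q x t (space M) = 0)"

definition q_rate :: "('a \<Rightarrow> real \<Rightarrow> 'a set \<Rightarrow> real) \<Rightarrow> 'a \<Rightarrow> real \<Rightarrow> real" where
  "q_rate q x t = - q x t {x}"

definition q_plus :: "('a \<Rightarrow> real \<Rightarrow> 'a set \<Rightarrow> real) \<Rightarrow> 'a \<Rightarrow> real \<Rightarrow> 'a set \<Rightarrow> real" where
  "q_plus q x t B = q x t (B - {x})"

definition q_plus_measure ::
    "'a measure \<Rightarrow> ('a \<Rightarrow> real \<Rightarrow> 'a set \<Rightarrow> real) \<Rightarrow> 'a \<Rightarrow> real \<Rightarrow> 'a measure" where
  "q_plus_measure M q z w = measure_of (space M) (sets M) (\<lambda>B. ennreal (q_plus q z w B))"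

(* P(u,x;t,B) is rendered as measure (P u x t) B. The values of P are only
   constrained for T0 <= u < t < T1 and x in the state space. *)
definition P_hat :: "'a measure \<Rightarrow> real \<Rightarrow> ereal \<Rightarrow> (real \<Rightarrow> 'a \<Rightarrow> real \<Rightarrow> 'a measure) set" where
  "P_hat M T0 T1 =
     {P. (\<forall>u\<in>ico T0 T1. \<forall>t\<in>ioo u T1. \<forall>x\<in>space M.
            sets (P u x t) = sets M \<and> finite_measure (P u x t)) \<and>
         (\<forall>u\<in>ico T0 T1. \<forall>x\<in>space M. \<forall>B\<in>sets M.
            (\<lambda>t. measure (P u x t) B) \<in> borel_measurable (restrict_space borel (ioo u T1)))}"

definition qs_bounded ::
    "'a measure \<Rightarrow> real \<Rightarrow> ('a \<Rightarrow> real \<Rightarrow> 'a set \<Rightarrow> real) \<Rightarrow> ereal \<Rightarrow> 'a set \<Rightarrow> bool" where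
  "qs_bounded M T0 q s B \<longleftrightarrow>
     B \<in> sets M \<and> bounded ((\<lambda>(x, t). q_rate q x t) ` (B \<times> ico T0 s))"

(* Absolute continuity on an interval I in the epsilon-delta sense; D is a finite
   family of non-overlapping subintervals, given by their end points. The library's
   absolutely_continuous is a relation between measures. *)
definition abs_continuous_on :: "real set \<Rightarrow> (real \<Rightarrow> real) \<Rightarrow> bool" where
  "abs_continuous_on I f \<longleftrightarrow>
     (\<forall>\<epsilon>>0. \<exists>\<delta>>0. \<forall>D. finite D \<and> D \<subseteq> I \<times> I \<and> (\<forall>(a, b)\<in>D. a < b) \<and>
        disjoint_family_on (\<lambda>(a, b). {a<..<b}) D \<and> (\<Sum>(a, b)\<in>D. b - a) < \<delta>
        \<longrightarrow> (\<Sum>(a, b)\<in>D. \<bar>f b - f a\<bar>) < \<epsilon>)"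

(* Integrability is part of the equation: a Bochner integral of a non-integrable
   function would be 0. *)
definition forward_equation_at ::
    "('a \<Rightarrow> real \<Rightarrow> 'a set \<Rightarrow> real) \<Rightarrow> (real \<Rightarrow> 'a \<Rightarrow> real \<Rightarrow> 'a measure) \<Rightarrow>
     real \<Rightarrow> 'a \<Rightarrow> 'a set \<Rightarrow> real \<Rightarrow> bool" where
  "forward_equation_at q P u x B t \<longleftrightarrow>
     set_integrable (P u x t) B (\<lambda>y. q_rate q y t) \<and>
     integrable (P u x t) (\<lambda>y. q_plus q y t B) \<and>
     ((\<lambda>\<tau>. measure (P u x \<tau>) B) has_real_derivative
        (- (LINT y:B|P u x t. q_rate q y t) + (LINT y|P u x t. q_plus q y t B))) (at t)"

end

theory Submission
  imports Defs
begin

text \<open>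
  For a fixed starting point write \<mu>(t) for P(u,x;t,\<cdot>), and call influx the measure
  \<nu>(w,B) = \<integral> q^+(z,w,B) \<mu>(w,dz). Both sides of the equivalence are compared with the balance equation
  \<mu>(t,B) + \<integral>_u^t \<integral>_B q(y,w) \<mu>(w,dy) dw = I{x \<in> B} + \<integral>_u^t \<nu>(w,B) dw.

  On a (q,s)-bounded set the balance equation is the integrated forward equation: one direction is
  the fundamental theorem of calculus for absolutely continuous functions, the other one is the
  Lebesgue differentiation theorem on the line.

  Writing E(y;w,t) = exp(-\<integral>_w^t q(y,\<theta>) d\<theta>), the balance equation and the integral equation of the
  theorem are turned into each other by Fubini's theorem, using
  E(w,t) + \<integral>_w^t q(\<theta>) E(w,\<theta>) d\<theta> = 1 in one direction and E(w,t) + \<integral>_w^t q(\<theta>) E(\<theta>,t) d\<theta> = 1 in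
  the other. All terms are nonnegative, so the second direction needs finiteness only to cancel the
  outflow, which is available on bounded sets.

  The passage from bounded sets to all sets needs bounded Borel sets that exhaust the state space.
  The set where q(\<cdot>,t) exceeds n for some t < s is only analytic; these sets decrease to the empty
  set, and Novikov's separation theorem encloses them in Borel sets with empty intersection.
\<close>

section \<open>Absolute continuity and differentiation on the line\<close>

text \<open>The hypothesis bounds the rate in time for each state, not uniformly in the state, so on
  a general set the influx and the outflow may be infinite. All identities are therefore stated
  between \<open>ennreal\<close> integrals; finiteness enters only where a term is cancelled or a
  derivative is taken.

  Cancelling the outflow works on a bounded set \<open>B\<close>, but there the balance equation is
  tested with the function q(y,\<theta>) E(y;\<theta>,t) restricted to \<open>B\<close>, so it has
  to hold for every measurable subset of \<open>B\<close>. Boundedness passes to such subsets, which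
  is what makes the localisation possible.

  In the converse direction no finiteness is given beforehand. It is extracted from the integral
  equation at the right end point of the time interval: there the measure of a bounded set is finite
  and dominates a fixed fraction of the influx. In that direction the working horizon
  \<open>s\<close> therefore lies strictly beyond the interval under study.\<close>

text \<open>Henstock's lemma controls the sum of the errors \<open>f x * length - integral\<close>
  over any fine partial division. A point where the difference quotient misses \<open>f x\<close> by
  more than \<epsilon> along arbitrarily short intervals tags fine intervals whose error exceeds
  \<epsilon> times their length. Disjoint ones thus have small total length, and a Vitali selection
  turns this into small outer measure of the set of bad points.\<close>

lemma integral_has_real_derivative_AE:
  fixes f :: "real \<Rightarrow> real"
  assumes f: "f integrable_on {a..b}"
  shows "negligible {x\<in>{a<..<b}. \<not> ((\<lambda>t. integral {a..t} f) has_real_derivative f x) (at x)}"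
proof -
  define F where "F t = integral {a..t} f" for t
  define E where "E \<epsilon> = {x\<in>{a<..<b}. \<forall>d>0. \<exists>y. y \<in> {a..b} \<and> y \<noteq> x \<and> \<bar>y - x\<bar> < d \<and>
      \<bar>F y - F x - f x * (y - x)\<bar> > \<epsilon> * \<bar>y - x\<bar>}" for \<epsilon> :: real
  have F_diff: "integral {y..z} f = F z - F y" if "a \<le> y" "y \<le> z" "z \<le> b" for y z
  proof -
    have "integral {a..y} f + integral {y..z} f = integral {a..z} f"
      using that by (intro Henstock_Kurzweil_Integration.integral_combine integrable_on_subinterval[OF f]) auto
    then show ?thesis by (simp add: F_def)
  qed
  have negl: "negligible (E \<epsilon>)" if \<epsilon>: "\<epsilon> > 0" for \<epsilon>
    unfolding negligible_outer_le
  proof (intro allI impI)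
    fix e :: real assume e: "e > 0"
    \<comment> \<open>The tolerance anticipates two factors: each bad interval has an error of at
      least \<epsilon> times its length, and the Vitali selection covers only after enlargement by
      the factor 5.\<close>
    obtain \<gamma> where \<gamma>: "gauge \<gamma>" and hen: "\<And>p. \<lbrakk>p tagged_partial_division_of cbox a b; \<gamma> fine p\<rbrakk> \<Longrightarrow>
        (\<Sum>(x,k)\<in>p. norm (measure lborel k *\<^sub>R f x - integral k f)) < \<epsilon> * e / 5"
      using Henstock_lemma[of f a b "\<epsilon> * e / 5"] f e \<epsilon> by auto
    have "\<exists>y. y \<in> {a..b} \<and> y \<noteq> x \<and> closed_segment x y \<subseteq> \<gamma> x \<and>
        \<bar>F y - F x - f x * (y - x)\<bar> > \<epsilon> * \<bar>y - x\<bar>" if "x \<in> E \<epsilon>" for x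
    proof -
      obtain d where d: "d > 0" "ball x d \<subseteq> \<gamma> x"
        using gaugeD[OF \<gamma>, of x] open_contains_ball by metis
      obtain y where y: "y \<in> {a..b}" "y \<noteq> x" "\<bar>y - x\<bar> < d" "\<bar>F y - F x - f x * (y - x)\<bar> > \<epsilon> * \<bar>y - x\<bar>"
        using \<open>x \<in> E \<epsilon>\<close> d(1) unfolding E_def by blast
      have "closed_segment x y \<subseteq> ball x d"
        using y(3) d(1) by (intro closed_segment_subset) (auto simp: dist_real_def)
      then show ?thesis using y d(2) by blast
    qed
    then obtain y where y: "\<And>x. x \<in> E \<epsilon> \<Longrightarrow> y x \<in> {a..b}" "\<And>x. x \<in> E \<epsilon> \<Longrightarrow> y x \<noteq> x"
      "\<And>x. x \<in> E \<epsilon> \<Longrightarrow> closed_segment x (y x) \<subseteq> \<gamma> x"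
      "\<And>x. x \<in> E \<epsilon> \<Longrightarrow> \<bar>F (y x) - F x - f x * (y x - x)\<bar> > \<epsilon> * \<bar>y x - x\<bar>"
      by metis
    \<comment> \<open>The interval between \<open>x\<close> and \<open>y x\<close> is rewritten as a
      ball for the covering lemma; its tag \<open>x\<close> stays an end point.\<close>
    define c where "c x = (x + y x) / 2" for x
    define r where "r x = \<bar>y x - x\<bar> / 2" for x
    have cb: "cball (c x) (r x) = {min x (y x)..max x (y x)}" for x
      unfolding cball_eq_atLeastAtMost c_def r_def
      by (auto simp: min_def max_def abs_if field_simps split: if_splits)
    have seg: "cball (c x) (r x) = closed_segment x (y x)" for x
      unfolding cb closed_segment_eq_real_ivl by (auto simp: min_def max_def)
    have xin: "x \<in> {a<..<b}" if "x \<in> E \<epsilon>" for x using that by (auto simp: E_def)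
    have rpos: "0 < r i \<and> r i \<le> b - a" if "i \<in> E \<epsilon>" for i
      using y(1,2)[OF that] xin[OF that] by (auto simp: r_def)
    have sub: "E \<epsilon> \<subseteq> (\<Union>i\<in>E \<epsilon>. cball (c i) (r i))"
      by (auto simp: seg)
    obtain C where C: "countable C" "C \<subseteq> E \<epsilon>"
      "pairwise (\<lambda>i j. disjnt (cball (c i) (r i)) (cball (c j) (r j))) C"
      "E \<epsilon> \<subseteq> (\<Union>i\<in>C. cball (c i) (5 * r i))"
      using Vitali_covering_lemma_cballs[OF sub rpos] by blast
    have bnd: "measure lebesgue (\<Union>i\<in>I. cball (c i) (5 * r i)) \<le> e" if I: "I \<subseteq> C" "finite I" for I
    proof -
      define p where "p = (\<lambda>x. (x, cball (c x) (r x))) ` I"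
      have inj: "inj_on (\<lambda>x. (x, cball (c x) (r x))) I" by (auto simp: inj_on_def)
      have IE: "x \<in> E \<epsilon>" if "x \<in> I" for x using that I C(2) by blast
      have "p tagged_partial_division_of cbox a b"
        unfolding tagged_partial_division_of_def
      proof (intro conjI allI impI)
        show "finite p" using I by (simp add: p_def)
      next
        fix x K assume "(x, K) \<in> p"
        then have x: "x \<in> I" "K = cball (c x) (r x)" by (auto simp: p_def)
        show "x \<in> K" using x by (simp add: seg)
        show "K \<subseteq> cbox a b" using x y(1)[OF IE[OF x(1)]] xin[OF IE[OF x(1)]] by (auto simp: cb)
        show "\<exists>a b. K = cbox a b" using x by (auto simp: cb)
      next
        fix x1 K1 x2 K2 assume "(x1, K1) \<in> p \<and> (x2, K2) \<in> p \<and> (x1, K1) \<noteq> (x2, K2)"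
        then have x: "x1 \<in> C" "x2 \<in> C" "x1 \<noteq> x2" "K1 = cball (c x1) (r x1)" "K2 = cball (c x2) (r x2)"
          using I by (auto simp: p_def)
        then have "disjnt K1 K2" using C(3) by (auto simp: pairwise_def)
        then show "interior K1 \<inter> interior K2 = {}"
          using interior_subset[of K1] interior_subset[of K2] by (auto simp: disjnt_def)
      qed
      moreover have "\<gamma> fine p"
        unfolding fine_def p_def using y(3)[OF IE] by (auto simp: seg)
      ultimately have "(\<Sum>(x,k)\<in>p. norm (measure lborel k *\<^sub>R f x - integral k f)) < \<epsilon> * e / 5"
        by (rule hen)
      also have "(\<Sum>(x,k)\<in>p. norm (measure lborel k *\<^sub>R f x - integral k f)) =
          (\<Sum>x\<in>I. norm (measure lborel (cball (c x) (r x)) *\<^sub>R f x - integral (cball (c x) (r x)) f))"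
        unfolding p_def by (subst sum.reindex[OF inj]) simp
      finally have le: "(\<Sum>x\<in>I. norm (measure lborel (cball (c x) (r x)) *\<^sub>R f x - integral (cball (c x) (r x)) f)) < \<epsilon> * e / 5" .
      have term_le: "\<epsilon> * (2 * r x) \<le> norm (measure lborel (cball (c x) (r x)) *\<^sub>R f x - integral (cball (c x) (r x)) f)"
        if "x \<in> I" for x
      proof -
        note x = IE[OF that]
        have ax: "a \<le> min x (y x)" "max x (y x) \<le> b" using y(1)[OF x] xin[OF x] by auto
        have 1: "integral (cball (c x) (r x)) f = F (max x (y x)) - F (min x (y x))"
          unfolding cb using ax by (intro F_diff) auto
        have 2: "measure lborel (cball (c x) (r x)) = \<bar>y x - x\<bar>"
          unfolding cb by (simp add: min_def max_def)
        have rx: "2 * r x = \<bar>y x - x\<bar>" by (simp add: r_def)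
        show ?thesis
          using y(4)[OF x] unfolding 1 2 rx
          by (cases "x \<le> y x") (auto simp: min_def max_def algebra_simps abs_if split: if_splits)
      qed
      have "\<epsilon> * (\<Sum>x\<in>I. 2 * r x) \<le> (\<Sum>x\<in>I. norm (measure lborel (cball (c x) (r x)) *\<^sub>R f x - integral (cball (c x) (r x)) f))"
        unfolding sum_distrib_left by (intro sum_mono term_le)
      then have "\<epsilon> * (\<Sum>x\<in>I. 2 * r x) < \<epsilon> * (e / 5)" using le by simp
      then have s: "(\<Sum>x\<in>I. 2 * r x) < e / 5" using \<epsilon> by simp
      have "measure lebesgue (\<Union>i\<in>I. cball (c i) (5 * r i)) \<le> (\<Sum>i\<in>I. measure lebesgue (cball (c i) (5 * r i)))"
        using I by (intro measure_UNION_le) auto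
      also have "\<dots> = (\<Sum>i\<in>I. 5 * (2 * r i))"
      proof (rule sum.cong)
        fix i assume "i \<in> I"
        then have "r i > 0" using rpos IE by auto
        then show "measure lebesgue (cball (c i) (5 * r i)) = 5 * (2 * r i)"
          by (simp add: cball_eq_atLeastAtMost)
      qed simp
      also have "\<dots> = 5 * (\<Sum>i\<in>I. 2 * r i)" by (simp add: sum_distrib_left)
      finally show ?thesis using s by linarith
    qed
    have "(\<Union>i\<in>C. cball (c i) (5 * r i)) \<in> lmeasurable"
      by (rule fmeasurable_UN_bound[OF C(1) _ bnd]) auto
    moreover have "measure lebesgue (\<Union>i\<in>C. cball (c i) (5 * r i)) \<le> e"
      by (rule measure_UN_bound[OF C(1) _ bnd]) auto
    ultimately show "\<exists>T. E \<epsilon> \<subseteq> T \<and> T \<in> lmeasurable \<and> measure lebesgue T \<le> e"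
      using C(4) by blast
  qed
  have "{x\<in>{a<..<b}. \<not> (F has_real_derivative f x) (at x)} \<subseteq> (\<Union>n. E (inverse (real (Suc n))))"
  proof
    fix x assume "x \<in> {x\<in>{a<..<b}. \<not> (F has_real_derivative f x) (at x)}"
    then have x: "a < x" "x < b" and nd: "\<not> (F has_real_derivative f x) (at x)" by auto
    show "x \<in> (\<Union>n. E (inverse (real (Suc n))))"
    proof (rule ccontr)
      assume "x \<notin> (\<Union>n. E (inverse (real (Suc n))))"
      then have *: "\<exists>d>0. \<forall>y. y \<in> {a..b} \<and> y \<noteq> x \<and> \<bar>y - x\<bar> < d \<longrightarrow>
          \<bar>F y - F x - f x * (y - x)\<bar> \<le> inverse (real (Suc n)) * \<bar>y - x\<bar>" for n
        using x unfolding E_def by (auto simp: not_less) (meson not_le)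
      have "(F has_real_derivative f x) (at x)"
        unfolding has_field_derivative_iff Lim_at
      proof (intro allI impI)
        fix \<eta> :: real assume "\<eta> > 0"
        then obtain n where n: "inverse (real (Suc n)) < \<eta>" using reals_Archimedean by blast
        obtain d where d: "d > 0" and dd: "\<And>y. y \<in> {a..b} \<Longrightarrow> y \<noteq> x \<Longrightarrow> \<bar>y - x\<bar> < d \<Longrightarrow>
          \<bar>F y - F x - f x * (y - x)\<bar> \<le> inverse (real (Suc n)) * \<bar>y - x\<bar>" using *[of n] by blast
        show "\<exists>d>0. \<forall>y. 0 < dist y x \<and> dist y x < d \<longrightarrow> dist ((F y - F x) / (y - x)) (f x) < \<eta>"
        proof (intro exI conjI allI impI)
          show "0 < min d (min (x - a) (b - x))" using d x by auto
          fix y assume "0 < dist y x \<and> dist y x < min d (min (x - a) (b - x))"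
          then have y: "y \<noteq> x" "\<bar>y - x\<bar> < d" "y \<in> {a..b}" by (auto simp: dist_real_def)
          have "(F y - F x) / (y - x) - f x = (F y - F x - f x * (y - x)) / (y - x)"
            using y(1) by (simp add: field_simps)
          then have "\<bar>(F y - F x) / (y - x) - f x\<bar> = \<bar>F y - F x - f x * (y - x)\<bar> / \<bar>y - x\<bar>"
            by (simp add: abs_divide)
          also have "\<dots> \<le> inverse (real (Suc n))"
            using dd[OF y(3,1,2)] y(1) by (simp add: divide_le_eq)
          finally show "dist ((F y - F x) / (y - x)) (f x) < \<eta>" using n by (simp add: dist_real_def)
        qed
      qed
      then show False using nd by simp
    qed
  qed
  moreover have "negligible (\<Union>n. E (inverse (real (Suc n))))"
    by (intro negligible_Union_nat negl) simp
  ultimately show ?thesis unfolding F_def by (rule negligible_subset[rotated])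
qed

definition short_family :: "real set \<Rightarrow> real \<Rightarrow> (real \<times> real) set \<Rightarrow> bool" where
  "short_family I \<delta> D \<longleftrightarrow> finite D \<and> D \<subseteq> I \<times> I \<and> (\<forall>(a, b)\<in>D. a < b) \<and>
     disjoint_family_on (\<lambda>(a, b). {a<..<b}) D \<and> (\<Sum>(a, b)\<in>D. b - a) < \<delta>"

lemma abs_continuous_on_iff:
  "abs_continuous_on I f \<longleftrightarrow>
     (\<forall>\<epsilon>>0. \<exists>\<delta>>0. \<forall>D. short_family I \<delta> D \<longrightarrow> (\<Sum>(a, b)\<in>D. \<bar>f b - f a\<bar>) < \<epsilon>)"
  unfolding abs_continuous_on_def short_family_def ..

lemma abs_continuous_onE:
  assumes "abs_continuous_on I f" "\<epsilon> > 0"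
  obtains \<delta> where "\<delta> > 0" "\<And>D. short_family I \<delta> D \<Longrightarrow> (\<Sum>(a, b)\<in>D. \<bar>f b - f a\<bar>) < \<epsilon>"
  using assms unfolding abs_continuous_on_iff by blast

text \<open>The gauge treats two kinds of tags. Off \<open>N\<close>, differentiability makes the
  error at most a small multiple of the length. On \<open>N\<close>, the intervals lie in an open
  set of small measure, where absolute continuity makes the increments of \<open>f\<close> small in
  total.\<close>

lemma abs_continuous_on_has_integral:
  fixes f g :: "real \<Rightarrow> real"
  assumes ac: "abs_continuous_on {a..b} f" and "a \<le> b" and N: "negligible N"
    and der: "\<And>x. x \<in> {a..b} - N \<Longrightarrow> (f has_real_derivative g x) (at x within {a..b})"
  shows "(g has_integral f b - f a) {a..b}"
proof -
  \<comment> \<open>Setting the integrand to 0 on \<open>N\<close> removes the products of length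
    and \<open>g x\<close> there, so only the increments of \<open>f\<close> remain; values on a
    negligible set do not affect the integral.\<close>
  define g0 where "g0 x = (if x \<in> N then 0 else g x)" for x
  have "(g0 has_integral f b - f a) {a..b}"
    unfolding has_integral_real
  proof (intro allI impI)
    fix e :: real assume e: "e > 0"
    have "0 < e / 2" using e by simp
    then obtain \<delta> where \<delta>: "\<delta> > 0"
      and ac\<delta>: "\<And>D. short_family {a..b} \<delta> D \<Longrightarrow> (\<Sum>(p, q)\<in>D. \<bar>f q - f p\<bar>) < e / 2"
      using abs_continuous_onE[OF ac] by metis
    obtain U where U: "open U" "N \<subseteq> U" "(U - N) \<in> lmeasurable" "emeasure lebesgue (U - N) < ennreal \<delta>"
      using sets_lebesgue_outer_open[of N \<delta>] N \<delta> by (auto simp: negligible_iff_null_sets)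
    have eU: "emeasure lebesgue U < ennreal \<delta>"
    proof -
      have "emeasure lebesgue U \<le> emeasure lebesgue (U - N) + emeasure lebesgue N"
        using U(1) N by (subst emeasure_Diff_null_set) (auto simp: negligible_iff_null_sets)
      then show ?thesis using U(4) N by (simp add: negligible_iff_null_sets null_sets_def)
    qed
    \<comment> \<open>The summand 2 keeps the denominator positive when \<open>a = b\<close> and
      makes \<open>\<epsilon> * (b - a) < e / 2\<close> strict.\<close>
    define \<epsilon> where "\<epsilon> = e / (2 * (b - a) + 2)"
    have \<epsilon>: "\<epsilon> > 0" "\<epsilon> * (b - a) < e / 2"
    proof -
      have "2 * (b - a) + 2 > 0" using \<open>a \<le> b\<close> by simp
      then show "\<epsilon> > 0" "\<epsilon> * (b - a) < e / 2" using e by (simp_all add: \<epsilon>_def field_simps)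
    qed
    have "\<exists>d>0. \<forall>y\<in>{a..b}. \<bar>y - x\<bar> < d \<longrightarrow> \<bar>f y - f x - g x * (y - x)\<bar> \<le> \<epsilon> * \<bar>y - x\<bar>" if "x \<in> {a..b} - N" for x
    proof -
      have "(f has_derivative (\<lambda>h. g x * h)) (at x within {a..b})"
        using der[OF that] by (simp add: has_field_derivative_def)
      then have "\<exists>d>0. \<forall>y\<in>{a..b}. norm (y - x) < d \<longrightarrow> norm (f y - f x - g x * (y - x)) \<le> \<epsilon> * norm (y - x)"
        unfolding has_derivative_within_alt using \<epsilon>(1) by blast
      then show ?thesis by (simp only: real_norm_def)
    qed
    then obtain d where d: "\<And>x. x \<in> {a..b} - N \<Longrightarrow> d x > 0"
      "\<And>x y. x \<in> {a..b} - N \<Longrightarrow> y \<in> {a..b} \<Longrightarrow> \<bar>y - x\<bar> < d x \<Longrightarrow> \<bar>f y - f x - g x * (y - x)\<bar> \<le> \<epsilon> * \<bar>y - x\<bar>"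
      by metis
    define \<gamma> where "\<gamma> x = (if x \<in> N then U else if x \<in> {a..b} then ball x (d x) else ball x 1)" for x
    have gauge: "gauge \<gamma>"
      using U d(1) by (auto simp: gauge_def \<gamma>_def)
    have main: "norm ((\<Sum>(x, k)\<in>\<D>. measure lborel k *\<^sub>R g0 x) - (f b - f a)) < e"
      if D: "\<D> tagged_division_of {a..b}" and fine: "\<gamma> fine \<D>" for \<D>
    proof -
      note tD = tagged_division_ofD[OF D]
      have K: "Inf K \<le> x \<and> x \<le> Sup K \<and> a \<le> Inf K \<and> Sup K \<le> b"
        and Keq: "{Inf K..Sup K} = K" if "(x, K) \<in> \<D>" for x K
      proof -
        have "\<exists>l u. K = {l..u}" using tD(4)[OF that] by auto
        then obtain l u where lu: "K = {l..u}" by blast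
        have "x \<in> K" "K \<subseteq> {a..b}" using tD(2,3)[OF that] by auto
        then show "Inf K \<le> x \<and> x \<le> Sup K \<and> a \<le> Inf K \<and> Sup K \<le> b" "{Inf K..Sup K} = K"
          unfolding lu by auto
      qed
      have tel: "(\<Sum>(x,K)\<in>\<D>. f (Sup K) - f (Inf K)) = f b - f a"
        by (rule additive_tagged_division_1[OF \<open>a \<le> b\<close> D])
      have len: "(\<Sum>(x,K)\<in>\<D>. Sup K - Inf K) = b - a"
        by (rule additive_tagged_division_1[OF \<open>a \<le> b\<close> D, where f="\<lambda>x. x"])
      define DN where "DN = {(x,K)\<in>\<D>. x \<in> N}"
      define DG where "DG = {(x,K)\<in>\<D>. x \<notin> N}"
      have fin: "finite DN" "finite DG" using tD(1) by (auto simp: DN_def DG_def intro: finite_subset)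
      have split: "\<D> = DN \<union> DG" "DN \<inter> DG = {}" by (auto simp: DN_def DG_def)
      have cont: "measure lborel K = Sup K - Inf K" if "(x, K) \<in> \<D>" for x K
        using K[OF that] by (subst Keq[OF that, symmetric]) simp
      have "(\<Sum>(x, k)\<in>\<D>. measure lborel k *\<^sub>R g0 x) - (f b - f a) =
          (\<Sum>(x, K)\<in>\<D>. (Sup K - Inf K) * g0 x - (f (Sup K) - f (Inf K)))"
        unfolding tel[symmetric] sum_subtractf[symmetric]
        by (rule sum.cong) (auto simp: cont)
      also have "\<dots> = (\<Sum>(x, K)\<in>DN. (Sup K - Inf K) * g0 x - (f (Sup K) - f (Inf K))) +
          (\<Sum>(x, K)\<in>DG. (Sup K - Inf K) * g0 x - (f (Sup K) - f (Inf K)))"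
        unfolding split(1) by (rule sum.union_disjoint[OF fin split(2)])
      finally have eq: "(\<Sum>(x, k)\<in>\<D>. measure lborel k *\<^sub>R g0 x) - (f b - f a) = \<dots>" .
      have G: "\<bar>\<Sum>(x, K)\<in>DG. (Sup K - Inf K) * g0 x - (f (Sup K) - f (Inf K))\<bar> < e / 2"
      proof -
        have "\<bar>\<Sum>(x, K)\<in>DG. (Sup K - Inf K) * g0 x - (f (Sup K) - f (Inf K))\<bar> \<le>
          (\<Sum>(x, K)\<in>DG. \<epsilon> * (Sup K - Inf K))"
        proof (rule order_trans[OF sum_abs], rule sum_mono, clarify)
          fix x K assume "(x, K) \<in> DG"
          then have xK: "(x, K) \<in> \<D>" "x \<notin> N" by (auto simp: DG_def)
          note KK = K[OF xK(1)]
          have x: "x \<in> {a..b} - N" using KK xK(2) by auto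
          have "K \<subseteq> ball x (d x)" using fineD[OF fine xK(1)] x by (simp add: \<gamma>_def)
          moreover have "Inf K \<in> {Inf K..Sup K}" "Sup K \<in> {Inf K..Sup K}" using KK by auto
          ultimately have "Inf K \<in> ball x (d x)" "Sup K \<in> ball x (d x)"
            unfolding Keq[OF xK(1)] by (simp_all only: subset_iff)
          then have "\<bar>Inf K - x\<bar> < d x" "\<bar>Sup K - x\<bar> < d x"
            by (simp_all add: dist_real_def abs_minus_commute)
          then have "\<bar>f (Inf K) - f x - g x * (Inf K - x)\<bar> \<le> \<epsilon> * \<bar>Inf K - x\<bar>"
            "\<bar>f (Sup K) - f x - g x * (Sup K - x)\<bar> \<le> \<epsilon> * \<bar>Sup K - x\<bar>"
            using d(2)[OF x, of "Inf K"] d(2)[OF x, of "Sup K"] KK by auto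
          then have "\<bar>(Sup K - Inf K) * g x - (f (Sup K) - f (Inf K))\<bar> \<le> \<epsilon> * \<bar>Inf K - x\<bar> + \<epsilon> * \<bar>Sup K - x\<bar>"
            unfolding abs_le_iff by (auto simp: algebra_simps)
          \<comment> \<open>The tag lies in \<open>K\<close>, so its distances to the two end points
            add up to the length.\<close>
          also have "\<dots> = \<epsilon> * (Sup K - Inf K)" using KK by (auto simp: algebra_simps)
          finally show "\<bar>(Sup K - Inf K) * g0 x - (f (Sup K) - f (Inf K))\<bar> \<le> \<epsilon> * (Sup K - Inf K)"
            using xK(2) by (simp add: g0_def)
        qed
        also have "\<dots> \<le> (\<Sum>(x, K)\<in>\<D>. \<epsilon> * (Sup K - Inf K))"
        proof (rule sum_mono2[OF tD(1)])
          show "DG \<subseteq> \<D>" by (auto simp: DG_def)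
          show "0 \<le> (case z of (x, K) \<Rightarrow> \<epsilon> * (Sup K - Inf K))" if "z \<in> \<D> - DG" for z
            using that K[of "fst z" "snd z"] \<epsilon>(1) by (auto simp: case_prod_beta)
        qed
        also have "\<dots> = \<epsilon> * (\<Sum>(x, K)\<in>\<D>. Sup K - Inf K)"
          unfolding sum_distrib_left by (rule sum.cong) auto
        also have "\<dots> < e / 2" using \<epsilon>(2) len by simp
        finally show ?thesis .
      qed
      have NN: "\<bar>\<Sum>(x, K)\<in>DN. (Sup K - Inf K) * g0 x - (f (Sup K) - f (Inf K))\<bar> < e / 2"
      proof -
        \<comment> \<open>Degenerate intervals are dropped: absolute continuity speaks of pairs with
          distinct end points, and the injectivity and disjointness below rest on nonempty
          interiors. The increments over dropped intervals vanish.\<close>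
        define DN' where "DN' = {(x, K)\<in>DN. Inf K < Sup K}"
        have DN': "finite DN'" "DN' \<subseteq> DN" using fin by (auto simp: DN'_def intro: finite_subset)
        define h where "h = (\<lambda>(x::real, K::real set). (Inf K, Sup K))"
        have K': "(x, K) \<in> \<D>" "Inf K < Sup K" "a \<le> Inf K" "Sup K \<le> b" "K \<subseteq> U"
          if "(x, K) \<in> DN'" for x K
        proof -
          show 1: "(x, K) \<in> \<D>" "Inf K < Sup K" using that by (auto simp: DN'_def DN_def)
          have "x \<in> N" using that by (auto simp: DN'_def DN_def)
          then show "K \<subseteq> U" using fineD[OF fine 1(1)] by (simp add: \<gamma>_def)
          show "a \<le> Inf K" "Sup K \<le> b" using K[OF 1(1)] by auto
        qed
        have disj: "{Inf K1<..<Sup K1} \<inter> {Inf K2<..<Sup K2} = {}"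
          if "(x1, K1) \<in> DN'" "(x2, K2) \<in> DN'" "(x1, K1) \<noteq> (x2, K2)" for x1 K1 x2 K2
        proof -
          note 1 = K'(1)[OF that(1)] and 2 = K'(1)[OF that(2)]
          have "interior {Inf K1..Sup K1} \<inter> interior {Inf K2..Sup K2} = {}"
            unfolding Keq[OF 1] Keq[OF 2] by (rule tD(5)[OF 1 2 that(3)])
          then show ?thesis by (simp only: interior_atLeastAtMost_real)
        qed
        have ne: "{Inf K<..<Sup K} \<noteq> {}" if "(x, K) \<in> DN'" for x K using K'(2)[OF that] by simp
        have inj: "inj_on h DN'"
        proof (rule inj_onI, clarify)
          fix x1 K1 x2 K2 assume *: "(x1, K1) \<in> DN'" "(x2, K2) \<in> DN'" "h (x1, K1) = h (x2, K2)"
          then have "{Inf K1<..<Sup K1} = {Inf K2<..<Sup K2}" by (simp add: h_def)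
          then show "x1 = x2 \<and> K1 = K2" using disj[OF *(1,2)] ne[OF *(1)] by auto
        qed
        have sub: "h ` DN' \<subseteq> {a..b} \<times> {a..b}"
        proof clarify
          fix p q x K assume "(x, K) \<in> DN'" "(p, q) = h (x, K)"
          then show "p \<in> {a..b} \<and> q \<in> {a..b}" using K'(2-4)[of x K] by (auto simp: h_def)
        qed
        have lt: "\<forall>(p, q)\<in>h ` DN'. p < q" using K'(2) by (auto simp: h_def)
        have dfam: "disjoint_family_on (\<lambda>(p, q). {p<..<q}) (h ` DN')"
          unfolding disjoint_family_on_def
        proof (intro ballI impI)
          fix i i' assume "i \<in> h ` DN'" "i' \<in> h ` DN'" "i \<noteq> i'"
          then obtain x K x' K' where *: "(x, K) \<in> DN'" "(x', K') \<in> DN'" "i = h (x, K)" "i' = h (x', K')" "(x, K) \<noteq> (x', K')"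
            by fastforce
          then show "(\<lambda>(p, q). {p<..<q}) i \<inter> (\<lambda>(p, q). {p<..<q}) i' = {}"
            using disj[OF *(1,2,5)] by (simp add: h_def)
        qed
        have "ennreal (\<Sum>(p, q)\<in>h ` DN'. q - p) = (\<Sum>i\<in>h ` DN'. emeasure lebesgue ((\<lambda>(p, q). {p<..<q}) i))"
          using lt by (subst sum_ennreal[symmetric]) (auto intro!: sum.cong)
        also have "\<dots> = emeasure lebesgue (\<Union>i\<in>h ` DN'. (\<lambda>(p, q). {p<..<q}) i)"
          using DN' by (intro sum_emeasure dfam) auto
        also have "\<dots> \<le> emeasure lebesgue U"
        proof (rule emeasure_mono)
          show "(\<Union>i\<in>h ` DN'. (\<lambda>(p, q). {p<..<q}) i) \<subseteq> U"
          proof (rule UN_least)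
            fix i assume "i \<in> h ` DN'"
            then obtain x K where *: "(x, K) \<in> DN'" "i = h (x, K)" by auto
            have "{Inf K<..<Sup K} \<subseteq> {Inf K..Sup K}" by auto
            then show "(\<lambda>(p, q). {p<..<q}) i \<subseteq> U"
              using K'(5)[OF *(1)] Keq[OF K'(1)[OF *(1)]] by (simp add: *(2) h_def)
          qed
        qed (use U in auto)
        also have "\<dots> < ennreal \<delta>" by (rule eU)
        finally have "(\<Sum>(p, q)\<in>h ` DN'. q - p) < \<delta>"
          by (metis ennreal_leI not_le)
        then have "short_family {a..b} \<delta> (h ` DN')"
          unfolding short_family_def using finite_imageI[OF DN'(1)] sub lt dfam by blast
        then have "(\<Sum>(p, q)\<in>h ` DN'. \<bar>f q - f p\<bar>) < e / 2" by (rule ac\<delta>)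
        moreover have "(\<Sum>(p, q)\<in>h ` DN'. \<bar>f q - f p\<bar>) = (\<Sum>(x, K)\<in>DN'. \<bar>f (Sup K) - f (Inf K)\<bar>)"
          by (subst sum.reindex[OF inj]) (auto intro!: sum.cong simp: h_def)
        moreover have "(\<Sum>(x, K)\<in>DN'. \<bar>f (Sup K) - f (Inf K)\<bar>) = (\<Sum>(x, K)\<in>DN. \<bar>f (Sup K) - f (Inf K)\<bar>)"
        proof (rule sum.mono_neutral_left[OF fin(1) DN'(2)], clarify)
          fix x K assume *: "(x, K) \<in> DN" "(x, K) \<notin> DN'"
          then have "Inf K \<le> Sup K" using K[of x K] by (auto simp: DN_def)
          then have "Inf K = Sup K" using * by (auto simp: DN'_def)
          then show "\<bar>f (Sup K) - f (Inf K)\<bar> = 0" by simp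
        qed
        moreover have "\<bar>\<Sum>(x, K)\<in>DN. (Sup K - Inf K) * g0 x - (f (Sup K) - f (Inf K))\<bar> \<le> (\<Sum>(x, K)\<in>DN. \<bar>f (Sup K) - f (Inf K)\<bar>)"
        proof (rule order_trans[OF sum_abs], rule sum_mono, clarify)
          fix x K assume "(x, K) \<in> DN"
          then have "g0 x = 0" by (simp add: DN_def g0_def)
          then show "\<bar>(Sup K - Inf K) * g0 x - (f (Sup K) - f (Inf K))\<bar> \<le> \<bar>f (Sup K) - f (Inf K)\<bar>"
            by (simp add: abs_minus_commute)
        qed
        ultimately show ?thesis by linarith
      qed
      show ?thesis
        unfolding eq real_norm_def
        using abs_triangle_ineq[of "\<Sum>(x, K)\<in>DN. (Sup K - Inf K) * g0 x - (f (Sup K) - f (Inf K))"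
            "\<Sum>(x, K)\<in>DG. (Sup K - Inf K) * g0 x - (f (Sup K) - f (Inf K))"] G NN
        by linarith
    qed
    show "\<exists>\<gamma>. gauge \<gamma> \<and> (\<forall>\<D>. \<D> tagged_division_of {a..b} \<and> \<gamma> fine \<D> \<longrightarrow>
        norm ((\<Sum>(x, k)\<in>\<D>. measure lborel k *\<^sub>R g0 x) - (f b - f a)) < e)"
      by (intro exI[of _ \<gamma>] conjI allI impI gauge) (elim conjE, rule main)
  qed
  then show ?thesis
    by (rule has_integral_spike[OF N, rotated]) (auto simp: g0_def)
qed

lemma nn_integral_Icc_eq_Ioo:
  "(\<integral>\<^sup>+x\<in>{a..b}. f x \<partial>lborel) = (\<integral>\<^sup>+x\<in>{a<..<b::real}. f x \<partial>lborel)"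
proof (rule nn_integral_cong_AE)
  have "AE x in lborel. x \<noteq> a" "AE x in lborel. x \<noteq> b" by (rule AE_lborel_singleton)+
  then show "AE x in lborel. f x * indicator {a..b} x = f x * indicator {a<..<b} x"
    by eventually_elim (auto simp: indicator_def)
qed

lemma nn_integral_Ioc_eq_Ioo:
  "(\<integral>\<^sup>+x\<in>{a<..b}. f x \<partial>lborel) = (\<integral>\<^sup>+x\<in>{a<..<b::real}. f x \<partial>lborel)"
proof (rule nn_integral_cong_AE)
  have "AE x in lborel. x \<noteq> b" by (rule AE_lborel_singleton)
  then show "AE x in lborel. f x * indicator {a<..b} x = f x * indicator {a<..<b} x"
    by eventually_elim (auto simp: indicator_def)
qed

lemma integrable_on_of_nn_integral:
  fixes h :: "real \<Rightarrow> real"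
  assumes h[measurable]: "h \<in> borel_measurable borel" and nn: "\<And>x. 0 \<le> h x" and A[measurable]: "A \<in> sets borel"
    and fin: "(\<integral>\<^sup>+x\<in>A. ennreal (h x) \<partial>lborel) < \<infinity>"
  shows "h integrable_on A" "(\<integral>\<^sup>+x\<in>A. ennreal (h x) \<partial>lborel) = ennreal (integral A h)"
proof -
  have eq: "ennreal (h x) * indicator A x = ennreal (if x \<in> A then h x else 0)" for x
    by (simp add: indicator_def)
  have "(\<lambda>x. if x \<in> A then h x else 0) integrable_on UNIV"
    by (rule nn_integral_integrable_on) (use nn fin in \<open>simp_all add: eq\<close>)
  then show "h integrable_on A" by (simp add: integrable_restrict_UNIV)
  then show "(\<integral>\<^sup>+x\<in>A. ennreal (h x) \<partial>lborel) = ennreal (integral A h)"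
    by (intro nn_integral_has_integral_lebesgue' nn integrable_integral)
qed

lemma abs_continuous_on_subset:
  assumes "abs_continuous_on I f" "J \<subseteq> I" shows "abs_continuous_on J f"
  unfolding abs_continuous_on_iff
proof (intro allI impI)
  fix \<epsilon> :: real assume "\<epsilon> > 0"
  then obtain \<delta> where d: "\<delta> > 0" and *: "\<And>D. short_family I \<delta> D \<Longrightarrow> (\<Sum>(a, b)\<in>D. \<bar>f b - f a\<bar>) < \<epsilon>"
    using abs_continuous_onE[OF assms(1)] by metis
  have "short_family I \<delta> D" if "short_family J \<delta> D" for D
    using that assms(2) unfolding short_family_def by blast
  then show "\<exists>\<delta>>0. \<forall>D. short_family J \<delta> D \<longrightarrow> (\<Sum>(a, b)\<in>D. \<bar>f b - f a\<bar>) < \<epsilon>"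
    using d * by blast
qed

lemma abs_continuous_on_lipschitz:
  assumes C: "C \<ge> 0" and lip: "\<And>p q. p \<in> I \<Longrightarrow> q \<in> I \<Longrightarrow> p < q \<Longrightarrow> \<bar>f q - f p\<bar> \<le> C * (q - p)"
  shows "abs_continuous_on I f"
  unfolding abs_continuous_on_iff
proof (intro allI impI)
  fix \<epsilon> :: real assume e: "\<epsilon> > 0"
  show "\<exists>\<delta>>0. \<forall>D. short_family I \<delta> D \<longrightarrow> (\<Sum>(a, b)\<in>D. \<bar>f b - f a\<bar>) < \<epsilon>"
  proof (intro exI[of _ "\<epsilon> / (C + 1)"] conjI allI impI)
    show "\<epsilon> / (C + 1) > 0" using e C by simp
    fix D assume D: "short_family I (\<epsilon> / (C + 1)) D"
    note D = D[unfolded short_family_def]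
    have "(\<Sum>(a, b)\<in>D. \<bar>f b - f a\<bar>) \<le> (\<Sum>(a, b)\<in>D. C * (b - a))"
      using D by (intro sum_mono) (auto intro: lip)
    also have "\<dots> = C * (\<Sum>(a, b)\<in>D. b - a)" unfolding sum_distrib_left by (simp add: case_prod_beta)
    also have "\<dots> \<le> C * (\<epsilon> / (C + 1))" using D C by (intro mult_left_mono) auto
    also have "\<dots> < \<epsilon>" using e C by (simp add: divide_simps)
    finally show "(\<Sum>(a, b)\<in>D. \<bar>f b - f a\<bar>) < \<epsilon>" .
  qed
qed

lemma abs_continuous_on_imp_continuous_on:
  assumes ac: "abs_continuous_on {a..b} f"
  shows "continuous_on {a..b} f"
  unfolding continuous_on_iff
proof (intro ballI allI impI)
  fix x \<epsilon> :: real assume x: "x \<in> {a..b}" and e: "\<epsilon> > 0"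
  then obtain \<delta> where d: "\<delta> > 0"
    and *: "\<And>D. short_family {a..b} \<delta> D \<Longrightarrow> (\<Sum>(a, b)\<in>D. \<bar>f b - f a\<bar>) < \<epsilon>"
    using abs_continuous_onE[OF ac] by metis
  have pair: "\<bar>f q - f p\<bar> < \<epsilon>" if "p \<in> {a..b}" "q \<in> {a..b}" "p < q" "q - p < \<delta>" for p q
    using *[of "{(p, q)}"] that by (simp add: short_family_def disjoint_family_on_def)
  show "\<exists>d>0. \<forall>x'\<in>{a..b}. dist x' x < d \<longrightarrow> dist (f x') (f x) < \<epsilon>"
  proof (intro exI[of _ \<delta>] conjI d ballI impI)
    fix y assume y: "y \<in> {a..b}" "dist y x < \<delta>"
    consider "y < x" | "y = x" | "x < y" by linarith
    then show "dist (f y) (f x) < \<epsilon>"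
    proof cases
      case 1
      then have "\<bar>f x - f y\<bar> < \<epsilon>" using x y by (intro pair) (simp_all add: dist_real_def)
      then show ?thesis by (simp add: dist_real_def abs_minus_commute)
    next
      case 3
      then have "\<bar>f y - f x\<bar> < \<epsilon>" using x y by (intro pair) (simp_all add: dist_real_def)
      then show ?thesis by (simp add: dist_real_def)
    qed (use e in simp)
  qed
qed

text \<open>Truncation: the integrals of \<open>min (h x) n\<close> increase to that of
  \<open>h\<close>, so for a suitable \<open>n\<close> the part above level \<open>n\<close>
  contributes less than \<epsilon>/2 on every set, while the truncated part is at most
  \<open>n\<close> times the measure of the set.\<close>

lemma nn_integral_small_sets:
  fixes h :: "real \<Rightarrow> ennreal"
  assumes h[measurable]: "h \<in> borel_measurable borel" and fin: "(\<integral>\<^sup>+x. h x \<partial>lborel) < \<infinity>" and e: "\<epsilon> > 0"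
  shows "\<exists>\<delta>>0. \<forall>A\<in>sets borel. emeasure lborel A < ennreal \<delta> \<longrightarrow> (\<integral>\<^sup>+x\<in>A. h x \<partial>lborel) < ennreal \<epsilon>"
proof -
  define k where "k n x = min (h x) (of_nat n)" for n :: nat and x
  have k[measurable]: "k n \<in> borel_measurable borel" for n unfolding k_def by measurable
  have "(SUP n. k n x) = h x" for x
  proof (rule antisym)
    show "h x \<le> (SUP n. k n x)"
    proof (cases "h x = top")
      case True
      have "(SUP n. k n x) = (SUP n. of_nat n :: ennreal)" by (simp add: k_def True)
      also have "\<dots> = top" by (rule ennreal_SUP_of_nat_eq_top)
      finally show ?thesis by (simp only: top_greatest)
    next
      case False
      then obtain n where "h x < of_nat n" using ennreal_Ex_less_of_nat[of "h x"] by (auto simp: less_top)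
      then have "k n x = h x" by (simp add: k_def min_absorb1 less_imp_le)
      then show ?thesis by (metis SUP_upper UNIV_I)
    qed
  qed (auto simp: k_def intro: SUP_least)
  then have "(\<integral>\<^sup>+x. h x \<partial>lborel) = (SUP n. \<integral>\<^sup>+x. k n x \<partial>lborel)"
    by (subst nn_integral_monotone_convergence_SUP[symmetric])
      (auto simp: incseq_def le_fun_def k_def intro: min.coboundedI2)
  moreover have "incseq (\<lambda>n. \<integral>\<^sup>+x. k n x \<partial>lborel)"
    unfolding k_def by (intro incseq_SucI nn_integral_mono min.mono order_refl of_nat_mono) simp
  ultimately have "(\<lambda>n. \<integral>\<^sup>+x. k n x \<partial>lborel) \<longlonglongrightarrow> (\<integral>\<^sup>+x. h x \<partial>lborel)"
    by (simp add: LIMSEQ_SUP)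
  then have "(\<lambda>n. (\<integral>\<^sup>+x. k n x \<partial>lborel) + ennreal (\<epsilon> / 2)) \<longlonglongrightarrow> (\<integral>\<^sup>+x. h x \<partial>lborel) + ennreal (\<epsilon> / 2)"
    by (intro tendsto_add tendsto_const)
  moreover have "(\<integral>\<^sup>+x. h x \<partial>lborel) < (\<integral>\<^sup>+x. h x \<partial>lborel) + ennreal (\<epsilon> / 2)"
  proof -
    obtain r where "(\<integral>\<^sup>+x. h x \<partial>lborel) = ennreal r" "0 \<le> r"
      using fin by (cases "\<integral>\<^sup>+x. h x \<partial>lborel" rule: ennreal_cases) auto
    then show ?thesis using e by (simp add: ennreal_plus[symmetric] ennreal_less_iff del: ennreal_plus)
  qed
  ultimately have "\<forall>\<^sub>F n in sequentially. (\<integral>\<^sup>+x. h x \<partial>lborel) < (\<integral>\<^sup>+x. k n x \<partial>lborel) + ennreal (\<epsilon> / 2)"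
    by (rule order_tendstoD(1))
  then obtain n where n: "(\<integral>\<^sup>+x. h x \<partial>lborel) < (\<integral>\<^sup>+x. k n x \<partial>lborel) + ennreal (\<epsilon> / 2)"
    by (auto simp: eventually_sequentially)
  \<comment> \<open>Replaces the subtraction of the integrals over the complement of
    \<open>A\<close>: \<open>a\<close> and \<open>x\<close> stand for the integrals of the truncated
    and the full function over \<open>A\<close>, \<open>c\<close> and \<open>y\<close> for those
    over the complement.\<close>
  have cancel: "x < a + e" if "K = a + c" "H = x + y" "c \<le> y" "H < K + e" for a c e x y H K :: ennreal
  proof (rule ccontr)
    assume "\<not> x < a + e"
    then have "(a + e) + c \<le> x + c" by (intro add_right_mono) simp
    also have "\<dots> \<le> H" unfolding that(2) using that(3) by (rule add_left_mono)
    also note that(4)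
    also have "K + e = (a + e) + c" unfolding that(1) by (simp only: ac_simps)
    finally show False by simp
  qed
  show ?thesis
  \<comment> \<open>Chosen so that \<open>n\<close> times this number is at most \<epsilon>/2;
    \<open>n + 1\<close> avoids a division by 0.\<close>
  proof (intro exI[of _ "\<epsilon> / (2 * (real n + 1))"] conjI ballI impI)
    show "\<epsilon> / (2 * (real n + 1)) > 0" using e by simp
    fix A :: "real set" assume A[measurable]: "A \<in> sets borel" and small: "emeasure lborel A < ennreal (\<epsilon> / (2 * (real n + 1)))"
    let ?kc = "\<integral>\<^sup>+x\<in>-A. k n x \<partial>lborel"
    have "(\<integral>\<^sup>+x. k n x \<partial>lborel) = (\<integral>\<^sup>+x\<in>A. k n x \<partial>lborel) + ?kc"
      by (subst nn_integral_add[symmetric]) (auto intro!: nn_integral_cong simp: indicator_def)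
    moreover have "(\<integral>\<^sup>+x. h x \<partial>lborel) = (\<integral>\<^sup>+x\<in>A. h x \<partial>lborel) + (\<integral>\<^sup>+x\<in>-A. h x \<partial>lborel)"
      by (subst nn_integral_add[symmetric]) (auto intro!: nn_integral_cong simp: indicator_def)
    moreover have "?kc \<le> (\<integral>\<^sup>+x\<in>-A. h x \<partial>lborel)"
      by (intro nn_integral_mono mult_right_mono) (auto simp: k_def)
    ultimately have "(\<integral>\<^sup>+x\<in>A. h x \<partial>lborel) < (\<integral>\<^sup>+x\<in>A. k n x \<partial>lborel) + ennreal (\<epsilon> / 2)"
      using n by (rule cancel)
    also have "\<dots> \<le> ennreal (\<epsilon> / 2) + ennreal (\<epsilon> / 2)"
    proof (rule add_right_mono)
      have "(\<integral>\<^sup>+x\<in>A. k n x \<partial>lborel) \<le> (\<integral>\<^sup>+x. of_nat n * indicator A x \<partial>lborel)"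
        by (intro nn_integral_mono mult_right_mono) (auto simp: k_def)
      also have "\<dots> = ennreal (real n) * emeasure lborel A" by (simp add: nn_integral_cmult_indicator ennreal_of_nat_eq_real_of_nat)
      also have "\<dots> \<le> ennreal (real n) * ennreal (\<epsilon> / (2 * (real n + 1)))"
        using small by (intro mult_left_mono) auto
      also have "\<dots> \<le> ennreal (\<epsilon> / 2)"
        using e by (simp add: ennreal_mult[symmetric] ennreal_leI field_simps)
      finally show "(\<integral>\<^sup>+x\<in>A. k n x \<partial>lborel) \<le> ennreal (\<epsilon> / 2)" .
    qed
    also have "\<dots> = ennreal \<epsilon>" using e by (simp add: ennreal_plus[symmetric] del: ennreal_plus)
    finally show "(\<integral>\<^sup>+x\<in>A. h x \<partial>lborel) < ennreal \<epsilon>" .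
  qed
qed

lemma abs_exp_diff_le:
  fixes p q :: real
  assumes "p \<le> 0" "q \<le> 0" shows "\<bar>exp p - exp q\<bar> \<le> \<bar>p - q\<bar>"
proof -
  have *: "exp p - exp q \<le> p - q" if "q \<le> p" "p \<le> 0" for p q :: real
  proof -
    have "exp p - exp q = exp p * (1 - exp (q - p))" by (simp add: exp_diff algebra_simps)
    also have "\<dots> \<le> 1 * (p - q)"
    proof (rule mult_mono)
      show "1 - exp (q - p) \<le> p - q" using exp_ge_add_one_self[of "q - p"] by linarith
    qed (use that in auto)
    finally show ?thesis by simp
  qed
  show ?thesis
    using *[of q p] *[of p q] assms by (cases "q \<le> p") auto
qed

text \<open>The exponential is differentiated in its upper and in its lower limit. The bound
  \<open>C\<close> makes the exponent Lipschitz in the moving limit, so the exponential is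
  absolutely continuous and its almost everywhere derivative integrates back to its
  increment.\<close>

lemma exp_integral_identities:
  fixes h :: "real \<Rightarrow> real"
  assumes h[measurable]: "h \<in> borel_measurable borel" and nn: "\<And>x. 0 \<le> h x" and bd: "\<And>x. h x \<le> C"
    and wt: "w \<le> t"
  defines "G \<equiv> \<lambda>w t. exp (- (LBINT \<theta>:{w..t}. h \<theta>))"
  shows "ennreal (G w t) + (\<integral>\<^sup>+\<theta>\<in>{w<..<t}. ennreal (h \<theta>) * ennreal (G w \<theta>) \<partial>lborel) = 1"
    and "ennreal (G w t) + (\<integral>\<^sup>+\<theta>\<in>{w<..<t}. ennreal (h \<theta>) * ennreal (G \<theta> t) \<partial>lborel) = 1"
proof -
  have C: "C \<ge> 0" using nn[of 0] bd[of 0] by linarith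
  have si: "set_integrable lborel {p..q} h" for p q
    unfolding set_integrable_def
  proof (rule integrableI_bounded_set_indicator[where B=C])
    show "AE x in lborel. x \<in> {p..q} \<longrightarrow> norm (h x) \<le> C" using nn bd by auto
  qed (auto simp: emeasure_lborel_Icc_eq)
  have io: "h integrable_on {p..q}" for p q
    by (rule set_borel_integral_eq_integral(1)[OF si])
  have eqI: "(LBINT \<theta>:{p..q}. h \<theta>) = integral {p..q} h" for p q
    by (rule set_borel_integral_eq_integral(2)[OF si])
  define F where "F \<theta> = integral {w..\<theta>} h" for \<theta>
  have Fd: "integral {p..q} h = F q - F p" if "w \<le> p" "p \<le> q" for p q
    using Henstock_Kurzweil_Integration.integral_combine[OF that io] by (simp add: F_def)
  have F0: "F w = 0" by (simp add: F_def)
  have bnd: "0 \<le> integral {p..q} h \<and> integral {p..q} h \<le> C * (q - p)" if "p \<le> q" for p q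
  proof
    show "0 \<le> integral {p..q} h" by (intro integral_nonneg io nn)
    have "integral {p..q} h \<le> integral {p..q} (\<lambda>x. C)" by (intro integral_le io bd) auto
    then show "integral {p..q} h \<le> C * (q - p)" using that by (simp add: mult.commute)
  qed
  define N where "N = {x\<in>{w<..<t}. \<not> (F has_real_derivative h x) (at x)} \<union> {w, t}"
  have "negligible N"
    unfolding N_def F_def by (intro negligible_Un integral_has_real_derivative_AE io) auto
  have dF: "(F has_real_derivative h x) (at x)" if "x \<in> {w..t} - N" for x
    using that by (auto simp: N_def)
  \<comment> \<open>Both identities at once: the exponent \<open>c + s * F \<theta>\<close> is the
    integral of \<open>h\<close> over \<open>{w..\<theta>}\<close> for \<open>c = 0\<close>,
    \<open>s = 1\<close>, and over \<open>{\<theta>..t}\<close> for \<open>c = F t\<close>,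
    \<open>s = - 1\<close>. The sign \<open>s\<close> appears squared in the derivative.\<close>
  have main: "ennreal (G w t) + (\<integral>\<^sup>+\<theta>\<in>{w<..<t}. ennreal (h \<theta>) * ennreal (exp (- (c + s * F \<theta>))) \<partial>lborel) = 1"
    if s: "s * (exp (- (c + s * F w)) - exp (- (c + s * F t))) = 1 - G w t" "s * s = 1"
      and np: "\<And>\<theta>. \<theta> \<in> {w..t} \<Longrightarrow> 0 \<le> c + s * F \<theta>" for c s
  proof -
    have s1: "\<bar>s\<bar> = 1" using s(2) by (metis abs_1 abs_mult_self_eq abs_square_eq_1 power2_eq_square)
    define f where "f \<theta> = - s * exp (- (c + s * F \<theta>))" for \<theta>
    have "abs_continuous_on {w..t} f"
    proof (rule abs_continuous_on_lipschitz[OF C])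
      fix p q assume pq: "p \<in> {w..t}" "q \<in> {w..t}" "p < q"
      have "\<bar>f q - f p\<bar> = \<bar>s\<bar> * \<bar>exp (- (c + s * F q)) - exp (- (c + s * F p))\<bar>"
        unfolding f_def abs_mult[symmetric] by (simp add: algebra_simps abs_minus_commute)
      also have "\<dots> \<le> \<bar>(- (c + s * F q)) - (- (c + s * F p))\<bar>"
        unfolding s1 using np[OF pq(1)] np[OF pq(2)] by (simp only: mult_1) (rule abs_exp_diff_le, auto)
      also have "\<dots> = \<bar>s\<bar> * \<bar>F q - F p\<bar>" unfolding abs_mult[symmetric] by (simp add: algebra_simps abs_minus_commute)
      also have "\<dots> \<le> C * (q - p)" using bnd[of p q] Fd[of p q] pq s1 by simp
      finally show "\<bar>f q - f p\<bar> \<le> C * (q - p)" .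
    qed
    moreover have "(f has_real_derivative (h x * exp (- (c + s * F x)))) (at x within {w..t})" if "x \<in> {w..t} - N" for x
    proof -
      have "(f has_real_derivative (- s * (exp (- (c + s * F x)) * (- (s * h x))))) (at x)"
        unfolding f_def by (auto intro!: derivative_eq_intros dF[OF that])
      moreover have "- s * (exp (- (c + s * F x)) * (- (s * h x))) = (s * s) * (h x * exp (- (c + s * F x)))"
        by (simp only: mult_minus_left mult_minus_right minus_minus mult.assoc mult.commute mult.left_commute)
      ultimately have "(f has_real_derivative ((s * s) * (h x * exp (- (c + s * F x))))) (at x)" by (simp only:)
      then show ?thesis unfolding s(2) mult_1 by (rule has_field_derivative_at_within)
    qed
    ultimately have "((\<lambda>x. h x * exp (- (c + s * F x))) has_integral (f t - f w)) {w..t}"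
      by (rule abs_continuous_on_has_integral[OF _ wt \<open>negligible N\<close>])
    moreover have "f t - f w = 1 - G w t" using s(1) by (simp add: f_def algebra_simps)
    ultimately have hi: "((\<lambda>x. h x * exp (- (c + s * F x))) has_integral (1 - G w t)) {w..t}" by simp
    have "(\<integral>\<^sup>+\<theta>\<in>{w..t}. ennreal (h \<theta> * exp (- (c + s * F \<theta>))) \<partial>lborel) = ennreal (1 - G w t)"
      by (rule nn_integral_has_integral_lebesgue'[OF _ hi]) (simp add: nn)
    then have "(\<integral>\<^sup>+\<theta>\<in>{w<..<t}. ennreal (h \<theta>) * ennreal (exp (- (c + s * F \<theta>))) \<partial>lborel) = ennreal (1 - G w t)"
      by (simp add: nn_integral_Icc_eq_Ioo ennreal_mult nn)
    moreover have "0 \<le> 1 - G w t" using bnd[OF wt] by (simp add: G_def eqI)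
    moreover have "0 \<le> G w t" by (simp add: G_def)
    ultimately show ?thesis by (simp add: ennreal_plus[symmetric] del: ennreal_plus)
  qed
  have Fnn: "0 \<le> F \<theta>" for \<theta> unfolding F_def by (intro integral_nonneg io nn)
  have Gw: "G w \<theta> = exp (- (0 + 1 * F \<theta>))" for \<theta> by (simp add: G_def eqI F_def)
  have Gt: "G \<theta> t = exp (- (F t + (- 1) * F \<theta>))" if "\<theta> \<in> {w..t}" for \<theta>
    using that Fd[of \<theta> t] by (simp add: G_def eqI)
  have "ennreal (G w t) + (\<integral>\<^sup>+\<theta>\<in>{w<..<t}. ennreal (h \<theta>) * ennreal (exp (- (0 + 1 * F \<theta>))) \<partial>lborel) = 1"
    by (rule main) (simp_all add: Gw F0 Fnn)
  then show "ennreal (G w t) + (\<integral>\<^sup>+\<theta>\<in>{w<..<t}. ennreal (h \<theta>) * ennreal (G w \<theta>) \<partial>lborel) = 1"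
    by (simp only: Gw)
  have "ennreal (G w t) + (\<integral>\<^sup>+\<theta>\<in>{w<..<t}. ennreal (h \<theta>) * ennreal (exp (- (F t + (- 1) * F \<theta>))) \<partial>lborel) = 1"
  proof (rule main)
    show "0 \<le> F t + (- 1) * F \<theta>" if "\<theta> \<in> {w..t}" for \<theta>
      using bnd[of \<theta> t] Fd[of \<theta> t] that by simp
  qed (simp_all add: Gw F0)
  moreover have "(\<integral>\<^sup>+\<theta>\<in>{w<..<t}. ennreal (h \<theta>) * ennreal (G \<theta> t) \<partial>lborel) =
      (\<integral>\<^sup>+\<theta>\<in>{w<..<t}. ennreal (h \<theta>) * ennreal (exp (- (F t + (- 1) * F \<theta>))) \<partial>lborel)"
    by (rule nn_integral_cong) (auto simp: indicator_def Gt)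
  ultimately show "ennreal (G w t) + (\<integral>\<^sup>+\<theta>\<in>{w<..<t}. ennreal (h \<theta>) * ennreal (G \<theta> t) \<partial>lborel) = 1"
    by (simp only:)
qed

section \<open>Integral and differential form of a scalar balance\<close>

text \<open>The bound \<open>b x \<le> K * f x\<close> makes \<open>b\<close> bounded on
  \<open>]u,t]\<close>, because \<open>f\<close> is bounded there: near \<open>u\<close> by its
  limit, on the rest by continuity. Integrability of \<open>v\<close> follows, as \<open>v\<close>
  is the sum of \<open>b\<close> and a derivative that integrates to an increment of
  \<open>f\<close>.\<close>

lemma abs_continuous_balance:
  fixes f b v :: "real \<Rightarrow> real"
  assumes ac: "abs_continuous_on {u<..<s} f" and lim: "(f \<longlongrightarrow> L) (at_right u)"
    and t: "u < t" "t < s"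
    and b[measurable]: "b \<in> borel_measurable borel" and v[measurable]: "v \<in> borel_measurable borel"
    and nn: "\<And>x. 0 \<le> f x" "\<And>x. 0 \<le> b x" "\<And>x. 0 \<le> v x" "0 \<le> L"
    and bK: "\<And>x. x \<in> {u<..<s} \<Longrightarrow> b x \<le> K * f x" and K: "K \<ge> 0"
    and der: "AE x in lborel. x \<in> {u<..<s} \<longrightarrow> (f has_real_derivative (v x - b x)) (at x)"
  shows "ennreal (f t) + (\<integral>\<^sup>+w\<in>{u<..<t}. ennreal (b w) \<partial>lborel) = ennreal L + (\<integral>\<^sup>+w\<in>{u<..<t}. ennreal (v w) \<partial>lborel)"
    and "(\<integral>\<^sup>+w\<in>{u<..<t}. ennreal (b w) \<partial>lborel) < \<infinity>"
proof -
  obtain N where N: "N \<in> null_sets lborel" "{x \<in> space lborel. \<not> (x \<in> {u<..<s} \<longrightarrow> (f has_real_derivative (v x - b x)) (at x))} \<subseteq> N"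
    using der by (auto simp: eventually_ae_filter)
  have negl: "negligible N" unfolding negligible_iff_null_sets using N(1) by (rule null_sets_completionI)
  have dN: "(f has_real_derivative (v x - b x)) (at x)" if "x \<in> {u<..<s}" "x \<notin> N" for x
    using N(2) that by auto
  have ac': "abs_continuous_on {a..t} f" if "u < a" for a
    by (rule abs_continuous_on_subset[OF ac]) (use that t in auto)
  have cont: "continuous_on {a..t} f" if "u < a" for a
    by (rule abs_continuous_on_imp_continuous_on[OF ac'[OF that]])
  have bdd: "\<exists>c. \<forall>x\<in>{a..t}. f x \<le> c" if "u < a" for a
  proof -
    have "bounded (f ` {a..t})" by (intro compact_imp_bounded compact_continuous_image cont that compact_Icc)
    then obtain c where "\<forall>y\<in>f ` {a..t}. \<bar>y\<bar> \<le> c" unfolding bounded_iff real_norm_def by blast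
    then show ?thesis by (intro exI[of _ c] ballI) (auto dest: bspec)
  qed
  have "\<forall>\<^sub>F x in at_right u. f x < L + 1" using lim by (rule order_tendstoD(2)) simp
  then obtain a0 where a0: "a0 > u" "\<And>y. u < y \<Longrightarrow> y < a0 \<Longrightarrow> f y < L + 1"
    unfolding eventually_at_right_field by blast
  obtain c0 where c0: "\<And>x. x \<in> {a0..t} \<Longrightarrow> f x \<le> c0" using bdd[OF a0(1)] by blast
  define c where "c = max (L + 1) c0"
  have fc: "f x \<le> c" if "u < x" "x \<le> t" for x
  proof (cases "x < a0")
    case True
    then show ?thesis using a0(2)[OF that(1) True] by (simp add: c_def)
  next
    case False
    then show ?thesis using c0[of x] that by (simp add: c_def le_max_iff_disj)
  qed
  have bc: "b x \<le> K * c" if "u < x" "x \<le> t" for x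
  proof -
    have "b x \<le> K * f x" using that t by (intro bK) auto
    also have "\<dots> \<le> K * c" using fc[OF that] K by (rule mult_left_mono)
    finally show ?thesis .
  qed
  have "(\<integral>\<^sup>+w\<in>{u<..<t}. ennreal (b w) \<partial>lborel) \<le> (\<integral>\<^sup>+w. ennreal (K * c) * indicator {u<..<t} w \<partial>lborel)"
    by (intro nn_integral_mono) (auto simp: indicator_def intro!: ennreal_leI bc)
  also have "\<dots> = ennreal (K * c) * ennreal (t - u)"
    using t by (subst nn_integral_cmult_indicator) auto
  also have "\<dots> < \<infinity>" by (simp add: ennreal_mult_less_top)
  finally show fin: "(\<integral>\<^sup>+w\<in>{u<..<t}. ennreal (b w) \<partial>lborel) < \<infinity>" .
  have step: "ennreal (f t) + (\<integral>\<^sup>+w\<in>{a..t}. ennreal (b w) \<partial>lborel) = ennreal (f a) + (\<integral>\<^sup>+w\<in>{a..t}. ennreal (v w) \<partial>lborel)"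
    if a: "u < a" "a \<le> t" for a
  proof -
    have hi: "((\<lambda>x. v x - b x) has_integral f t - f a) {a..t}"
    proof (rule abs_continuous_on_has_integral[OF ac'[OF a(1)] a(2) negl])
      fix x assume "x \<in> {a..t} - N"
      then show "(f has_real_derivative v x - b x) (at x within {a..t})"
        by (intro has_field_derivative_at_within[OF dN]) (use a t in auto)
    qed
    have "(\<integral>\<^sup>+w\<in>{a..t}. ennreal (b w) \<partial>lborel) \<le> (\<integral>\<^sup>+w\<in>{u..t}. ennreal (b w) \<partial>lborel)"
      using a by (intro nn_integral_mono) (auto simp: indicator_def)
    also have "\<dots> = (\<integral>\<^sup>+w\<in>{u<..<t}. ennreal (b w) \<partial>lborel)"
      by (rule nn_integral_Icc_eq_Ioo)
    also note fin
    finally have fa: "(\<integral>\<^sup>+w\<in>{a..t}. ennreal (b w) \<partial>lborel) < \<infinity>" .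
    have bi: "b integrable_on {a..t}" "(\<integral>\<^sup>+w\<in>{a..t}. ennreal (b w) \<partial>lborel) = ennreal (integral {a..t} b)"
      by (rule integrable_on_of_nn_integral[OF b nn(2) _ fa]; simp)+
    have "((\<lambda>x. (v x - b x) + b x) has_integral (f t - f a) + integral {a..t} b) {a..t}"
      by (rule has_integral_add[OF hi integrable_integral[OF bi(1)]])
    then have vi: "(v has_integral (f t - f a) + integral {a..t} b) {a..t}" by simp
    have vint: "(\<integral>\<^sup>+w\<in>{a..t}. ennreal (v w) \<partial>lborel) = ennreal ((f t - f a) + integral {a..t} b)"
      by (rule nn_integral_has_integral_lebesgue'[OF nn(3) vi])
    have nnv: "0 \<le> (f t - f a) + integral {a..t} b"
      by (rule has_integral_nonneg[OF vi nn(3)])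
    have nnb: "0 \<le> integral {a..t} b" by (intro integral_nonneg bi nn)
    have "ennreal (f t) + ennreal (integral {a..t} b) = ennreal (f t + integral {a..t} b)"
      by (rule ennreal_plus[symmetric, OF nn(1) nnb])
    also have "f t + integral {a..t} b = f a + ((f t - f a) + integral {a..t} b)" by simp
    also have "ennreal \<dots> = ennreal (f a) + ennreal ((f t - f a) + integral {a..t} b)"
      by (rule ennreal_plus[OF nn(1) nnv])
    finally show ?thesis unfolding bi(2) vint .
  qed
  \<comment> \<open>Absolute continuity is known on the open interval only, so the fundamental
    theorem is applied on \<open>{a n..t}\<close> and the left end then tends to
    \<open>u\<close>.\<close>
  define a where "a n = u + (t - u) / real (n + 2)" for n :: nat
  have a: "u < a n" "a n \<le> t" for n
  proof -
    show "u < a n" using t by (simp add: a_def)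
    have "(t - u) / real (n + 2) \<le> (t - u) / 1" using t by (intro divide_left_mono) auto
    then show "a n \<le> t" by (simp add: a_def)
  qed
  have a_lim: "a \<longlonglongrightarrow> u"
  proof -
    have "(\<lambda>n. u + (t - u) / real (n + 2)) \<longlonglongrightarrow> u + 0"
      by (intro tendsto_add tendsto_const LIMSEQ_ignore_initial_segment[OF lim_const_over_n])
    then show ?thesis by (simp add: a_def[abs_def])
  qed
  have a_dec: "a n \<le> a m" if "m \<le> n" for m n
    using that t by (auto simp: a_def intro!: divide_left_mono)
  have un: "(\<Union>n. {a n..t}) = {u<..t}"
  proof (intro equalityI subsetI)
    fix x assume x: "x \<in> {u<..t}"
    then have "\<forall>\<^sub>F n in sequentially. a n < x" by (intro order_tendstoD(2)[OF a_lim]) auto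
    then obtain n where "a n < x" by (auto simp: eventually_sequentially)
    then show "x \<in> (\<Union>n. {a n..t})" using x by (intro UN_I[of n]) auto
  next
    fix x assume "x \<in> (\<Union>n. {a n..t})"
    then obtain n where "a n \<le> x" "x \<le> t" by auto
    then show "x \<in> {u<..t}" using a(1)[of n] by simp
  qed
  have conv: "(\<lambda>n. \<integral>\<^sup>+w\<in>{a n..t}. ennreal (h w) \<partial>lborel) \<longlonglongrightarrow> (\<integral>\<^sup>+w\<in>{u<..<t}. ennreal (h w) \<partial>lborel)"
    if [measurable]: "h \<in> borel_measurable borel" for h :: "real \<Rightarrow> real"
  proof -
    \<comment> \<open>Convergence of the integrals over growing intervals is continuity from below
      of the measure with density \<open>h\<close>.\<close>
    let ?D = "density lborel (\<lambda>w. ennreal (h w))"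
    have "(\<lambda>n. emeasure ?D {a n..t}) \<longlonglongrightarrow> emeasure ?D (\<Union>n. {a n..t})"
      by (rule Lim_emeasure_incseq) (auto simp: incseq_def intro: order_trans[OF a_dec])
    then have "(\<lambda>n. \<integral>\<^sup>+w\<in>{a n..t}. ennreal (h w) \<partial>lborel) \<longlonglongrightarrow> (\<integral>\<^sup>+w\<in>{u<..t}. ennreal (h w) \<partial>lborel)"
      unfolding un by (simp add: emeasure_density)
    also have "(\<integral>\<^sup>+w\<in>{u<..t}. ennreal (h w) \<partial>lborel) = (\<integral>\<^sup>+w\<in>{u<..<t}. ennreal (h w) \<partial>lborel)"
      by (rule nn_integral_Ioc_eq_Ioo)
    finally show ?thesis .
  qed
  have "(\<lambda>n. ennreal (f t) + (\<integral>\<^sup>+w\<in>{a n..t}. ennreal (b w) \<partial>lborel)) \<longlonglongrightarrow>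
      ennreal (f t) + (\<integral>\<^sup>+w\<in>{u<..<t}. ennreal (b w) \<partial>lborel)"
    by (intro tendsto_add tendsto_const conv b)
  moreover have "(\<lambda>n. ennreal (f (a n)) + (\<integral>\<^sup>+w\<in>{a n..t}. ennreal (v w) \<partial>lborel)) \<longlonglongrightarrow>
      ennreal L + (\<integral>\<^sup>+w\<in>{u<..<t}. ennreal (v w) \<partial>lborel)"
  proof (intro tendsto_add conv v tendsto_ennrealI)
    have "filterlim a (at_right u) sequentially"
      unfolding filterlim_at using a_lim a(1) by (auto intro!: always_eventually)
    then show "(\<lambda>n. f (a n)) \<longlonglongrightarrow> L" by (rule filterlim_compose[OF lim])
  qed
  ultimately show "ennreal (f t) + (\<integral>\<^sup>+w\<in>{u<..<t}. ennreal (b w) \<partial>lborel) = ennreal L + (\<integral>\<^sup>+w\<in>{u<..<t}. ennreal (v w) \<partial>lborel)"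
    unfolding step[OF a] by (rule LIMSEQ_unique)
qed

text \<open>Finite integrals allow subtraction, so \<open>f\<close> is \<open>L\<close> plus the
  indefinite integral of \<open>v - b\<close>. Its limit at \<open>u\<close>, derivative and
  absolute continuity are those of an indefinite integral.\<close>

lemma balance_abs_continuous:
  fixes f b v :: "real \<Rightarrow> real"
  assumes us: "u < s"
    and b[measurable]: "b \<in> borel_measurable borel" and v[measurable]: "v \<in> borel_measurable borel"
    and nn: "\<And>x. 0 \<le> f x" "\<And>x. 0 \<le> b x" "\<And>x. 0 \<le> v x" "0 \<le> L"
    and fin: "(\<integral>\<^sup>+w\<in>{u<..<s}. ennreal (b w) \<partial>lborel) < \<infinity>" "(\<integral>\<^sup>+w\<in>{u<..<s}. ennreal (v w) \<partial>lborel) < \<infinity>"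
    and bal: "\<And>t. t \<in> {u<..<s} \<Longrightarrow> ennreal (f t) + (\<integral>\<^sup>+w\<in>{u<..<t}. ennreal (b w) \<partial>lborel) =
      ennreal L + (\<integral>\<^sup>+w\<in>{u<..<t}. ennreal (v w) \<partial>lborel)"
  shows "(f \<longlongrightarrow> L) (at_right u)" "abs_continuous_on {u<..<s} f"
    "AE t in lborel. t \<in> {u<..<s} \<longrightarrow> (f has_real_derivative (v t - b t)) (at t)"
proof -
  have int: "h integrable_on {p..q}" "(\<integral>\<^sup>+w\<in>{p..q}. ennreal (h w) \<partial>lborel) = ennreal (integral {p..q} h)"
    if h: "h \<in> borel_measurable borel" "\<And>x. 0 \<le> h x" "(\<integral>\<^sup>+w\<in>{u<..<s}. ennreal (h w) \<partial>lborel) < \<infinity>"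
      and pq: "u \<le> p" "q \<le> s" for h p q
  proof -
    have "(\<integral>\<^sup>+w\<in>{p..q}. ennreal (h w) \<partial>lborel) \<le> (\<integral>\<^sup>+w\<in>{u..s}. ennreal (h w) \<partial>lborel)"
      using pq by (intro nn_integral_mono) (auto simp: indicator_def)
    also have "\<dots> < \<infinity>" unfolding nn_integral_Icc_eq_Ioo by (rule h(3))
    finally have *: "(\<integral>\<^sup>+w\<in>{p..q}. ennreal (h w) \<partial>lborel) < \<infinity>" .
    show "h integrable_on {p..q}" "(\<integral>\<^sup>+w\<in>{p..q}. ennreal (h w) \<partial>lborel) = ennreal (integral {p..q} h)"
      by (rule integrable_on_of_nn_integral[OF h(1,2) _ *]; simp)+
  qed
  note intb = int[OF b nn(2) fin(1)] and intv = int[OF v nn(3) fin(2)]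
  define g where "g x = v x - b x" for x
  have gi: "g integrable_on {p..q}" if "u \<le> p" "q \<le> s" for p q
    unfolding g_def[abs_def] by (intro integrable_diff intb intv that)
  have f_eq: "f t = L + integral {u..t} g" if t: "t \<in> {u<..<s}" for t
  proof -
    have "ennreal (f t) + ennreal (integral {u..t} b) = ennreal L + ennreal (integral {u..t} v)"
      using bal[OF t] intb(2)[of u t] intv(2)[of u t] t by (simp add: nn_integral_Icc_eq_Ioo)
    moreover have "0 \<le> integral {u..t} b" "0 \<le> integral {u..t} v"
      using t by (auto intro!: integral_nonneg intb intv nn)
    ultimately have "f t + integral {u..t} b = L + integral {u..t} v"
      using nn by (simp add: ennreal_plus[symmetric] del: ennreal_plus)
    moreover have "integral {u..t} g = integral {u..t} v - integral {u..t} b"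
      unfolding g_def[abs_def] using t by (intro integral_diff intb intv) auto
    ultimately show ?thesis by linarith
  qed
  have cont: "continuous_on {u..s} (\<lambda>t. L + integral {u..t} g)"
    by (intro continuous_on_add continuous_on_const indefinite_integral_continuous_1 gi) auto
  have "u \<in> {u..s}" using us by simp
  then have "((\<lambda>t. L + integral {u..t} g) \<longlongrightarrow> L + integral {u..u} g) (at u within {u..s})"
    by (rule bspec[OF cont[unfolded continuous_on_def]])
  moreover have "at u within {u..s} = at_right u" using us by (simp add: at_within_Icc_at_right)
  ultimately have "((\<lambda>t. L + integral {u..t} g) \<longlongrightarrow> L) (at_right u)" by simp
  moreover have "\<forall>\<^sub>F t in at_right u. L + integral {u..t} g = f t"
    unfolding eventually_at_right_field using us f_eq by (intro exI[of _ s]) auto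
  ultimately show "(f \<longlongrightarrow> L) (at_right u)" by (rule Lim_transform_eventually)
  have "negligible {x\<in>{u<..<s}. \<not> ((\<lambda>t. integral {u..t} g) has_real_derivative g x) (at x)}"
    by (rule integral_has_real_derivative_AE[OF gi]) auto
  then have "AE x in lebesgue. x \<notin> {x\<in>{u<..<s}. \<not> ((\<lambda>t. integral {u..t} g) has_real_derivative g x) (at x)}"
    unfolding negligible_iff_null_sets by (rule AE_not_in)
  then have "AE x in lborel. x \<notin> {x\<in>{u<..<s}. \<not> ((\<lambda>t. integral {u..t} g) has_real_derivative g x) (at x)}"
    by (simp only: AE_completion_iff)
  then show "AE t in lborel. t \<in> {u<..<s} \<longrightarrow> (f has_real_derivative (v t - b t)) (at t)"
  proof eventually_elim
    case (elim t)
    show ?case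
    proof
      assume t: "t \<in> {u<..<s}"
      then have "((\<lambda>t. integral {u..t} g) has_real_derivative g t) (at t)" using elim by blast
      then have "((\<lambda>t. L + integral {u..t} g) has_real_derivative g t) (at t)"
        by (auto intro!: derivative_eq_intros)
      then have "(f has_real_derivative g t) (at t)"
        by (rule has_field_derivative_transform_within_open[OF _ open_greaterThanLessThan t]) (simp add: f_eq)
      then show "(f has_real_derivative (v t - b t)) (at t)" by (simp add: g_def)
    qed
  qed
  \<comment> \<open>Dominates the absolute value of \<open>v - b\<close> on the interval and
    vanishes outside, so that one integrable function on the line bounds all increments of
    \<open>f\<close>.\<close>
  define h where "h x = ennreal (v x + b x) * indicator {u<..<s} x" for x
  have h[measurable]: "h \<in> borel_measurable borel" unfolding h_def by measurable
  have hfin: "(\<integral>\<^sup>+x. h x \<partial>lborel) < \<infinity>"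
  proof -
    have "(\<integral>\<^sup>+x. h x \<partial>lborel) = (\<integral>\<^sup>+w\<in>{u<..<s}. ennreal (v w) \<partial>lborel) + (\<integral>\<^sup>+w\<in>{u<..<s}. ennreal (b w) \<partial>lborel)"
      unfolding h_def using nn by (subst nn_integral_add[symmetric]) (auto intro!: nn_integral_cong simp: distrib_right)
    then show ?thesis using fin by simp
  qed
  have incr: "ennreal \<bar>f q - f p\<bar> \<le> (\<integral>\<^sup>+x\<in>{p<..<q}. h x \<partial>lborel)" if pq: "p \<in> {u<..<s}" "q \<in> {u<..<s}" "p < q" for p q
  proof -
    have "f q - f p = integral {p..q} g"
      using Henstock_Kurzweil_Integration.integral_combine[of u p q g] gi[of u q] pq f_eq[OF pq(1)] f_eq[OF pq(2)] by simp
    also have "\<bar>\<dots>\<bar> \<le> integral {p..q} (\<lambda>x. v x + b x)"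
    proof -
      have "norm (integral {p..q} g) \<le> integral {p..q} (\<lambda>x. v x + b x)"
      proof (rule integral_norm_bound_integral)
        show "g integrable_on {p..q}" "(\<lambda>x. v x + b x) integrable_on {p..q}"
          using pq by (auto intro!: gi integrable_add intv intb)
        show "norm (g x) \<le> v x + b x" for x using nn(2,3)[of x] by (simp add: g_def)
      qed
      then show ?thesis by simp
    qed
    finally have "ennreal \<bar>f q - f p\<bar> \<le> ennreal (integral {p..q} (\<lambda>x. v x + b x))" by (rule ennreal_leI)
    also have "\<dots> = (\<integral>\<^sup>+w\<in>{p..q}. ennreal (v w + b w) \<partial>lborel)"
    proof (rule nn_integral_has_integral_lebesgue'[symmetric])
      show "0 \<le> v x + b x" for x using nn(2,3)[of x] by simp
      show "((\<lambda>x. v x + b x) has_integral integral {p..q} (\<lambda>x. v x + b x)) {p..q}"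
        using pq by (intro integrable_integral integrable_add intv intb) auto
    qed
    also have "\<dots> = (\<integral>\<^sup>+x\<in>{p<..<q}. h x \<partial>lborel)"
      unfolding nn_integral_Icc_eq_Ioo using pq by (intro nn_integral_cong) (auto simp: h_def indicator_def)
    finally show ?thesis .
  qed
  show "abs_continuous_on {u<..<s} f"
    unfolding abs_continuous_on_iff
  proof (intro allI impI)
    fix \<epsilon> :: real assume e: "\<epsilon> > 0"
    from nn_integral_small_sets[OF h hfin e]
    obtain \<delta> where d: "\<delta> > 0" and small: "\<And>A. A \<in> sets borel \<Longrightarrow> emeasure lborel A < ennreal \<delta> \<Longrightarrow> (\<integral>\<^sup>+x\<in>A. h x \<partial>lborel) < ennreal \<epsilon>"
      by blast
    show "\<exists>\<delta>>0. \<forall>D. short_family {u<..<s} \<delta> D \<longrightarrow> (\<Sum>(a, b)\<in>D. \<bar>f b - f a\<bar>) < \<epsilon>"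
    proof (intro exI[of _ \<delta>] conjI d allI impI)
      fix D assume D: "short_family {u<..<s} \<delta> D"
      define I where "I = (\<lambda>(a::real, b::real). {a<..<b})"
      have finD: "finite D" and disj: "disjoint_family_on I D" and sub: "D \<subseteq> {u<..<s} \<times> {u<..<s}"
        and lt: "\<And>i. i \<in> D \<Longrightarrow> fst i < snd i" and len: "(\<Sum>i\<in>D. snd i - fst i) < \<delta>"
        using D by (auto simp: short_family_def I_def case_prod_beta)
      have I: "I i \<in> sets borel" for i by (simp add: I_def case_prod_beta)
      have "emeasure lborel (\<Union>i\<in>D. I i) = (\<Sum>i\<in>D. emeasure lborel (I i))"
        by (rule sum_emeasure[symmetric]) (auto simp: I finD disj)
      also have "\<dots> = (\<Sum>i\<in>D. ennreal (snd i - fst i))"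
        using lt by (intro sum.cong) (auto simp: I_def case_prod_beta less_imp_le)
      also have "\<dots> = ennreal (\<Sum>i\<in>D. snd i - fst i)"
        by (rule sum_ennreal) (use lt in \<open>simp add: less_imp_le\<close>)
      also have "\<dots> < ennreal \<delta>" using len d by (simp add: ennreal_lessI)
      finally have "emeasure lborel (\<Union>i\<in>D. I i) < ennreal \<delta>" .
      then have *: "(\<integral>\<^sup>+x\<in>(\<Union>i\<in>D. I i). h x \<partial>lborel) < ennreal \<epsilon>"
        using I finD by (intro small sets.finite_UN) auto
      have "ennreal (\<Sum>i\<in>D. \<bar>f (snd i) - f (fst i)\<bar>) = (\<Sum>i\<in>D. ennreal \<bar>f (snd i) - f (fst i)\<bar>)"
        by (rule sum_ennreal[symmetric]) simp
      \<comment> \<open>Each increment is at most the \<open>h\<close>-mass of its own interval; the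
        intervals are disjoint, so these masses add up to that of the union, a set of small
        length.\<close>
      also have "\<dots> \<le> (\<Sum>i\<in>D. emeasure (density lborel h) (I i))"
      proof (rule sum_mono)
        fix i assume i: "i \<in> D"
        then have "fst i \<in> {u<..<s}" "snd i \<in> {u<..<s}" using sub by auto
        from incr[OF this lt[OF i]] show "ennreal \<bar>f (snd i) - f (fst i)\<bar> \<le> emeasure (density lborel h) (I i)"
          using I[of i] by (simp add: emeasure_density I_def case_prod_beta)
      qed
      also have "\<dots> = emeasure (density lborel h) (\<Union>i\<in>D. I i)"
        by (rule sum_emeasure) (auto simp: I finD disj)
      also have "\<dots> = (\<integral>\<^sup>+x\<in>(\<Union>i\<in>D. I i). h x \<partial>lborel)"
        using I finD by (intro emeasure_density) auto
      also note *
      finally have "(\<Sum>i\<in>D. \<bar>f (snd i) - f (fst i)\<bar>) < \<epsilon>"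
        using e by (simp add: ennreal_less_iff sum_nonneg)
      then show "(\<Sum>(a, b)\<in>D. \<bar>f b - f a\<bar>) < \<epsilon>" by (simp add: case_prod_beta)
    qed
  qed
qed

section \<open>Analytic sets and separation\<close>

text \<open>Projections along sequences of reals instead of sequences of naturals; over a Polish
  space both give the analytic (Suslin) sets.\<close>

definition analytic_set :: "'z::topological_space set \<Rightarrow> bool" where
  "analytic_set A \<longleftrightarrow> (\<exists>C::('z \<times> (nat \<Rightarrow> real)) set. closed C \<and> A = fst ` C)"

lemma closed_imp_analytic_set:
  assumes "closed F" shows "analytic_set F"
  unfolding analytic_set_def
  by (intro exI[of _ "F \<times> UNIV"]) (auto simp: assms closed_Times)

lemma continuous_snd_coordinate [continuous_intros]:
  "continuous_on S (\<lambda>p::'z::topological_space \<times> (nat \<Rightarrow> real). snd p k)"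
  by (rule continuous_on_compose2[OF continuous_on_product_coordinates continuous_on_snd[OF continuous_on_id]]) auto

text \<open>Coordinate 0 of the auxiliary sequence carries the index of the set, the shifted
  sequence carries the witness.\<close>

lemma analytic_set_UN:
  assumes "\<And>n::nat. analytic_set (A n)"
  shows "analytic_set (\<Union>n. A n)"
proof -
  obtain C :: "nat \<Rightarrow> ('a \<times> (nat \<Rightarrow> real)) set" where C: "\<And>n. closed (C n)" "\<And>n. A n = fst ` C n"
    using assms unfolding analytic_set_def by metis
  define sh where "sh = (\<lambda>p::'a \<times> (nat \<Rightarrow> real). (fst p, \<lambda>k. snd p (Suc k)))"
  have sh: "continuous_on UNIV sh"
    unfolding sh_def by (intro continuous_intros continuous_on_coordinatewise_then_product)
  \<comment> \<open>That \<open>n\<close> is not the index is expressed as distance at least 1/2,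
    which for natural values means being different and is a closed condition.\<close>
  define D where "D = (\<lambda>p::'a \<times> (nat \<Rightarrow> real). snd p 0) -` \<nat> \<inter>
      (\<Inter>n. {p. 1 / 2 \<le> \<bar>snd p 0 - real n\<bar>} \<union> sh -` C n)"
  have "closed D"
    unfolding D_def
    by (intro closed_Int closed_INT ballI closed_Un closed_vimage closed_Nats continuous_intros
        closed_Collect_le C(1) sh)
  moreover have "(\<Union>n. A n) = fst ` D"
  proof (intro equalityI subsetI)
    fix z assume "z \<in> (\<Union>n. A n)"
    then obtain n \<sigma> where n: "(z, \<sigma>) \<in> C n" unfolding C(2) by auto
    have far: "1 / 2 \<le> \<bar>real n - real m\<bar>" if "m \<noteq> n" for m
      using that by linarith
    have "(z, case_nat (real n) \<sigma>) \<in> D"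
      unfolding D_def
    proof (intro IntI INT_I)
      fix m show "(z, case_nat (real n) \<sigma>) \<in> {p. 1 / 2 \<le> \<bar>snd p 0 - real m\<bar>} \<union> sh -` C m"
        using n far[of m] by (cases "m = n") (auto simp: sh_def)
    qed simp
    then show "z \<in> fst ` D" by force
  next
    fix z assume "z \<in> fst ` D"
    then obtain \<sigma> where s: "(z, \<sigma>) \<in> D" by auto
    then obtain n where n: "\<sigma> 0 = real n" by (auto simp: D_def Nats_def)
    then have "sh (z, \<sigma>) \<in> C n" using s unfolding D_def by force
    then have "fst (sh (z, \<sigma>)) \<in> A n" unfolding C(2) by blast
    then show "z \<in> (\<Union>n. A n)" by (auto simp: sh_def)
  qed
  ultimately show ?thesis unfolding analytic_set_def by blast
qed

text \<open>One sequence encodes the witnesses for all sets as the rows of a matrix, read off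
  through \<open>prod_encode\<close>.\<close>

lemma analytic_set_INT:
  assumes "\<And>n::nat. analytic_set (A n)"
  shows "analytic_set (\<Inter>n. A n)"
proof -
  obtain C :: "nat \<Rightarrow> ('a \<times> (nat \<Rightarrow> real)) set" where C: "\<And>n. closed (C n)" "\<And>n. A n = fst ` C n"
    using assms unfolding analytic_set_def by metis
  define row where "row n = (\<lambda>p::'a \<times> (nat \<Rightarrow> real). (fst p, \<lambda>k. snd p (prod_encode (n, k))))" for n
  have row: "continuous_on UNIV (row n)" for n
    unfolding row_def by (intro continuous_intros continuous_on_coordinatewise_then_product)
  define D where "D = (\<Inter>n. row n -` C n)"
  have "closed D"
    unfolding D_def by (intro closed_INT ballI closed_vimage C(1) row)
  moreover have "(\<Inter>n. A n) = fst ` D"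
  proof (intro equalityI subsetI)
    fix z assume "z \<in> (\<Inter>n. A n)"
    then have "\<forall>n. \<exists>\<sigma>. (z, \<sigma>) \<in> C n" unfolding C(2) by force
    then obtain \<sigma> where \<sigma>: "\<And>n. (z, \<sigma> n) \<in> C n" by metis
    have "(z, \<lambda>m. case prod_decode m of (n, k) \<Rightarrow> \<sigma> n k) \<in> D"
      using \<sigma> by (auto simp: D_def row_def)
    then show "z \<in> fst ` D" by force
  next
    fix z assume "z \<in> fst ` D"
    then obtain \<sigma> where s: "(z, \<sigma>) \<in> D" by auto
    have "z \<in> A n" for n
    proof -
      have "fst (row n (z, \<sigma>)) \<in> A n" using s unfolding C(2) D_def by blast
      then show ?thesis by (simp add: row_def)
    qed
    then show "z \<in> (\<Inter>n. A n)" by blast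
  qed
  ultimately show ?thesis unfolding analytic_set_def by blast
qed

text \<open>Analytic sets are not closed under complement, so the induction over the Borel sets
  carries a set and its complement together. It starts because in a metric space the complement of a
  closed set is a countable union of closed sets.\<close>

lemma borel_imp_analytic_set:
  fixes A :: "'z::metric_space set"
  assumes "A \<in> sets borel"
  shows "analytic_set A"
proof -
  have "A \<in> sigma_sets UNIV (Collect closed)"
    using assms unfolding borel_eq_closed by simp
  then have "analytic_set A \<and> analytic_set (- A)"
  proof induction
    case (Basic F)
    then have F: "closed F" by simp
    have "analytic_set (- F)"
    proof (cases "F = {}")
      case False
      have "- F = (\<Union>n. {x. inverse (real (Suc n)) \<le> infdist x F})"
      proof (intro equalityI subsetI)
        fix x assume "x \<in> - F"
        then have "infdist x F \<noteq> 0" using in_closed_iff_infdist_zero[OF F False, of x] by simp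
        then have "0 < infdist x F" using infdist_nonneg[of x F] by linarith
        then obtain n where "inverse (real (Suc n)) < infdist x F" using reals_Archimedean by blast
        then show "x \<in> (\<Union>n. {x. inverse (real (Suc n)) \<le> infdist x F})"
          by (intro UN_I[of n]) auto
      next
        fix x assume "x \<in> (\<Union>n. {x. inverse (real (Suc n)) \<le> infdist x F})"
        then obtain n where n: "inverse (real (Suc n)) \<le> infdist x F" by blast
        have "0 < inverse (real (Suc n))" by simp
        with n have "infdist x F \<noteq> 0" by linarith
        then show "x \<in> - F" by (metis ComplI infdist_zero)
      qed
      then show ?thesis
        by (simp only:) (intro analytic_set_UN closed_imp_analytic_set closed_Collect_le continuous_intros)
    qed (simp add: closed_imp_analytic_set)
    with F show ?case by (simp add: closed_imp_analytic_set)
  next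
    case Empty
    show ?case by (simp add: closed_imp_analytic_set)
  next
    case (Compl a)
    then show ?case by (simp add: Compl_eq_Diff_UNIV double_diff)
  next
    case (Union a)
    then show ?case using analytic_set_UN[of a] analytic_set_INT[of "\<lambda>n. - a n"] by simp
  qed
  then show ?thesis ..
qed

text \<open>The classical argument: a family that cannot be separated stays inseparable when finitely
  many of its members are cut down to small pieces; in the limit it shrinks to points which, having
  distinct images, are separated.\<close>

lemma novikov_separation:
  fixes C :: "nat \<Rightarrow> 'w::{complete_space,second_countable_topology} set" and h :: "'w \<Rightarrow> 'a"
  assumes clo: "\<And>n. closed (C n)"
    and emp: "(\<Inter>n. h ` C n) = {}"
    and hM: "\<And>n. h ` C n \<subseteq> space M"
    and sep: "\<And>v w. v \<in> \<Union> (range C) \<Longrightarrow> w \<in> \<Union> (range C) \<Longrightarrow> h v \<noteq> h w \<Longrightarrow>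
      \<exists>U V G G'. U \<in> sets M \<and> V \<in> sets M \<and> U \<inter> V = {} \<and> open G \<and> open G' \<and> v \<in> G \<and> w \<in> G' \<and>
        h ` (G \<inter> \<Union> (range C)) \<subseteq> U \<and> h ` (G' \<inter> \<Union> (range C)) \<subseteq> V"
  shows "\<exists>B. (\<forall>n. B n \<in> sets M \<and> h ` C n \<subseteq> B n) \<and> (\<Inter>n. B n) = {}"
proof (rule ccontr)
  \<comment> \<open>\<open>S c\<close> says that the family \<open>c\<close> can be separated; the
    failure of \<open>S\<close> is the property that is preserved under cutting.\<close>
  define S where "S c \<longleftrightarrow> (\<exists>B. (\<forall>n::nat. B n \<in> sets M \<and> h ` c n \<subseteq> B n) \<and> (\<Inter>n. B n) = {})" for c :: "nat \<Rightarrow> 'w set"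
  assume "\<not> (\<exists>B. (\<forall>n. B n \<in> sets M \<and> h ` C n \<subseteq> B n) \<and> (\<Inter>n. B n) = {})"
  then have nS: "\<not> S C" by (simp add: S_def)
  obtain D :: "'w set" where D: "countable D" "\<And>X. open X \<Longrightarrow> X \<noteq> {} \<Longrightarrow> \<exists>d\<in>D. d \<in> X"
    using countable_dense_exists by metis
  have Dne: "D \<noteq> {}" using D(2)[of UNIV] by auto
  define s where "s = from_nat_into D"
  have s: "\<exists>k. x \<in> cball (s k) e" if "e > 0" for x e
  proof -
    have "\<exists>d\<in>D. d \<in> ball x e" by (rule D(2)) (use that in auto)
    then obtain d where "d \<in> D" "d \<in> ball x e" by blast
    moreover obtain k where "s k = d" using from_nat_into_surj[OF D(1) \<open>d \<in> D\<close>] by (auto simp: s_def)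
    ultimately show ?thesis by (intro exI[of _ k]) (auto simp: dist_commute)
  qed
  have split1: "\<exists>k. \<not> S (c(n := c n \<inter> cball (s k) e))" if "\<not> S c" "e > 0" for c n e
  proof (rule ccontr)
    assume "\<not> ?thesis"
    then have "\<forall>k. \<exists>B. (\<forall>m. B m \<in> sets M \<and> h ` (c(n := c n \<inter> cball (s k) e)) m \<subseteq> B m) \<and> (\<Inter>m. B m) = {}"
      by (simp add: S_def)
    then obtain B where B: "\<And>k m. B k m \<in> sets M" "\<And>k m. h ` (c(n := c n \<inter> cball (s k) e)) m \<subseteq> B k m"
      "\<And>k. (\<Inter>m. B k m) = {}" by metis
    \<comment> \<open>If every piece of the \<open>n\<close>-th set leads to a separation, the
      enclosing sets are united at place \<open>n\<close> and intersected at all other places; a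
      point common to all of them would be common to those for a single \<open>k\<close>.\<close>
    define B' where "B' m = (if m = n then \<Union>k. B k n else \<Inter>k. B k m)" for m
    have "B' m \<in> sets M" for m using B(1) by (auto simp: B'_def)
    moreover have "h ` c m \<subseteq> B' m" for m
    proof (cases "m = n")
      case True
      have "h x \<in> (\<Union>k. B k n)" if "x \<in> c n" for x
      proof -
        obtain k where "x \<in> cball (s k) e" using s[OF \<open>e > 0\<close>] by blast
        then have "h x \<in> h ` (c(n := c n \<inter> cball (s k) e)) n" using that by auto
        then show ?thesis using B(2) by blast
      qed
      then show ?thesis using True by (auto simp: B'_def)
    next
      case False
      then have "h ` c m \<subseteq> B k m" for k using B(2)[of k m] by simp
      then show ?thesis using False by (auto simp: B'_def)
    qed
    moreover have "(\<Inter>m. B' m) = {}"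
    proof (rule ccontr)
      assume "(\<Inter>m. B' m) \<noteq> {}"
      then obtain x where x: "\<And>m. x \<in> B' m" by blast
      obtain k where k: "x \<in> B k n" using x[of n] by (auto simp: B'_def)
      have "x \<in> B k m" for m using x[of m] k by (auto simp: B'_def split: if_splits)
      then show False using B(3)[of k] by blast
    qed
    ultimately have "S c" unfolding S_def by blast
    then show False using that by simp
  qed
  have splitN: "\<exists>c'. \<not> S c' \<and> (\<forall>n. closed (c' n) \<and> c' n \<subseteq> c n) \<and> (\<forall>n<m. \<exists>a. c' n \<subseteq> cball a e)"
    if "\<not> S c" "\<And>n. closed (c n)" "e > 0" for c e and m :: nat
  proof (induction m)
    case 0
    show ?case using that by (intro exI[of _ c]) auto
  next
    case (Suc m)
    then obtain c' where c': "\<not> S c'" "\<And>n. closed (c' n)" "\<And>n. c' n \<subseteq> c n" "\<And>n. n < m \<Longrightarrow> \<exists>a. c' n \<subseteq> cball a e"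
      by blast
    obtain k where k: "\<not> S (c'(m := c' m \<inter> cball (s k) e))" using split1[OF c'(1) \<open>e > 0\<close>] by blast
    define c2 where "c2 = c'(m := c' m \<inter> cball (s k) e)"
    have "\<exists>a. c2 n \<subseteq> cball a e" if "n < Suc m" for n
      using that c'(4)[of n] by (cases "n = m") (auto simp: c2_def)
    moreover have "closed (c2 n)" for n using c'(2) by (simp add: c2_def closed_Int)
    moreover have "c2 n \<subseteq> c n" for n using c'(3)[of n] by (auto simp: c2_def)
    moreover have "\<not> S c2" using k by (simp add: c2_def)
    ultimately show ?case by blast
  qed
  \<comment> \<open>At stage \<open>m\<close> the members with index below \<open>m\<close> lie in
    balls of radius 1/(m+1). Each member is covered by this from some stage on, so all diameters
    tend to 0.\<close>
  define P where "P m c \<longleftrightarrow> \<not> S c \<and> (\<forall>n. closed (c n) \<and> c n \<subseteq> C n) \<and>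
      (\<forall>n<m. \<exists>a. c n \<subseteq> cball a (inverse (real (Suc m))))" for m c
  have "\<exists>cs. \<forall>m. P m (cs m) \<and> (\<forall>n. cs (Suc m) n \<subseteq> cs m n)"
  proof (rule dependent_nat_choice)
    show "\<exists>c. P 0 c" using nS clo by (intro exI[of _ C]) (auto simp: P_def)
    fix c m assume "P m c"
    then have c: "\<not> S c" "\<And>n. closed (c n)" "\<And>n. c n \<subseteq> C n" by (auto simp: P_def)
    have "0 < inverse (real (Suc (Suc m)))" by simp
    from splitN[OF c(1,2) this, of "Suc m"]
    obtain c' where "\<not> S c'" "\<And>n. closed (c' n)" "\<And>n. c' n \<subseteq> c n"
      "\<And>n. n < Suc m \<Longrightarrow> \<exists>a. c' n \<subseteq> cball a (inverse (real (Suc (Suc m))))" by blast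
    then show "\<exists>c'. P (Suc m) c' \<and> (\<forall>n. c' n \<subseteq> c n)"
      unfolding P_def using c(3) by (intro exI[of _ c']) blast
  qed
  then obtain cs where cs: "\<And>m. P m (cs m)" "\<And>m n. cs (Suc m) n \<subseteq> cs m n" by blast
  have cs_closed: "closed (cs m n)" and cs_sub: "cs m n \<subseteq> C n" and cs_nS: "\<not> S (cs m)" for m n
    using cs(1) by (auto simp: P_def)
  have antimono: "cs m' n \<subseteq> cs m n" if "m \<le> m'" for m m' n
    using that by (rule lift_Suc_antimono_le[where f="\<lambda>m. cs m n", OF cs(2)])
  have hsub: "h ` cs m n \<subseteq> space M" for m n using cs_sub hM by blast
  have ne: "cs m n \<noteq> {}" for m n
  proof
    assume *: "cs m n = {}"
    \<comment> \<open>An empty member is enclosed by the empty set, which separates the family.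
      Hence all members are nonempty and Cantor's intersection theorem applies.\<close>
    have "S (cs m)"
      unfolding S_def using hsub * by (intro exI[of _ "\<lambda>k. if k = n then {} else space M"]) (auto split: if_splits)
    then show False using cs_nS by simp
  qed
  have small: "\<exists>m0. \<forall>m\<ge>m0. \<forall>x\<in>cs m n. \<forall>y\<in>cs m n. dist x y < \<epsilon>" if "\<epsilon> > 0" for n \<epsilon>
  proof -
    have "\<epsilon> / 2 > 0" using that by simp
    then obtain m1 where m1: "inverse (real (Suc m1)) < \<epsilon> / 2" using reals_Archimedean by blast
    show ?thesis
    proof (intro exI allI impI ballI)
      fix m x y assume m: "m \<ge> max m1 (Suc n)" and xy: "x \<in> cs m n" "y \<in> cs m n"
      have "n < m" using m by simp
      then obtain a where "cs m n \<subseteq> cball a (inverse (real (Suc m)))"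
        using cs(1)[of m] unfolding P_def by blast
      then have "dist a x \<le> inverse (real (Suc m))" "dist a y \<le> inverse (real (Suc m))" using xy by auto
      moreover have "inverse (real (Suc m)) \<le> inverse (real (Suc m1))" using m by (simp add: field_simps)
      moreover have "dist x y \<le> dist a x + dist a y" by (metis dist_commute dist_triangle)
      ultimately show "dist x y < \<epsilon>" using m1 by linarith
    qed
  qed
  have "\<exists>w. \<forall>m. w \<in> cs m n" for n
  proof -
    have "\<exists>m. \<forall>x\<in>cs m n. \<forall>y\<in>cs m n. dist x y < \<epsilon>" if "\<epsilon> > 0" for \<epsilon> using small[OF that] by blast
    then show ?thesis
      using decreasing_closed_nest[of "\<lambda>m. cs m n"] cs_closed ne antimono by metis
  qed
  then obtain w where w: "\<And>n m. w n \<in> cs m n" by metis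
  have wC: "w n \<in> C n" for n using w cs_sub by blast
  \<comment> \<open>The points \<open>w n\<close> cannot all have the same image, since that image
    would lie in the image of every \<open>C n\<close>.\<close>
  obtain j where j: "h (w 0) \<noteq> h (w j)"
  proof (rule ccontr)
    assume "\<not> thesis"
    then have "h (w 0) = h (w j)" for j using that by blast
    then have "h (w 0) \<in> (\<Inter>n. h ` C n)" using wC by force
    then show False using emp by simp
  qed
  have j0: "j \<noteq> 0"
  proof
    assume "j = 0" with j show False by simp
  qed
  have "w 0 \<in> \<Union> (range C)" "w j \<in> \<Union> (range C)" using wC by auto
  from sep[OF this j] obtain U V G G' where UV: "U \<in> sets M" "V \<in> sets M" "U \<inter> V = {}" "open G" "open G'"
    "w 0 \<in> G" "w j \<in> G'" "h ` (G \<inter> \<Union> (range C)) \<subseteq> U" "h ` (G' \<inter> \<Union> (range C)) \<subseteq> V"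
    by (elim exE conjE) (rule that; assumption)
  have shrink: "\<exists>m0. \<forall>m\<ge>m0. cs m n \<subseteq> H" if "open H" "w n \<in> H" for n H
  proof -
    obtain \<epsilon> where \<epsilon>: "\<epsilon> > 0" "ball (w n) \<epsilon> \<subseteq> H" using openE[OF \<open>open H\<close> \<open>w n \<in> H\<close>] by blast
    obtain m0 where "\<forall>m\<ge>m0. \<forall>x\<in>cs m n. \<forall>y\<in>cs m n. dist x y < \<epsilon>" using small[OF \<epsilon>(1)] by blast
    then have "\<forall>m\<ge>m0. cs m n \<subseteq> ball (w n) \<epsilon>" using w by auto
    then show ?thesis using \<epsilon>(2) by blast
  qed
  obtain m0 m1 where "\<forall>m\<ge>m0. cs m 0 \<subseteq> G" "\<forall>m\<ge>m1. cs m j \<subseteq> G'"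
    using shrink[OF UV(4,6)] shrink[OF UV(5,7)] by blast
  then have m: "cs (max m0 m1) 0 \<subseteq> G" "cs (max m0 m1) j \<subseteq> G'" by auto
  define m where "m = max m0 m1"
  have subC: "cs m n \<subseteq> \<Union> (range C)" for n using cs_sub[of m n] by blast
  have 0: "h ` cs m 0 \<subseteq> U"
    by (rule order_trans[OF image_mono UV(8)]) (use m(1) subC in \<open>simp add: m_def\<close>)
  have j: "h ` cs m j \<subseteq> V"
    by (rule order_trans[OF image_mono UV(9)]) (use m(2) subC in \<open>simp add: m_def\<close>)
  \<comment> \<open>Enclosing two members in the disjoint sets \<open>U\<close> and \<open>V\<close>
    already empties the intersection, so the whole space serves for the others.\<close>
  define B where "B k = (if k = 0 then U else if k = j then V else space M)" for k
  have "B k \<in> sets M \<and> h ` cs m k \<subseteq> B k" for k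
    using UV(1,2) 0 j hsub[of m k] by (simp add: B_def)
  moreover have "(\<Inter>k. B k) \<subseteq> B 0 \<inter> B j" by blast
  then have "(\<Inter>k. B k) = {}" using j0 UV(3) by (simp add: B_def)
  ultimately have "S (cs m)" unfolding S_def by blast
  then show False using cs_nS by simp
qed

section \<open>Parametrization of standard Borel spaces by sequences\<close>

lemma (in Metric_space) separable_mtopologyE:
  assumes "separable_space mtopology" "M \<noteq> {}"
  obtains r :: "nat \<Rightarrow> 'a" where "\<And>i. r i \<in> M" "\<And>x e. x \<in> M \<Longrightarrow> e > 0 \<Longrightarrow> \<exists>i. d x (r i) < e"
proof -
  obtain C where C: "countable C" "C \<subseteq> M" "mtopology closure_of C = M"
    using assms(1) by (auto simp: separable_space_def)
  have dense: "\<exists>y\<in>C. d x y < e" if "x \<in> M" "e > 0" for x e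
    using that C(3) unfolding metric_closure_of by (auto simp: in_mball)
  have "C \<noteq> {}" using dense[of _ 1] assms(2) by auto
  show ?thesis
  proof (rule that[of "from_nat_into C"])
    show "from_nat_into C i \<in> M" for i using from_nat_into[OF \<open>C \<noteq> {}\<close>] C(2) by blast
    show "\<exists>i. d x (from_nat_into C i) < e" if "x \<in> M" "e > 0" for x e
      using dense[OF that] from_nat_into_surj[OF C(1)] by metis
  qed
qed

text \<open>Makes any relation between two consecutive natural-valued terms a closed condition on
  real sequences.\<close>

lemma closed_of_nat_pairs: "closed ((\<lambda>(i, j). (real i, real j)) ` N)"
proof (rule discrete_imp_closed[of 1], simp, intro ballI impI)
  fix p q assume "p \<in> (\<lambda>(i, j). (real i, real j)) ` N" "q \<in> (\<lambda>(i, j). (real i, real j)) ` N" "dist q p < 1"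
  then obtain i j i' j' where eq: "p = (real i, real j)" "q = (real i', real j')" by auto
  have "dist (fst q) (fst p) < 1" "dist (snd q) (snd p) < 1"
    using dist_fst_le[of q p] dist_snd_le[of q p] \<open>dist q p < 1\<close> by linarith+
  moreover have "a = b" if "dist (real a) (real b) < 1" for a b
    using that unfolding dist_real_def by linarith
  ultimately show "q = p" by (simp add: eq)
qed

text \<open>Sequences of naturals are coded as real-valued ones, for which the library has a complete
  metric.\<close>

lemma standard_borel_parametrization:
  assumes "standard_borel M" and ne: "space M \<noteq> {}"
  obtains D :: "(nat \<Rightarrow> real) set" and g :: "(nat \<Rightarrow> real) \<Rightarrow> 'a" and E :: "nat \<Rightarrow> 'a set"
  where "closed D" "g \<in> borel \<rightarrow>\<^sub>M M" "g ` D = space M"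
    "\<And>v w. v \<in> D \<Longrightarrow> w \<in> D \<Longrightarrow> g v \<noteq> g w \<Longrightarrow> \<exists>U V G G'. U \<in> sets M \<and> V \<in> sets M \<and> U \<inter> V = {} \<and>
      open G \<and> open G' \<and> v \<in> G \<and> w \<in> G' \<and> g ` (G \<inter> D) \<subseteq> U \<and> g ` (G' \<inter> D) \<subseteq> V"
    "\<And>i. E i \<in> sets M"
    "\<And>x y. x \<in> space M \<Longrightarrow> y \<in> space M \<Longrightarrow> x \<noteq> y \<Longrightarrow> \<exists>i. x \<in> E i \<and> y \<notin> E i"
proof -
  obtain T where T: "completely_metrizable_space T" "separable_space T" "space M = topspace T"
    "sets M = sigma_sets (topspace T) {U. openin T U}"
    using assms(1) unfolding standard_borel_def by blast
  obtain X d where Xd: "Metric_space X d" "Metric_space.mcomplete X d" "T = Metric_space.mtopology X d"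
    using T(1) unfolding completely_metrizable_space_def by blast
  interpret Metric_space X d by fact
  have X: "X = space M" using T(3) Xd(3) by simp
  obtain r where r: "\<And>i::nat. r i \<in> X" "\<And>x e. x \<in> X \<Longrightarrow> e > 0 \<Longrightarrow> \<exists>i. d x (r i) < e"
    using that by (rule separable_mtopologyE[OF T(2)[unfolded Xd(3)] ne[folded X]])
  have open_sets: "U \<in> sets M" if "openin mtopology U" for U
    using that unfolding T(4) Xd(3) by (intro sigma_sets.Basic) simp
  have ball_sets: "mball x e \<in> sets M" for x e by (intro open_sets) simp
  \<comment> \<open>Balls of radii 1/(j+1) around a countable dense set; they separate
    points.\<close>
  define E where "E n = (case prod_decode n of (i, j) \<Rightarrow> mball (r i) (inverse (real (Suc j))))" for n
  have E: "E n \<in> sets M" for n by (simp add: E_def ball_sets split: prod.split)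
  have E_sep: "\<exists>i. x \<in> E i \<and> y \<notin> E i" if xy: "x \<in> X" "y \<in> X" "x \<noteq> y" for x y
  proof -
    have "d x y / 2 > 0" using xy by (simp add: zero less_le)
    then obtain j where j: "inverse (real (Suc j)) < d x y / 2" using reals_Archimedean by blast
    obtain i where i: "d x (r i) < inverse (real (Suc j))" using r(2)[OF xy(1), of "inverse (real (Suc j))"] by auto
    have "d x y \<le> d x (r i) + d (r i) y" using xy r by (intro triangle) auto
    then have "\<not> d (r i) y < inverse (real (Suc j))" using i j by linarith
    then show ?thesis
      using i xy r(1) by (intro exI[of _ "prod_encode (i, j)"]) (auto simp: E_def in_mball commute)
  qed
  define p :: "nat \<Rightarrow> real" where "p k = (1 / 2) ^ k" for k
  have p: "p k > 0" "p (Suc k) = p k / 2" for k by (auto simp: p_def)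
  have p_small: "\<exists>k. p k < e" if "e > 0" for e
    using real_arch_pow_inv[OF that, of "1 / 2"] by (auto simp: p_def)
  define ix where "ix \<sigma> k = r (nat \<lfloor>\<sigma> k\<rfloor>)" for \<sigma> :: "nat \<Rightarrow> real" and k
  have ix: "ix \<sigma> k \<in> X" for \<sigma> k using r by (simp add: ix_def)
  \<comment> \<open>Sequences of indices of dense points whose consecutive distances shrink
    geometrically. The factor 2 admits a code for every point: if \<open>d x (r (i k)) < p k\<close>
    for all \<open>k\<close>, consecutive terms are closer than
    \<open>p k + p k / 2\<close>.\<close>
  define D :: "(nat \<Rightarrow> real) set" where
    "D = (\<Inter>k. (\<lambda>\<sigma>. (\<sigma> k, \<sigma> (Suc k))) -` ((\<lambda>(i, j). (real i, real j)) ` {(i, j). d (r i) (r j) \<le> 2 * p k}))"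
  have D_closed: "closed D"
    unfolding D_def
    by (intro closed_INT ballI closed_vimage closed_of_nat_pairs continuous_intros continuous_on_product_coordinates)
  have D_nat: "\<exists>n. \<sigma> k = real n" if "\<sigma> \<in> D" for \<sigma> k
    using that by (auto simp: D_def)
  have D_step: "d (ix \<sigma> k) (ix \<sigma> (Suc k)) \<le> 2 * p k" if "\<sigma> \<in> D" for \<sigma> k
  proof -
    have "(\<sigma> k, \<sigma> (Suc k)) \<in> (\<lambda>(i, j). (real i, real j)) ` {(i, j). d (r i) (r j) \<le> 2 * p k}"
      using that by (auto simp: D_def)
    then show ?thesis by (auto simp: ix_def)
  qed
  \<comment> \<open>The bound telescopes, since
    \<open>2 * p k = 4 * p k - 4 * p (Suc k)\<close>.\<close>
  have D_dist: "d (ix \<sigma> k) (ix \<sigma> (k + m)) \<le> 4 * p k - 4 * p (k + m)" if "\<sigma> \<in> D" for \<sigma> k m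
  proof (induction m)
    case (Suc m)
    have "d (ix \<sigma> k) (ix \<sigma> (k + Suc m)) \<le> d (ix \<sigma> k) (ix \<sigma> (k + m)) + d (ix \<sigma> (k + m)) (ix \<sigma> (Suc (k + m)))"
      using ix by (simp add: triangle)
    then show ?case using Suc D_step[OF that, of "k + m"] p(2)[of "k + m"] by simp
  qed (use ix in simp)
  have D_dist': "d (ix \<sigma> k) (ix \<sigma> m) \<le> 4 * p k" if "\<sigma> \<in> D" "k \<le> m" for \<sigma> k m
    using D_dist[OF that(1), of k "m - k"] p(1)[of m] that(2) by simp
  have lim: "\<exists>x\<in>X. \<forall>k. d (ix \<sigma> k) x \<le> 4 * p k" if "\<sigma> \<in> D" for \<sigma>
  proof -
    have "MCauchy (ix \<sigma>)"
      unfolding MCauchy_def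
    proof (intro conjI allI impI)
      show "range (ix \<sigma>) \<subseteq> X" using ix by auto
      fix e :: real assume "e > 0"
      then obtain k where k: "p k < e / 8" using p_small[of "e / 8"] by auto
      show "\<exists>N. \<forall>n n'. N \<le> n \<longrightarrow> N \<le> n' \<longrightarrow> d (ix \<sigma> n) (ix \<sigma> n') < e"
      proof (intro exI allI impI)
        fix n n' assume "k \<le> n" "k \<le> n'"
        then have "d (ix \<sigma> k) (ix \<sigma> n) \<le> 4 * p k" "d (ix \<sigma> k) (ix \<sigma> n') \<le> 4 * p k"
          using D_dist'[OF that] by auto
        moreover have "d (ix \<sigma> n) (ix \<sigma> n') \<le> d (ix \<sigma> n) (ix \<sigma> k) + d (ix \<sigma> k) (ix \<sigma> n')"
          using ix by (intro triangle) auto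
        ultimately show "d (ix \<sigma> n) (ix \<sigma> n') < e" using k by (simp add: commute)
      qed
    qed
    then obtain x where x: "limitin mtopology (ix \<sigma>) x sequentially"
      using Xd(2) unfolding mcomplete_def by blast
    then have xX: "x \<in> X" using limitin_mspace by blast
    have "d (ix \<sigma> k) x \<le> 4 * p k" for k
    proof (rule field_le_epsilon)
      fix e :: real assume "e > 0"
      then obtain N where N: "\<forall>n\<ge>N. d (ix \<sigma> n) x < e"
        using x unfolding limit_metric_sequentially by blast
      have "d (ix \<sigma> k) x \<le> d (ix \<sigma> k) (ix \<sigma> (max k N)) + d (ix \<sigma> (max k N)) x"
        using ix xX by (intro triangle) auto
      moreover have "d (ix \<sigma> k) (ix \<sigma> (max k N)) \<le> 4 * p k" by (intro D_dist' that) simp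
      moreover have "d (ix \<sigma> (max k N)) x < e" using N by simp
      ultimately show "d (ix \<sigma> k) x \<le> 4 * p k + e" by linarith
    qed
    then show ?thesis using xX by blast
  qed
  obtain x0 where x0: "x0 \<in> X" using ne X by auto
  \<comment> \<open>The limit of the coded sequence. Off the closed set \<open>D\<close> the value
    is constant, which keeps \<open>g\<close> total and Borel.\<close>
  define g where "g \<sigma> = (if \<sigma> \<in> D then SOME x. x \<in> X \<and> (\<forall>k. d (ix \<sigma> k) x \<le> 4 * p k) else x0)" for \<sigma>
  have g: "g \<sigma> \<in> X" "d (ix \<sigma> k) (g \<sigma>) \<le> 4 * p k" if "\<sigma> \<in> D" for \<sigma> k
  proof -
    have "\<exists>x. x \<in> X \<and> (\<forall>k. d (ix \<sigma> k) x \<le> 4 * p k)" using lim[OF that] by blast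
    from someI_ex[OF this] show "g \<sigma> \<in> X" "d (ix \<sigma> k) (g \<sigma>) \<le> 4 * p k" using that by (auto simp: g_def)
  qed
  have gX: "g \<sigma> \<in> X" for \<sigma> using g(1) x0 by (cases "\<sigma> \<in> D") (auto simp: g_def)
  have surj: "g ` D = X"
  proof (intro equalityI subsetI)
    fix x assume x: "x \<in> X"
    obtain i where i: "\<And>k. d x (r (i k)) < p k" using r(2)[OF x p(1)] by metis
    define \<sigma> where "\<sigma> k = real (i k)" for k
    have ixi: "ix \<sigma> k = r (i k)" for k by (simp add: ix_def \<sigma>_def)
    have "d (r (i k)) (r (i (Suc k))) \<le> 2 * p k" for k
    proof -
      have "d (r (i k)) (r (i (Suc k))) \<le> d (r (i k)) x + d x (r (i (Suc k)))"
        using r x by (intro triangle) auto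
      then show ?thesis using i[of k] i[of "Suc k"] p(2)[of k] p(1)[of k] by (simp add: commute)
    qed
    then have \<sigma>D: "\<sigma> \<in> D" by (auto simp: D_def \<sigma>_def)
    have "d (g \<sigma>) x \<le> 0"
    proof (rule field_le_epsilon)
      fix e :: real assume "e > 0"
      then obtain k where k: "p k < e / 5" using p_small[of "e / 5"] by auto
      have "d (g \<sigma>) x \<le> d (g \<sigma>) (ix \<sigma> k) + d (ix \<sigma> k) x" using gX ix x by (intro triangle) auto
      then show "d (g \<sigma>) x \<le> 0 + e" using g(2)[OF \<sigma>D, of k] i[of k] k by (simp add: ixi commute)
    qed
    then have "g \<sigma> = x" using nonneg[of "g \<sigma>" x] zero[OF gX x] by (simp add: order_antisym)
    then show "x \<in> g ` D" using \<sigma>D by blast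
  qed (use gX in auto)
  \<comment> \<open>Within \<open>D\<close> the coordinates are natural numbers, so differing by
    less than 1 means agreeing at place \<open>k\<close>; this alone puts the two limits within
    \<open>8 * p k\<close>.\<close>
  define G where "G \<sigma> k = {\<tau>::nat \<Rightarrow> real. \<bar>\<tau> k - \<sigma> k\<bar> < 1}" for \<sigma> k
  have G_open: "open (G \<sigma> k)" for \<sigma> k
    unfolding G_def by (intro open_Collect_less continuous_intros continuous_on_product_coordinates)
  have G_in: "\<sigma> \<in> G \<sigma> k" for \<sigma> k by (simp add: G_def)
  have G_dist: "d (g \<sigma>) (g \<tau>) \<le> 8 * p k" if "\<sigma> \<in> D" "\<tau> \<in> G \<sigma> k" "\<tau> \<in> D" for \<sigma> \<tau> k
  proof -
    obtain m n where "\<sigma> k = real m" "\<tau> k = real n" using D_nat[OF \<open>\<sigma> \<in> D\<close>, of k] D_nat[OF \<open>\<tau> \<in> D\<close>, of k] by blast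
    then have "\<tau> k = \<sigma> k" using \<open>\<tau> \<in> G \<sigma> k\<close> by (simp add: G_def)
    then have "ix \<tau> k = ix \<sigma> k" by (simp add: ix_def)
    moreover have "d (g \<sigma>) (g \<tau>) \<le> d (g \<sigma>) (ix \<sigma> k) + d (ix \<sigma> k) (g \<tau>)" using gX ix by (intro triangle) auto
    ultimately show ?thesis using g(2)[OF that(1), of k] g(2)[OF that(3), of k] by (simp add: commute)
  qed
  have G_ball: "\<exists>k. g ` (G \<sigma> k \<inter> D) \<subseteq> mball (g \<sigma>) e" if "\<sigma> \<in> D" "e > 0" for \<sigma> e
  proof -
    obtain k where "p k < e / 8" using p_small[of "e / 8"] \<open>e > 0\<close> by auto
    have "g ` (G \<sigma> k \<inter> D) \<subseteq> mball (g \<sigma>) e"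
    proof (intro image_subsetI)
      fix \<tau> assume "\<tau> \<in> G \<sigma> k \<inter> D"
      then have "d (g \<sigma>) (g \<tau>) \<le> 8 * p k" using G_dist[OF \<open>\<sigma> \<in> D\<close>] by blast
      then show "g \<tau> \<in> mball (g \<sigma>) e" using \<open>p k < e / 8\<close> gX by (simp add: in_mball)
    qed
    then show ?thesis ..
  qed
  have g_meas: "g \<in> borel \<rightarrow>\<^sub>M M"
  proof (rule measurable_sigma_sets[OF T(4)])
    show "{U. openin T U} \<subseteq> Pow (topspace T)" by (auto dest: openin_subset)
    show "g \<in> space borel \<rightarrow> topspace T"
      unfolding T(3)[symmetric] X[symmetric] by (intro Pi_I gX)
    fix U assume "U \<in> {U. openin T U}"
    then have U: "openin mtopology U" by (simp add: Xd(3))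
    \<comment> \<open>Continuity of \<open>g\<close> on \<open>D\<close> shows that the trace of
      this open set on \<open>D\<close> is the whole preimage of \<open>U\<close> in
      \<open>D\<close>.\<close>
    define W where "W = \<Union>{H. open H \<and> g ` (H \<inter> D) \<subseteq> U}"
    have "g -` U \<inter> D = W \<inter> D"
    proof (intro equalityI subsetI)
      fix \<sigma> assume s: "\<sigma> \<in> g -` U \<inter> D"
      then have s1: "\<sigma> \<in> D" "g \<sigma> \<in> U" by auto
      then obtain e where e: "e > 0" "mball (g \<sigma>) e \<subseteq> U"
        using conjunct2[OF U[unfolded openin_mtopology], rule_format, OF s1(2)] by blast
      obtain k where k: "g ` (G \<sigma> k \<inter> D) \<subseteq> mball (g \<sigma>) e" using G_ball[OF s1(1) e(1)] by blast
      have "\<sigma> \<in> W"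
        unfolding W_def
        by (rule UnionI[of "G \<sigma> k"]) (simp_all only: mem_Collect_eq G_open G_in order_trans[OF k e(2)] simp_thms)
      then show "\<sigma> \<in> W \<inter> D" using s1(1) by blast
    qed (auto simp: W_def)
    moreover have "open W" unfolding W_def by (intro open_Union) auto
    moreover have "g -` U \<inter> (- D) = (if x0 \<in> U then - D else {})" by (auto simp: g_def)
    moreover have "g -` U \<inter> space borel = (g -` U \<inter> D) \<union> (g -` U \<inter> (- D))" by auto
    ultimately show "g -` U \<inter> space borel \<in> sets borel" using D_closed by auto
  qed
  have sep: "\<exists>U V G G'. U \<in> sets M \<and> V \<in> sets M \<and> U \<inter> V = {} \<and>
      open G \<and> open G' \<and> v \<in> G \<and> w \<in> G' \<and> g ` (G \<inter> D) \<subseteq> U \<and> g ` (G' \<inter> D) \<subseteq> V"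
    if vw: "v \<in> D" "w \<in> D" "g v \<noteq> g w" for v w
  proof -
    define e where "e = d (g v) (g w) / 2"
    have e: "e > 0" using vw(3) gX by (auto simp: e_def zero less_le)
    obtain k where k: "g ` (G v k \<inter> D) \<subseteq> mball (g v) e" using G_ball[OF vw(1) e] by blast
    obtain k' where k': "g ` (G w k' \<inter> D) \<subseteq> mball (g w) e" using G_ball[OF vw(2) e] by blast
    have disj: "mball (g v) e \<inter> mball (g w) e = {}"
    proof (rule ccontr)
      assume "mball (g v) e \<inter> mball (g w) e \<noteq> {}"
      then obtain z where z: "z \<in> X" "d (g v) z < e" "d (g w) z < e" by (auto simp: in_mball)
      have "d (g v) (g w) \<le> d (g v) z + d z (g w)" using z gX by (intro triangle) auto
      then show False using z by (simp add: commute e_def)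
    qed
    show ?thesis
      by (rule exI[of _ "mball (g v) e"], rule exI[of _ "mball (g w) e"], rule exI[of _ "G v k"], rule exI[of _ "G w k'"])
        (simp add: ball_sets G_open G_in k k' disj)
  qed
  show ?thesis
    by (rule that[OF D_closed g_meas surj[unfolded X] sep E E_sep[unfolded X]])
qed

text \<open>Pulling the sets back along the parametrization \<open>g\<close> places them in a
  product of Polish spaces, where Borel sets are projections of closed ones. Dropping the real
  variable and the auxiliary sequence and then applying \<open>g\<close> is a single map
  \<open>h\<close> on closed sets, to which the separation theorem applies.\<close>

lemma borel_projections_separation:
  fixes \<Gamma> :: "nat \<Rightarrow> ('a \<times> real) set"
  assumes M: "standard_borel M" and \<Gamma>: "\<And>n. \<Gamma> n \<in> sets (M \<Otimes>\<^sub>M borel)"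
    and emp: "(\<Inter>n. fst ` \<Gamma> n) = {}"
  shows "\<exists>B. (\<forall>n. B n \<in> sets M \<and> fst ` \<Gamma> n \<subseteq> B n) \<and> (\<Inter>n. B n) = {}"
proof (cases "space M = {}")
  case True
  then have "\<Gamma> n = {}" for n using sets.sets_into_space[OF \<Gamma>[of n]] by (auto simp: space_pair_measure)
  then show ?thesis by (intro exI[of _ "\<lambda>n. {}"]) simp
next
  case False
  obtain D :: "(nat \<Rightarrow> real) set" and g
    where D: "closed D" "g \<in> borel \<rightarrow>\<^sub>M M" "g ` D = space M"
    and sep: "\<And>v w. v \<in> D \<Longrightarrow> w \<in> D \<Longrightarrow> g v \<noteq> g w \<Longrightarrow> \<exists>U V G G'. U \<in> sets M \<and> V \<in> sets M \<and> U \<inter> V = {} \<and>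
      open G \<and> open G' \<and> v \<in> G \<and> w \<in> G' \<and> g ` (G \<inter> D) \<subseteq> U \<and> g ` (G' \<inter> D) \<subseteq> V"
    by (rule standard_borel_parametrization[OF M False]) (rule that; assumption)
  define \<Gamma>' where "\<Gamma>' n = ((\<lambda>p. (g (fst p), snd p)) -` \<Gamma> n) \<inter> (D \<times> UNIV)" for n
  have "\<Gamma>' n \<in> sets borel" for n
  proof -
    have "(\<lambda>p::(nat \<Rightarrow> real) \<times> real. (g (fst p), snd p)) \<in> borel \<rightarrow>\<^sub>M M \<Otimes>\<^sub>M borel"
      unfolding borel_prod[symmetric] using D(2) by measurable
    from measurable_sets[OF this \<Gamma>[of n]] show ?thesis
      using D(1) unfolding \<Gamma>'_def by (intro sets.Int) (auto simp: closed_Times)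
  qed
  then have "\<exists>C::(((nat \<Rightarrow> real) \<times> real) \<times> (nat \<Rightarrow> real)) set. closed C \<and> \<Gamma>' n = fst ` C" for n
    using borel_imp_analytic_set unfolding analytic_set_def by blast
  then obtain C :: "nat \<Rightarrow> (((nat \<Rightarrow> real) \<times> real) \<times> (nat \<Rightarrow> real)) set"
    where C: "\<And>n. closed (C n)" "\<And>n. \<Gamma>' n = fst ` C n" by metis
  define h where "h p = g (fst (fst p))" for p :: "((nat \<Rightarrow> real) \<times> real) \<times> (nat \<Rightarrow> real)"
  have hD: "fst (fst p) \<in> D" if "p \<in> C n" for p n
  proof -
    have "fst p \<in> \<Gamma>' n" using that unfolding C(2) by blast
    then show ?thesis by (auto simp: \<Gamma>'_def)
  qed
  have h_eq: "h ` C n = fst ` \<Gamma> n" for n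
  proof -
    have "h ` C n = (g \<circ> fst) ` \<Gamma>' n" unfolding C(2) image_image by (simp add: h_def)
    also have "\<dots> = fst ` \<Gamma> n"
    proof (intro equalityI subsetI)
      fix x assume "x \<in> fst ` \<Gamma> n"
      then obtain t where t: "(x, t) \<in> \<Gamma> n" by auto
      then have "x \<in> g ` D" using sets.sets_into_space[OF \<Gamma>[of n]] D(3) by (auto simp: space_pair_measure)
      then obtain \<sigma> where s: "\<sigma> \<in> D" "g \<sigma> = x" by auto
      then have "(\<sigma>, t) \<in> \<Gamma>' n" using t by (simp add: \<Gamma>'_def)
      then show "x \<in> (g \<circ> fst) ` \<Gamma>' n" using s by force
    qed (auto simp: \<Gamma>'_def image_iff intro: rev_bexI)
    finally show ?thesis .
  qed
  have "\<exists>B. (\<forall>n. B n \<in> sets M \<and> h ` C n \<subseteq> B n) \<and> (\<Inter>n. B n) = {}"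
  proof (rule novikov_separation[OF C(1)])
    show "(\<Inter>n. h ` C n) = {}" using emp by (simp add: h_eq)
    show "h ` C n \<subseteq> space M" for n
      unfolding h_eq using sets.sets_into_space[OF \<Gamma>[of n]] by (auto simp: space_pair_measure)
    fix v w assume vw: "v \<in> \<Union> (range C)" "w \<in> \<Union> (range C)" "h v \<noteq> h w"
    then have "fst (fst v) \<in> D" "fst (fst w) \<in> D" "g (fst (fst v)) \<noteq> g (fst (fst w))"
      using hD unfolding h_def by blast+
    from sep[OF this] obtain U V G G' where UV: "U \<in> sets M" "V \<in> sets M" "U \<inter> V = {}" "open G" "open G'"
      "fst (fst v) \<in> G" "fst (fst w) \<in> G'" "g ` (G \<inter> D) \<subseteq> U" "g ` (G' \<inter> D) \<subseteq> V"
      by (elim exE conjE) (rule that; assumption)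
    define pre where "pre H = (\<lambda>p::((nat \<Rightarrow> real) \<times> real) \<times> (nat \<Rightarrow> real). fst (fst p)) -` H" for H
    have pre: "open (pre H)" if "open H" for H
      unfolding pre_def using that by (intro open_vimage continuous_intros)
    have sub: "h ` (pre H \<inter> \<Union> (range C)) \<subseteq> g ` (H \<inter> D)" for H
      using hD by (auto simp: pre_def h_def)
    show "\<exists>U V G G'. U \<in> sets M \<and> V \<in> sets M \<and> U \<inter> V = {} \<and> open G \<and> open G' \<and> v \<in> G \<and> w \<in> G' \<and>
        h ` (G \<inter> \<Union> (range C)) \<subseteq> U \<and> h ` (G' \<inter> \<Union> (range C)) \<subseteq> V"
      by (rule exI[of _ U], rule exI[of _ V], rule exI[of _ "pre G"], rule exI[of _ "pre G'"])
        (intro conjI UV(1-3) pre[OF UV(4)] pre[OF UV(5)] order_trans[OF sub UV(8)] order_trans[OF sub UV(9)],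
         simp_all add: pre_def UV(6,7))
  qed
  then show ?thesis by (simp add: h_eq)
qed

section \<open>Kernels and the balance equation\<close>

text \<open>Finiteness is required of each measure separately: the jump measures have total mass
  \<open>q_rate\<close>, which in general is unbounded in the state.\<close>

definition kernel :: "'b measure \<Rightarrow> 'a measure \<Rightarrow> ('b \<Rightarrow> 'a measure) \<Rightarrow> bool" where
  "kernel A M K \<longleftrightarrow> (\<forall>a\<in>space A. sets (K a) = sets M \<and> finite_measure (K a)) \<and>
     (\<forall>B\<in>sets M. (\<lambda>a. emeasure (K a) B) \<in> borel_measurable A)"

lemma kernel_sets: "kernel A M K \<Longrightarrow> a \<in> space A \<Longrightarrow> sets (K a) = sets M"
  and kernel_finite: "kernel A M K \<Longrightarrow> a \<in> space A \<Longrightarrow> finite_measure (K a)"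
  and kernel_emeasure: "kernel A M K \<Longrightarrow> B \<in> sets M \<Longrightarrow> (\<lambda>a. emeasure (K a) B) \<in> borel_measurable A"
  by (auto simp: kernel_def)

lemma kernel_space: "kernel A M K \<Longrightarrow> a \<in> space A \<Longrightarrow> space (K a) = space M"
  by (metis kernel_sets sets_eq_imp_space_eq)

text \<open>Dynkin argument from rectangles; the step for complements uses the finiteness of each
  \<open>K a\<close>.\<close>

lemma kernel_emeasure_cut:
  assumes K: "kernel A M K" and Q: "Q \<in> sets (A \<Otimes>\<^sub>M M)"
  shows "(\<lambda>a. emeasure (K a) (Pair a -` Q)) \<in> borel_measurable A"
  using Int_stable_pair_measure_generator pair_measure_closed Q
  unfolding sets_pair_measure
proof (induct rule: sigma_sets_induct_disjoint)
  case (basic Q)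
  then obtain C B where CB: "Q = C \<times> B" "C \<in> sets A" "B \<in> sets M" by auto
  have "emeasure (K a) (Pair a -` Q) = indicator C a * emeasure (K a) B" for a
    by (auto simp: CB(1) indicator_def)
  then show ?case using CB(2) kernel_emeasure[OF K CB(3)] by simp
next
  case (compl Q)
  have "emeasure (K a) (Pair a -` ((space A \<times> space M) - Q)) =
      emeasure (K a) (space M) - emeasure (K a) (Pair a -` Q)" if a: "a \<in> space A" for a
  proof -
    have Q: "Q \<in> sets (A \<Otimes>\<^sub>M M)" using compl(1) by (simp add: sets_pair_measure)
    have "Pair a -` ((space A \<times> space M) - Q) = space (K a) - Pair a -` Q"
      using a by (auto simp: kernel_space[OF K a])
    moreover have "Pair a -` Q \<in> sets (K a)" using Q kernel_sets[OF K a] by (simp add: sets_Pair1)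
    ultimately show ?thesis
      using finite_measure.emeasure_finite[OF kernel_finite[OF K a]]
      by (simp add: emeasure_compl kernel_space[OF K a, symmetric])
  qed
  then have "(\<lambda>a. emeasure (K a) (Pair a -` ((space A \<times> space M) - Q))) \<in> borel_measurable A \<longleftrightarrow>
      (\<lambda>a. emeasure (K a) (space M) - emeasure (K a) (Pair a -` Q)) \<in> borel_measurable A"
    by (intro measurable_cong)
  then show ?case using compl(2) kernel_emeasure[OF K sets.top] by simp
next
  case (union F)
  have F: "F i \<in> sets (A \<Otimes>\<^sub>M M)" for i using union(2) by (auto simp: sets_pair_measure)
  have "emeasure (K a) (Pair a -` \<Union> (range F)) = (\<Sum>i. emeasure (K a) (Pair a -` F i))" if a: "a \<in> space A" for a
  proof -
    have "Pair a -` \<Union> (range F) = (\<Union>i. Pair a -` F i)" by auto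
    moreover have "Pair a -` F i \<in> sets (K a)" for i using F kernel_sets[OF K a] by (simp add: sets_Pair1)
    moreover have "disjoint_family (\<lambda>i. Pair a -` F i)"
      using union(1) by (auto simp: disjoint_family_on_def)
    ultimately show ?thesis by (simp add: suminf_emeasure image_subset_iff)
  qed
  then have "(\<lambda>a. emeasure (K a) (Pair a -` \<Union> (range F))) \<in> borel_measurable A \<longleftrightarrow>
      (\<lambda>a. \<Sum>i. emeasure (K a) (Pair a -` F i)) \<in> borel_measurable A"
    by (intro measurable_cong)
  then show ?case using union(3) by simp
qed simp

lemma kernel_measurable_section:
  assumes K: "kernel A M K" and f: "f \<in> borel_measurable (A \<Otimes>\<^sub>M M)" and a: "a \<in> space A"
  shows "(\<lambda>y. f (a, y)) \<in> borel_measurable (K a)"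
  using measurable_Pair2[OF f a] measurable_cong_sets[OF kernel_sets[OF K a] refl] by blast

lemma borel_measurable_kernel_nn_integral:
  assumes K: "kernel A M K" and f: "f \<in> borel_measurable (A \<Otimes>\<^sub>M M)"
  shows "(\<lambda>a. \<integral>\<^sup>+y. f (a, y) \<partial>K a) \<in> borel_measurable A"
  using f
proof induct
  case (cong f g)
  have "(\<integral>\<^sup>+y. f (a, y) \<partial>K a) = (\<integral>\<^sup>+y. g (a, y) \<partial>K a)" if "a \<in> space A" for a
    using cong(3) that by (intro nn_integral_cong) (auto simp: kernel_space[OF K that] space_pair_measure)
  then show ?case using cong(4) by (simp cong: measurable_cong)
next
  case (set Q)
  have "(\<integral>\<^sup>+y. indicator Q (a, y) \<partial>K a) = emeasure (K a) (Pair a -` Q)" if a: "a \<in> space A" for a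
  proof -
    have "Pair a -` Q \<in> sets (K a)" using set kernel_sets[OF K a] by (simp add: sets_Pair1)
    moreover have "(\<lambda>y. indicator Q (a, y) :: ennreal) = indicator (Pair a -` Q)"
      by (auto simp: indicator_def)
    ultimately show ?thesis by simp
  qed
  then have "(\<lambda>a. \<integral>\<^sup>+y. indicator Q (a, y) \<partial>K a) \<in> borel_measurable A \<longleftrightarrow>
      (\<lambda>a. emeasure (K a) (Pair a -` Q)) \<in> borel_measurable A"
    by (intro measurable_cong)
  then show ?case using kernel_emeasure_cut[OF K set] by simp
next
  case (mult f c)
  have "(\<integral>\<^sup>+y. c * f (a, y) \<partial>K a) = c * (\<integral>\<^sup>+y. f (a, y) \<partial>K a)" if "a \<in> space A" for a
    using kernel_measurable_section[OF K mult(2) that] by (intro nn_integral_cmult)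
  then have "(\<lambda>a. \<integral>\<^sup>+y. c * f (a, y) \<partial>K a) \<in> borel_measurable A \<longleftrightarrow>
      (\<lambda>a. c * (\<integral>\<^sup>+y. f (a, y) \<partial>K a)) \<in> borel_measurable A"
    by (intro measurable_cong)
  then show ?case using mult(4) by simp
next
  case (add f g)
  have "(\<integral>\<^sup>+y. g (a, y) + f (a, y) \<partial>K a) = (\<integral>\<^sup>+y. g (a, y) \<partial>K a) + (\<integral>\<^sup>+y. f (a, y) \<partial>K a)"
    if "a \<in> space A" for a
    using kernel_measurable_section[OF K add(1) that] kernel_measurable_section[OF K add(4) that]
    by (intro nn_integral_add)
  then have "(\<lambda>a. \<integral>\<^sup>+y. g (a, y) + f (a, y) \<partial>K a) \<in> borel_measurable A \<longleftrightarrow>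
      (\<lambda>a. (\<integral>\<^sup>+y. g (a, y) \<partial>K a) + (\<integral>\<^sup>+y. f (a, y) \<partial>K a)) \<in> borel_measurable A"
    by (intro measurable_cong)
  then show ?case using add by simp
next
  case (seq U)
  have "(\<integral>\<^sup>+y. (SUP i. U i) (a, y) \<partial>K a) = (SUP i. \<integral>\<^sup>+y. U i (a, y) \<partial>K a)" if "a \<in> space A" for a
    unfolding SUP_apply
    using kernel_measurable_section[OF K seq(1) that] seq(4)
    by (intro nn_integral_monotone_convergence_SUP) (auto simp: incseq_def le_fun_def)
  then have "(\<lambda>a. \<integral>\<^sup>+y. (SUP i. U i) (a, y) \<partial>K a) \<in> borel_measurable A \<longleftrightarrow>
      (\<lambda>a. SUP i. \<integral>\<^sup>+y. U i (a, y) \<partial>K a) \<in> borel_measurable A"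
    by (intro measurable_cong)
  then show ?case using seq(3) by simp
qed

lemma kernel_comp:
  assumes "kernel A M K" "\<phi> \<in> N \<rightarrow>\<^sub>M A"
  shows "kernel N M (\<lambda>p. K (\<phi> p))"
  using assms measurable_space[OF assms(2)] unfolding kernel_def
  by (auto intro: measurable_compose[OF assms(2)])

lemma borel_measurable_kernel_nn_integral':
  assumes "kernel A M K" "\<phi> \<in> N \<rightarrow>\<^sub>M A" "(\<lambda>(p, y). f p y) \<in> borel_measurable (N \<Otimes>\<^sub>M M)"
  shows "(\<lambda>p. \<integral>\<^sup>+y. f p y \<partial>K (\<phi> p)) \<in> borel_measurable N"
  using borel_measurable_kernel_nn_integral[OF kernel_comp[OF assms(1,2)] assms(3)] by simp

lemma finite_measure_Fubini_lborel:
  assumes "finite_measure N" "(\<lambda>(y, \<theta>). g y \<theta>) \<in> borel_measurable (N \<Otimes>\<^sub>M borel)"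
  shows "(\<integral>\<^sup>+y. \<integral>\<^sup>+\<theta>. g y \<theta> \<partial>lborel \<partial>N) = (\<integral>\<^sup>+\<theta>. \<integral>\<^sup>+y. g y \<theta> \<partial>N \<partial>(lborel::real measure))"
proof -
  interpret finite_measure N by fact
  interpret pair_sigma_finite N "lborel :: real measure" ..
  have "sets (N \<Otimes>\<^sub>M (lborel::real measure)) = sets (N \<Otimes>\<^sub>M borel)"
    by (intro sets_pair_measure_cong) auto
  then have "(\<lambda>(y, \<theta>). g y \<theta>) \<in> borel_measurable (N \<Otimes>\<^sub>M lborel)"
    using assms(2) measurable_cong_sets by blast
  from Fubini'[OF this] show ?thesis by simp
qed

text \<open>Tonelli on the triangle \<open>u < w < \<theta> < t\<close>.\<close>

lemma lborel_triangle_swap: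
  fixes G :: "real \<Rightarrow> real \<Rightarrow> ennreal"
  assumes G[measurable]: "(\<lambda>(w, \<theta>). G w \<theta>) \<in> borel_measurable (borel \<Otimes>\<^sub>M borel)"
  shows "(\<integral>\<^sup>+w\<in>{u<..<t}. (\<integral>\<^sup>+\<theta>\<in>{w<..<t}. G w \<theta> \<partial>lborel) \<partial>lborel) =
    (\<integral>\<^sup>+\<theta>\<in>{u<..<t}. (\<integral>\<^sup>+w\<in>{u<..<\<theta>}. G w \<theta> \<partial>lborel) \<partial>lborel)"
proof -
  define H where "H w \<theta> = (if u < w \<and> w < \<theta> \<and> \<theta> < t then G w \<theta> else 0)" for w \<theta>
  have H: "(\<lambda>(w, \<theta>). H w \<theta>) \<in> borel_measurable (borel \<Otimes>\<^sub>M borel)"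
    unfolding H_def by measurable
  have "sets (lborel \<Otimes>\<^sub>M lborel) = sets (borel \<Otimes>\<^sub>M (borel :: real measure) :: (real \<times> real) measure)"
    by (intro sets_pair_measure_cong) auto
  then have H': "(\<lambda>(w, \<theta>). H w \<theta>) \<in> borel_measurable (lborel \<Otimes>\<^sub>M lborel)"
    using H measurable_cong_sets by blast
  have Gs[measurable]: "(\<lambda>\<theta>. G w \<theta>) \<in> borel_measurable borel" "(\<lambda>\<theta>. G \<theta> w) \<in> borel_measurable borel" for w
    by measurable
  have "(\<integral>\<^sup>+w\<in>{u<..<t}. (\<integral>\<^sup>+\<theta>\<in>{w<..<t}. G w \<theta> \<partial>lborel) \<partial>lborel) = (\<integral>\<^sup>+w. \<integral>\<^sup>+\<theta>. H w \<theta> \<partial>lborel \<partial>lborel)"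
  proof (rule nn_integral_cong)
    fix w
    show "(\<integral>\<^sup>+\<theta>\<in>{w<..<t}. G w \<theta> \<partial>lborel) * indicator {u<..<t} w = (\<integral>\<^sup>+\<theta>. H w \<theta> \<partial>lborel)"
    proof (cases "w \<in> {u<..<t}")
      case True
      then show ?thesis by (auto intro!: nn_integral_cong simp: H_def indicator_def)
    next
      case False
      then have "H w \<theta> = 0" for \<theta> by (auto simp: H_def)
      then show ?thesis using False by simp
    qed
  qed
  also have "\<dots> = (\<integral>\<^sup>+\<theta>. \<integral>\<^sup>+w. H w \<theta> \<partial>lborel \<partial>lborel)"
    using lborel_pair.Fubini'[OF H'] by simp
  also have "\<dots> = (\<integral>\<^sup>+\<theta>\<in>{u<..<t}. (\<integral>\<^sup>+w\<in>{u<..<\<theta>}. G w \<theta> \<partial>lborel) \<partial>lborel)"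
  proof (rule nn_integral_cong)
    fix \<theta>
    show "(\<integral>\<^sup>+w. H w \<theta> \<partial>lborel) = (\<integral>\<^sup>+w\<in>{u<..<\<theta>}. G w \<theta> \<partial>lborel) * indicator {u<..<t} \<theta>"
    proof (cases "\<theta> \<in> {u<..<t}")
      case True
      then show ?thesis by (auto intro!: nn_integral_cong simp: H_def indicator_def)
    next
      case False
      then have "H w \<theta> = 0" for w by (auto simp: H_def)
      then show ?thesis using False by simp
    qed
  qed
  finally show ?thesis .
qed

section \<open>Additive functionals with monotone convergence\<close>

text \<open>Describes integration against a measure by its rules, so that iterated integrals over
  time, state and jump target can be treated as one integral without constructing the measure they
  define.\<close>

definition integral_functional :: "'a measure \<Rightarrow> (('a \<Rightarrow> ennreal) \<Rightarrow> ennreal) \<Rightarrow> bool" where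
  "integral_functional M L \<longleftrightarrow>
    (\<forall>f\<in>borel_measurable M. \<forall>g\<in>borel_measurable M. (\<forall>y\<in>space M. f y = g y) \<longrightarrow> L f = L g) \<and>
    (\<forall>f\<in>borel_measurable M. \<forall>c. L (\<lambda>y. c * f y) = c * L f) \<and>
    (\<forall>f\<in>borel_measurable M. \<forall>g\<in>borel_measurable M. L (\<lambda>y. f y + g y) = L f + L g) \<and>
    (\<forall>F. (\<forall>i::nat. F i \<in> borel_measurable M) \<and> incseq F \<longrightarrow> L (\<lambda>y. SUP i. F i y) = (SUP i. L (F i)))"

lemma integral_functional_cong:
  "integral_functional M L \<Longrightarrow> f \<in> borel_measurable M \<Longrightarrow> g \<in> borel_measurable M \<Longrightarrow>
    (\<And>y. y \<in> space M \<Longrightarrow> f y = g y) \<Longrightarrow> L f = L g"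
  and integral_functional_cmult:
  "integral_functional M L \<Longrightarrow> f \<in> borel_measurable M \<Longrightarrow> L (\<lambda>y. c * f y) = c * L f"
  and integral_functional_plus:
  "integral_functional M L \<Longrightarrow> f \<in> borel_measurable M \<Longrightarrow> g \<in> borel_measurable M \<Longrightarrow>
    L (\<lambda>y. f y + g y) = L f + L g"
  and integral_functional_SUP:
  "integral_functional M L \<Longrightarrow> (\<And>i. F i \<in> borel_measurable M) \<Longrightarrow> incseq F \<Longrightarrow>
    L (\<lambda>y. SUP i::nat. F i y) = (SUP i. L (F i))"
  unfolding integral_functional_def by blast+

lemma integral_functional_eqI:
  assumes L: "integral_functional M L" and R: "integral_functional M R"
    and eq: "\<And>B. B \<in> sets M \<Longrightarrow> L (indicator B) = R (indicator B)"
    and f: "f \<in> borel_measurable M"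
  shows "L f = R f"
  using f
proof induct
  case (cong f g)
  then show ?case
    using integral_functional_cong[OF L cong(1,2)] integral_functional_cong[OF R cong(1,2)] by simp
next
  case (seq U)
  then show ?case
    using integral_functional_SUP[OF L seq(1,4)] integral_functional_SUP[OF R seq(1,4)]
    by (simp add: image_image fun_eq_iff SUP_apply[abs_def])
qed (simp_all add: eq integral_functional_cmult[OF L] integral_functional_cmult[OF R]
    integral_functional_plus[OF L] integral_functional_plus[OF R])

text \<open>Monotonicity is not among the defining rules; it is continuity along the increasing
  sequence \<open>f\<close>, \<open>g\<close>, \<open>g\<close> and so on.\<close>

lemma integral_functional_mono:
  assumes L: "integral_functional M L" and "f \<in> borel_measurable M" "g \<in> borel_measurable M" "f \<le> g"
  shows "L f \<le> L g"
proof -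
  have "incseq (\<lambda>i::nat. if i = 0 then f else g)" using assms(4) by (auto simp: incseq_def)
  from integral_functional_SUP[OF L _ this] have "L (\<lambda>y. SUP i::nat. (if i = 0 then f else g) y) =
      (SUP i::nat. L (if i = 0 then f else g))" using assms(2,3) by simp
  moreover have "(SUP i::nat. (if i = 0 then f else g) y) = g y" for y
    using assms(4) by (intro antisym SUP_least SUP_upper2[of 1]) (auto simp: le_fun_def)
  ultimately have "L g = (SUP i::nat. L (if i = 0 then f else g))" by simp
  moreover have "L f \<le> (SUP i::nat. L (if i = 0 then f else g))" by (rule SUP_upper2[of 0]) auto
  ultimately show ?thesis by simp
qed

lemma integral_functional_nn_integral:
  assumes N: "sets N = sets M"
  shows "integral_functional M (\<lambda>f. \<integral>\<^sup>+y. f y \<partial>N)"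
proof -
  have *: "borel_measurable M = borel_measurable N" by (rule measurable_cong_sets) (simp_all add: N)
  show ?thesis
    unfolding integral_functional_def *
    by (auto simp: nn_integral_cmult nn_integral_add sets_eq_imp_space_eq[OF N]
        intro: nn_integral_cong nn_integral_monotone_convergence_SUP)
qed

lemma integral_functional_point:
  assumes "x \<in> space M"
  shows "integral_functional M (\<lambda>f. f x)"
  using assms unfolding integral_functional_def by auto

lemma integral_functional_add:
  assumes L: "integral_functional M L" and R: "integral_functional M R"
  shows "integral_functional M (\<lambda>f. L f + R f)"
  unfolding integral_functional_def
proof (intro conjI ballI allI impI)
  fix F :: "nat \<Rightarrow> 'a \<Rightarrow> ennreal" assume F: "(\<forall>i::nat. F i \<in> borel_measurable M) \<and> incseq F"
  have "incseq (\<lambda>i. L (F i))" "incseq (\<lambda>i. R (F i))"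
    using F by (auto intro!: incseq_SucI integral_functional_mono[OF L] integral_functional_mono[OF R] dest: incseq_SucD)
  then show "L (\<lambda>y. SUP i. F i y) + R (\<lambda>y. SUP i. F i y) = (SUP i. L (F i) + R (F i))"
    using F by (simp add: integral_functional_SUP[OF L] integral_functional_SUP[OF R] ennreal_SUP_add)
next
  fix f g :: "'a \<Rightarrow> ennreal"
  assume *: "f \<in> borel_measurable M" "g \<in> borel_measurable M" "\<forall>y\<in>space M. f y = g y"
  show "L f + R f = L g + R g"
    using integral_functional_cong[OF L *(1,2)] integral_functional_cong[OF R *(1,2)] *(3) by simp
qed (auto simp: integral_functional_cmult[OF L] integral_functional_cmult[OF R] distrib_left
    integral_functional_plus[OF L] integral_functional_plus[OF R] algebra_simps)

lemma integral_functional_mult: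
  assumes L: "integral_functional M L" and k: "k \<in> borel_measurable M"
  shows "integral_functional M (\<lambda>f. L (\<lambda>y. f y * k y))"
  unfolding integral_functional_def
proof (intro conjI ballI allI impI)
  fix f g :: "'a \<Rightarrow> ennreal"
  assume *: "f \<in> borel_measurable M" "g \<in> borel_measurable M" "\<forall>y\<in>space M. f y = g y"
  show "L (\<lambda>y. f y * k y) = L (\<lambda>y. g y * k y)"
    using * k by (intro integral_functional_cong[OF L]) auto
next
  fix f :: "'a \<Rightarrow> ennreal" and c assume *: "f \<in> borel_measurable M"
  show "L (\<lambda>y. c * f y * k y) = c * L (\<lambda>y. f y * k y)"
    using * k integral_functional_cmult[OF L, of "\<lambda>y. f y * k y" c] by (simp add: mult.assoc)
next
  fix f g :: "'a \<Rightarrow> ennreal" assume *: "f \<in> borel_measurable M" "g \<in> borel_measurable M"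
  show "L (\<lambda>y. (f y + g y) * k y) = L (\<lambda>y. f y * k y) + L (\<lambda>y. g y * k y)"
    unfolding distrib_right using * k by (intro integral_functional_plus[OF L]) auto
next
  fix F :: "nat \<Rightarrow> 'a \<Rightarrow> ennreal" assume F: "(\<forall>i::nat. F i \<in> borel_measurable M) \<and> incseq F"
  have Fk: "(\<lambda>y. F i y * k y) \<in> borel_measurable M" for i
    using F k by (intro borel_measurable_times_ennreal) auto
  have "incseq (\<lambda>i y. F i y * k y)"
    using F by (auto simp: incseq_def le_fun_def intro!: mult_right_mono)
  from integral_functional_SUP[OF L Fk this]
  show "L (\<lambda>y. (SUP i. F i y) * k y) = (SUP i. L (\<lambda>y. F i y * k y))"
    by (simp add: SUP_mult_right_ennreal)
qed

lemma integral_functional_integral: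
  fixes L :: "'b \<Rightarrow> ('a \<Rightarrow> ennreal) \<Rightarrow> ennreal"
  assumes L: "\<And>w. w \<in> space N \<Longrightarrow> integral_functional M (L w)"
    and meas: "\<And>f. f \<in> borel_measurable M \<Longrightarrow> (\<lambda>w. L w f) \<in> borel_measurable N"
  shows "integral_functional M (\<lambda>f. \<integral>\<^sup>+w. L w f \<partial>N)"
  unfolding integral_functional_def
proof (intro conjI ballI allI impI)
  fix f g :: "'a \<Rightarrow> ennreal"
  assume *: "f \<in> borel_measurable M" "g \<in> borel_measurable M" "\<forall>y\<in>space M. f y = g y"
  show "(\<integral>\<^sup>+w. L w f \<partial>N) = (\<integral>\<^sup>+w. L w g \<partial>N)"
    using * by (intro nn_integral_cong integral_functional_cong[OF L]) auto
next
  fix f :: "'a \<Rightarrow> ennreal" and c assume *: "f \<in> borel_measurable M"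
  have "(\<integral>\<^sup>+w. L w (\<lambda>y. c * f y) \<partial>N) = (\<integral>\<^sup>+w. c * L w f \<partial>N)"
    using * by (intro nn_integral_cong integral_functional_cmult[OF L]) auto
  then show "(\<integral>\<^sup>+w. L w (\<lambda>y. c * f y) \<partial>N) = c * (\<integral>\<^sup>+w. L w f \<partial>N)"
    using meas[OF *] by (simp add: nn_integral_cmult)
next
  fix f g :: "'a \<Rightarrow> ennreal" assume *: "f \<in> borel_measurable M" "g \<in> borel_measurable M"
  have "(\<integral>\<^sup>+w. L w (\<lambda>y. f y + g y) \<partial>N) = (\<integral>\<^sup>+w. L w f + L w g \<partial>N)"
    using * by (intro nn_integral_cong integral_functional_plus[OF L]) auto
  then show "(\<integral>\<^sup>+w. L w (\<lambda>y. f y + g y) \<partial>N) = (\<integral>\<^sup>+w. L w f \<partial>N) + (\<integral>\<^sup>+w. L w g \<partial>N)"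
    using meas[OF *(1)] meas[OF *(2)] by (simp add: nn_integral_add)
next
  fix F :: "nat \<Rightarrow> 'a \<Rightarrow> ennreal" assume F: "(\<forall>i::nat. F i \<in> borel_measurable M) \<and> incseq F"
  have "(\<integral>\<^sup>+w. L w (\<lambda>y. SUP i. F i y) \<partial>N) = (\<integral>\<^sup>+w. (SUP i. L w (F i)) \<partial>N)"
    using F by (intro nn_integral_cong integral_functional_SUP[OF L]) auto
  also have "\<dots> = (SUP i. \<integral>\<^sup>+w. L w (F i) \<partial>N)"
  proof (rule nn_integral_monotone_convergence_SUP_AE)
    show "AE w in N. L w (F i) \<le> L w (F (Suc i))" for i
      using F by (intro AE_I2 integral_functional_mono[OF L]) (auto dest: incseq_SucD)
  qed (use F meas in auto)
  finally show "(\<integral>\<^sup>+w. L w (\<lambda>y. SUP i. F i y) \<partial>N) = (SUP i. \<integral>\<^sup>+w. L w (F i) \<partial>N)" .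
qed

lemma integral_functional_eq:
  assumes L: "integral_functional M L" and eq: "\<And>f. f \<in> borel_measurable M \<Longrightarrow> L' f = L f"
  shows "integral_functional M L'"
  unfolding integral_functional_def
proof (intro conjI ballI allI impI)
  fix f g :: "'a \<Rightarrow> ennreal"
  assume *: "f \<in> borel_measurable M" "g \<in> borel_measurable M" "\<forall>y\<in>space M. f y = g y"
  show "L' f = L' g"
    unfolding eq[OF *(1)] eq[OF *(2)] using * by (intro integral_functional_cong[OF L]) auto
next
  fix f :: "'a \<Rightarrow> ennreal" and c assume [measurable]: "f \<in> borel_measurable M"
  have "(\<lambda>y. c * f y) \<in> borel_measurable M" by measurable
  then show "L' (\<lambda>y. c * f y) = c * L' f" by (simp add: eq integral_functional_cmult[OF L])
next
  fix f g :: "'a \<Rightarrow> ennreal" assume [measurable]: "f \<in> borel_measurable M" "g \<in> borel_measurable M"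
  have "(\<lambda>y. f y + g y) \<in> borel_measurable M" by measurable
  then show "L' (\<lambda>y. f y + g y) = L' f + L' g" by (simp add: eq integral_functional_plus[OF L])
next
  fix F :: "nat \<Rightarrow> 'a \<Rightarrow> ennreal" assume F: "(\<forall>i. F i \<in> borel_measurable M) \<and> incseq F"
  then have [measurable]: "F i \<in> borel_measurable M" for i by simp
  have "(\<lambda>y. SUP i. F i y) \<in> borel_measurable M" by measurable
  then show "L' (\<lambda>y. SUP i. F i y) = (SUP i. L' (F i))"
    using F by (simp add: eq integral_functional_SUP[OF L])
qed

lemma integral_functional_cmultr:
  assumes L: "integral_functional M L"
  shows "integral_functional M (\<lambda>f. L f * c)"
proof (rule integral_functional_eq)
  show "integral_functional M (\<lambda>f. L (\<lambda>y. f y * c))"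
    by (rule integral_functional_mult[OF L]) simp
  show "L f * c = L (\<lambda>y. f y * c)" if "f \<in> borel_measurable M" for f
    using integral_functional_cmult[OF L that, of c] by (simp add: mult.commute)
qed

lemma pred_greaterThanLessThan [measurable (raw)]:
  fixes a b c :: "'b \<Rightarrow> real"
  assumes [measurable]: "a \<in> borel_measurable N" "b \<in> borel_measurable N" "c \<in> borel_measurable N"
  shows "Measurable.pred N (\<lambda>x. c x \<in> {a x<..<b x})"
  unfolding greaterThanLessThan_iff by measurable

lemma pred_atLeastAtMost [measurable (raw)]:
  fixes a b c :: "'b \<Rightarrow> real"
  assumes [measurable]: "a \<in> borel_measurable N" "b \<in> borel_measurable N" "c \<in> borel_measurable N"
  shows "Measurable.pred N (\<lambda>x. c x \<in> {a x..b x})"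
proof -
  have "Measurable.pred N (\<lambda>x. a x \<le> c x)" "Measurable.pred N (\<lambda>x. c x \<le> b x)" by measurable
  then show ?thesis unfolding atLeastAtMost_iff by (rule pred_intros_logic)
qed

lemma borel_measurable_uncurry3:
  assumes "(\<lambda>(y, w, t). f y w t) \<in> borel_measurable (M \<Otimes>\<^sub>M (borel \<Otimes>\<^sub>M borel))"
    and "a \<in> N \<rightarrow>\<^sub>M M" "b \<in> borel_measurable N" "c \<in> borel_measurable N"
  shows "(\<lambda>p. f (a p) (b p) (c p)) \<in> borel_measurable N"
  using measurable_compose[OF measurable_Pair[OF assms(2) measurable_Pair[OF assms(3,4)]] assms(1)] by simp

section \<open>Abstract form of the balance and integral equations\<close>

text \<open>Rates, jump kernels and laws are total in time here. Besides measurability,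
  \<open>E_right\<close> and \<open>E_left\<close> are all that is known of the survival function;
  the exponential is hidden behind them.\<close>

locale flux_balance =
  fixes M :: "'a measure" and lam :: "'a \<Rightarrow> real \<Rightarrow> ennreal" and E :: "'a \<Rightarrow> real \<Rightarrow> real \<Rightarrow> ennreal"
    and Q :: "'a \<Rightarrow> real \<Rightarrow> 'a measure" and mu :: "real \<Rightarrow> 'a measure" and x :: 'a and u :: real
  assumes lam: "(\<lambda>(y, w). lam y w) \<in> borel_measurable (M \<Otimes>\<^sub>M borel)"
    and E: "(\<lambda>(y, w, t). E y w t) \<in> borel_measurable (M \<Otimes>\<^sub>M (borel \<Otimes>\<^sub>M borel))"
    and E_right: "\<And>y w t. y \<in> space M \<Longrightarrow> w \<le> t \<Longrightarrow>
      E y w t + (\<integral>\<^sup>+\<theta>\<in>{w<..<t}. lam y \<theta> * E y w \<theta> \<partial>lborel) = 1"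
    and E_left: "\<And>y w t. y \<in> space M \<Longrightarrow> w \<le> t \<Longrightarrow>
      E y w t + (\<integral>\<^sup>+\<theta>\<in>{w<..<t}. lam y \<theta> * E y \<theta> t \<partial>lborel) = 1"
    and Q: "kernel (M \<Otimes>\<^sub>M borel) M (\<lambda>(z, w). Q z w)"
    and mu: "kernel borel M mu"
    and x: "x \<in> space M"
begin

text \<open>Integration against the influx measure at time \<open>w\<close>, kept as a functional so
  that this measure, which may be infinite, need not be built.\<close>

definition flux :: "real \<Rightarrow> ('a \<Rightarrow> ennreal) \<Rightarrow> ennreal" where
  "flux w f = (\<integral>\<^sup>+z. \<integral>\<^sup>+y. f y \<partial>Q z w \<partial>mu w)"

text \<open>The equation of the theorem in variation-of-constants form: mass present at
  \<open>t\<close> is either initial or entered at some time \<open>w\<close>, and has survived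
  since then.\<close>

definition mild :: "real \<Rightarrow> 'a set \<Rightarrow> bool" where
  "mild t B \<longleftrightarrow> emeasure (mu t) B = indicator B x * E x u t +
      (\<integral>\<^sup>+w\<in>{u<..<t}. flux w (\<lambda>y. indicator B y * E y w t) \<partial>lborel)"

text \<open>The outflow stands on the left, because moving it over would mean a subtraction in
  \<open>ennreal\<close>.\<close>

definition balance :: "real \<Rightarrow> 'a set \<Rightarrow> bool" where
  "balance t B \<longleftrightarrow> emeasure (mu t) B + (\<integral>\<^sup>+w\<in>{u<..<t}. (\<integral>\<^sup>+y. indicator B y * lam y w \<partial>mu w) \<partial>lborel) =
      indicator B x + (\<integral>\<^sup>+w\<in>{u<..<t}. flux w (indicator B) \<partial>lborel)"

lemma lam_measurable [measurable (raw)]: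
  assumes "a \<in> N \<rightarrow>\<^sub>M M" "b \<in> borel_measurable N"
  shows "(\<lambda>p. lam (a p) (b p)) \<in> borel_measurable N"
  using measurable_compose[OF measurable_Pair[OF assms] lam] by simp

lemmas E_measurable [measurable (raw)] = borel_measurable_uncurry3[OF E]

lemma mu_measurable [measurable (raw)]:
  assumes "w \<in> borel_measurable N" "(\<lambda>(p, y). f p y) \<in> borel_measurable (N \<Otimes>\<^sub>M M)"
  shows "(\<lambda>p. \<integral>\<^sup>+y. f p y \<partial>mu (w p)) \<in> borel_measurable N"
  by (rule borel_measurable_kernel_nn_integral'[OF mu assms])

lemma flux_measurable [measurable (raw)]:
  assumes w[measurable]: "w \<in> borel_measurable N"
    and f[measurable]: "(\<lambda>(p, y). f p y) \<in> borel_measurable (N \<Otimes>\<^sub>M M)"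
  shows "(\<lambda>p. flux (w p) (f p)) \<in> borel_measurable N"
proof -
  have "(\<lambda>q. \<integral>\<^sup>+y. f (fst q) y \<partial>(case (snd q, w (fst q)) of (z, w) \<Rightarrow> Q z w)) \<in> borel_measurable (N \<Otimes>\<^sub>M M)"
    by (rule borel_measurable_kernel_nn_integral'[OF Q]) measurable
  then have "(\<lambda>(p, z). \<integral>\<^sup>+y. f p y \<partial>Q z (w p)) \<in> borel_measurable (N \<Otimes>\<^sub>M M)"
    by (simp add: case_prod_beta')
  then show ?thesis unfolding flux_def by (rule mu_measurable[OF w])
qed

lemma sets_mu: "sets (mu w) = sets M" and finite_mu: "finite_measure (mu w)"
  and space_mu: "space (mu w) = space M"
  using kernel_sets[OF mu] kernel_finite[OF mu] kernel_space[OF mu] by auto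

lemma sets_Q: "z \<in> space M \<Longrightarrow> sets (Q z w) = sets M" and finite_Q: "z \<in> space M \<Longrightarrow> finite_measure (Q z w)"
  using kernel_sets[OF Q, of "(z, w)"] kernel_finite[OF Q, of "(z, w)"] by (auto simp: space_pair_measure)

lemma integral_functional_flux: "integral_functional M (flux w)"
proof -
  have "integral_functional M (\<lambda>f. \<integral>\<^sup>+z. (\<integral>\<^sup>+y. f y \<partial>Q z w) \<partial>mu w)"
  proof (rule integral_functional_integral)
    show "integral_functional M (\<lambda>f. \<integral>\<^sup>+y. f y \<partial>Q z w)" if "z \<in> space (mu w)" for z
      using that by (intro integral_functional_nn_integral sets_Q) (simp add: space_mu)
    fix f :: "'a \<Rightarrow> ennreal" assume [measurable]: "f \<in> borel_measurable M"
    have "(\<lambda>z. \<integral>\<^sup>+y. f y \<partial>(case (z, w) of (z, w) \<Rightarrow> Q z w)) \<in> borel_measurable M"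
      by (rule borel_measurable_kernel_nn_integral'[OF Q]) measurable
    then show "(\<lambda>z. \<integral>\<^sup>+y. f y \<partial>Q z w) \<in> borel_measurable (mu w)"
      using measurable_cong_sets[OF sets_mu refl] by auto
  qed
  then show ?thesis unfolding flux_def[abs_def] .
qed

lemma flux_Fubini:
  assumes g[measurable]: "(\<lambda>(\<theta>, y). g \<theta> y) \<in> borel_measurable (borel \<Otimes>\<^sub>M M)"
  shows "flux w (\<lambda>y. \<integral>\<^sup>+\<theta>. g \<theta> y \<partial>lborel) = (\<integral>\<^sup>+\<theta>. flux w (g \<theta>) \<partial>(lborel::real measure))"
proof -
  have "flux w (\<lambda>y. \<integral>\<^sup>+\<theta>. g \<theta> y \<partial>lborel) = (\<integral>\<^sup>+z. \<integral>\<^sup>+\<theta>. \<integral>\<^sup>+y. g \<theta> y \<partial>Q z w \<partial>lborel \<partial>mu w)"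
    unfolding flux_def
  proof (rule nn_integral_cong)
    fix z assume "z \<in> space (mu w)"
    then have z: "z \<in> space M" by (simp add: space_mu)
    have "sets (Q z w \<Otimes>\<^sub>M (borel::real measure)) = sets (M \<Otimes>\<^sub>M borel)"
      by (intro sets_pair_measure_cong) (auto simp: sets_Q[OF z])
    moreover have "(\<lambda>(y, \<theta>). g \<theta> y) \<in> borel_measurable (M \<Otimes>\<^sub>M borel)" by measurable
    ultimately have "(\<lambda>(y, \<theta>). g \<theta> y) \<in> borel_measurable (Q z w \<Otimes>\<^sub>M borel)"
      using measurable_cong_sets by blast
    then show "(\<integral>\<^sup>+y. \<integral>\<^sup>+\<theta>. g \<theta> y \<partial>lborel \<partial>Q z w) = (\<integral>\<^sup>+\<theta>. \<integral>\<^sup>+y. g \<theta> y \<partial>Q z w \<partial>lborel)"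
      by (rule finite_measure_Fubini_lborel[OF finite_Q[OF z]])
  qed
  also have "\<dots> = (\<integral>\<^sup>+\<theta>. \<integral>\<^sup>+z. \<integral>\<^sup>+y. g \<theta> y \<partial>Q z w \<partial>mu w \<partial>lborel)"
  proof (rule finite_measure_Fubini_lborel[OF finite_mu])
    have "(\<lambda>q. \<integral>\<^sup>+y. g (snd q) y \<partial>(case (fst q, w) of (z, w) \<Rightarrow> Q z w)) \<in> borel_measurable (M \<Otimes>\<^sub>M borel)"
      by (rule borel_measurable_kernel_nn_integral'[OF Q]) measurable
    then have "(\<lambda>(z, \<theta>). \<integral>\<^sup>+y. g \<theta> y \<partial>Q z w) \<in> borel_measurable (M \<Otimes>\<^sub>M borel)"
      by (simp add: case_prod_beta')
    moreover have "sets (mu w \<Otimes>\<^sub>M (borel::real measure)) = sets (M \<Otimes>\<^sub>M borel)"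
      by (intro sets_pair_measure_cong) (auto simp: sets_mu)
    ultimately show "(\<lambda>(z, \<theta>). \<integral>\<^sup>+y. g \<theta> y \<partial>Q z w) \<in> borel_measurable (mu w \<Otimes>\<^sub>M borel)"
      using measurable_cong_sets by blast
  qed
  finally show ?thesis unfolding flux_def .
qed

lemma mu_Fubini:
  assumes g[measurable]: "(\<lambda>(\<theta>, y). g \<theta> y) \<in> borel_measurable (borel \<Otimes>\<^sub>M M)"
  shows "(\<integral>\<^sup>+y. \<integral>\<^sup>+\<theta>. g \<theta> y \<partial>lborel \<partial>mu w) = (\<integral>\<^sup>+\<theta>. \<integral>\<^sup>+y. g \<theta> y \<partial>mu w \<partial>(lborel::real measure))"
proof (rule finite_measure_Fubini_lborel[OF finite_mu])
  have "(\<lambda>(y, \<theta>). g \<theta> y) \<in> borel_measurable (M \<Otimes>\<^sub>M borel)" by measurable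
  moreover have "sets (mu w \<Otimes>\<^sub>M (borel::real measure)) = sets (M \<Otimes>\<^sub>M borel)"
    by (intro sets_pair_measure_cong) (auto simp: sets_mu)
  ultimately show "(\<lambda>(y, \<theta>). g \<theta> y) \<in> borel_measurable (mu w \<Otimes>\<^sub>M borel)"
    using measurable_cong_sets by blast
qed

text \<open>E y w t is the probability that a Poisson clock of rate lam y does not ring between w and t;
  K y w \<theta> stands for the density of its first or of its last ring \<theta> in that interval.\<close>

lemma flux_split:
  assumes K: "(\<lambda>(y, w, \<theta>). K y w \<theta>) \<in> borel_measurable (M \<Otimes>\<^sub>M (borel \<Otimes>\<^sub>M borel))"
    and EK: "\<And>y w. y \<in> space M \<Longrightarrow> w < t \<Longrightarrow> E y w t + (\<integral>\<^sup>+\<theta>\<in>{w<..<t}. K y w \<theta> \<partial>lborel) = 1"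
    and "u < t" and B[measurable]: "B \<in> sets M"
  shows "indicator B x + (\<integral>\<^sup>+w\<in>{u<..<t}. flux w (indicator B) \<partial>lborel) =
    (indicator B x * E x u t + (\<integral>\<^sup>+w\<in>{u<..<t}. flux w (\<lambda>y. indicator B y * E y w t) \<partial>lborel)) +
    (\<integral>\<^sup>+\<theta>\<in>{u<..<t}. (indicator B x * K x u \<theta> +
      (\<integral>\<^sup>+w\<in>{u<..<\<theta>}. flux w (\<lambda>y. indicator B y * K y w \<theta>) \<partial>lborel)) \<partial>lborel)"
proof -
  note Km[measurable (raw)] = borel_measurable_uncurry3[OF K]
  have fluxK[measurable]: "(\<lambda>(w, \<theta>). flux w (\<lambda>y. indicator B y * K y w \<theta>)) \<in> borel_measurable (borel \<Otimes>\<^sub>M borel)"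
    by measurable
  have Kx[measurable]: "(\<lambda>\<theta>. K x u \<theta>) \<in> borel_measurable borel"
    by (rule Km) (simp_all add: x)
  have pt: "indicator B y * E y w t + (\<integral>\<^sup>+\<theta>. indicator B y * K y w \<theta> * indicator {w<..<t} \<theta> \<partial>lborel) = indicator B y"
    if "y \<in> space M" "w < t" for y w
  proof -
    have [measurable]: "(\<lambda>\<theta>. K y w \<theta>) \<in> borel_measurable borel"
      by (rule Km) (simp_all add: that)
    have "(\<integral>\<^sup>+\<theta>. indicator B y * K y w \<theta> * indicator {w<..<t} \<theta> \<partial>lborel) = indicator B y * (\<integral>\<^sup>+\<theta>\<in>{w<..<t}. K y w \<theta> \<partial>lborel)"
      unfolding mult.assoc by (rule nn_integral_cmult) measurable
    then show ?thesis using EK[OF that] by (simp add: distrib_left[symmetric])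
  qed
  have fl: "flux w (indicator B) = flux w (\<lambda>y. indicator B y * E y w t) +
      (\<integral>\<^sup>+\<theta>\<in>{w<..<t}. flux w (\<lambda>y. indicator B y * K y w \<theta>) \<partial>lborel)" if "w < t" for w
  proof -
    have "flux w (indicator B) = flux w (\<lambda>y. indicator B y * E y w t + (\<integral>\<^sup>+\<theta>. indicator B y * K y w \<theta> * indicator {w<..<t} \<theta> \<partial>lborel))"
      using pt[OF _ that] by (intro integral_functional_cong[OF integral_functional_flux]) auto
    also have "\<dots> = flux w (\<lambda>y. indicator B y * E y w t) + flux w (\<lambda>y. \<integral>\<^sup>+\<theta>. indicator B y * K y w \<theta> * indicator {w<..<t} \<theta> \<partial>lborel)"
      by (rule integral_functional_plus[OF integral_functional_flux]) measurable
    also have "flux w (\<lambda>y. \<integral>\<^sup>+\<theta>. indicator B y * K y w \<theta> * indicator {w<..<t} \<theta> \<partial>lborel) =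
        (\<integral>\<^sup>+\<theta>. flux w (\<lambda>y. indicator B y * K y w \<theta> * indicator {w<..<t} \<theta>) \<partial>lborel)"
      by (rule flux_Fubini) measurable
    also have "\<dots> = (\<integral>\<^sup>+\<theta>\<in>{w<..<t}. flux w (\<lambda>y. indicator B y * K y w \<theta>) \<partial>lborel)"
    proof (rule nn_integral_cong)
      fix \<theta>
      have "flux w (\<lambda>y. indicator {w<..<t} \<theta> * (indicator B y * K y w \<theta>)) =
          indicator {w<..<t} \<theta> * flux w (\<lambda>y. indicator B y * K y w \<theta>)"
        by (rule integral_functional_cmult[OF integral_functional_flux]) measurable
      then show "flux w (\<lambda>y. indicator B y * K y w \<theta> * indicator {w<..<t} \<theta>) =
          flux w (\<lambda>y. indicator B y * K y w \<theta>) * indicator {w<..<t} \<theta>"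
        by (simp add: mult.commute)
    qed
    finally show ?thesis .
  qed
  have "(\<integral>\<^sup>+w\<in>{u<..<t}. flux w (indicator B) \<partial>lborel) =
      (\<integral>\<^sup>+w. flux w (\<lambda>y. indicator B y * E y w t) * indicator {u<..<t} w +
        (\<integral>\<^sup>+\<theta>\<in>{w<..<t}. flux w (\<lambda>y. indicator B y * K y w \<theta>) \<partial>lborel) * indicator {u<..<t} w \<partial>lborel)"
    by (rule nn_integral_cong) (auto simp: fl indicator_def)
  also have "\<dots> = (\<integral>\<^sup>+w\<in>{u<..<t}. flux w (\<lambda>y. indicator B y * E y w t) \<partial>lborel) +
      (\<integral>\<^sup>+w\<in>{u<..<t}. (\<integral>\<^sup>+\<theta>\<in>{w<..<t}. flux w (\<lambda>y. indicator B y * K y w \<theta>) \<partial>lborel) \<partial>lborel)"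
    by (rule nn_integral_add) measurable
  \<comment> \<open>After the exchange the outer variable is the ring time \<theta>. At fixed
    \<theta> the inner bracket is the right-hand side of one of the two equations, which the
    applications replace by integrals against \<open>mu\<close>.\<close>
  also have "(\<integral>\<^sup>+w\<in>{u<..<t}. (\<integral>\<^sup>+\<theta>\<in>{w<..<t}. flux w (\<lambda>y. indicator B y * K y w \<theta>) \<partial>lborel) \<partial>lborel) =
      (\<integral>\<^sup>+\<theta>\<in>{u<..<t}. (\<integral>\<^sup>+w\<in>{u<..<\<theta>}. flux w (\<lambda>y. indicator B y * K y w \<theta>) \<partial>lborel) \<partial>lborel)"
    by (rule lborel_triangle_swap[OF fluxK])
  finally have 1: "(\<integral>\<^sup>+w\<in>{u<..<t}. flux w (indicator B) \<partial>lborel) =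
      (\<integral>\<^sup>+w\<in>{u<..<t}. flux w (\<lambda>y. indicator B y * E y w t) \<partial>lborel) +
      (\<integral>\<^sup>+\<theta>\<in>{u<..<t}. (\<integral>\<^sup>+w\<in>{u<..<\<theta>}. flux w (\<lambda>y. indicator B y * K y w \<theta>) \<partial>lborel) \<partial>lborel)" .
  have 2: "(\<integral>\<^sup>+\<theta>\<in>{u<..<t}. (indicator B x * K x u \<theta> +
      (\<integral>\<^sup>+w\<in>{u<..<\<theta>}. flux w (\<lambda>y. indicator B y * K y w \<theta>) \<partial>lborel)) \<partial>lborel) =
      (\<integral>\<^sup>+\<theta>. indicator B x * K x u \<theta> * indicator {u<..<t} \<theta> \<partial>lborel) +
      (\<integral>\<^sup>+\<theta>\<in>{u<..<t}. (\<integral>\<^sup>+w\<in>{u<..<\<theta>}. flux w (\<lambda>y. indicator B y * K y w \<theta>) \<partial>lborel) \<partial>lborel)"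
    unfolding distrib_right by (rule nn_integral_add) measurable
  have rearrange: "c + (d + e) = (a + d) + (b + e)" if "a + b = c" for a b c d e :: ennreal
    unfolding that[symmetric] by (simp only: ac_simps)
  show ?thesis unfolding 1 2 by (rule rearrange[OF pt[OF x \<open>u < t\<close>]])
qed

lemma integral_functional_mild:
  "integral_functional M (\<lambda>f. f x * E x u t + (\<integral>\<^sup>+w\<in>{u<..<t}. flux w (\<lambda>y. f y * E y w t) \<partial>lborel))"
proof (intro integral_functional_add integral_functional_cmultr integral_functional_point x integral_functional_integral
    integral_functional_mult[OF integral_functional_flux])
  fix f :: "'a \<Rightarrow> ennreal" assume [measurable]: "f \<in> borel_measurable M"
  show "(\<lambda>w. flux w (\<lambda>y. f y * E y w t) * indicator {u<..<t} w) \<in> borel_measurable lborel"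
    by measurable
qed measurable

lemma mild_nn_integral:
  assumes mild: "\<And>B. B \<in> sets M \<Longrightarrow> mild t B" and f: "f \<in> borel_measurable M"
  shows "(\<integral>\<^sup>+y. f y \<partial>mu t) = f x * E x u t +
      (\<integral>\<^sup>+w\<in>{u<..<t}. flux w (\<lambda>y. f y * E y w t) \<partial>lborel)"
proof (rule integral_functional_eqI[OF _ integral_functional_mild _ f, where L="\<lambda>f. \<integral>\<^sup>+y. f y \<partial>mu t"])
  show "integral_functional M (\<lambda>f. \<integral>\<^sup>+y. f y \<partial>mu t)"
    by (rule integral_functional_nn_integral[OF sets_mu])
  show "(\<integral>\<^sup>+y. indicator B y \<partial>mu t) = indicator B x * E x u t +
      (\<integral>\<^sup>+w\<in>{u<..<t}. flux w (\<lambda>y. indicator B y * E y w t) \<partial>lborel)" if "B \<in> sets M" for B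
    using mild[OF that] that unfolding mild_def by (simp add: sets_mu)
qed

text \<open>Both sides are continuous along increasing sequences of sets, infinite values included.
  This lifts the equation from bounded sets to all sets.\<close>

lemma mild_UN:
  assumes A: "\<And>n. A n \<in> sets M" "incseq A" and mild: "\<And>n. mild t (A n)"
  shows "mild t (\<Union>n. A n)"
proof -
  let ?R = "\<lambda>f. f x * E x u t + (\<integral>\<^sup>+w\<in>{u<..<t}. flux w (\<lambda>y. f y * E y w t) \<partial>lborel)"
  have inc: "incseq (\<lambda>n. indicator (A n) :: 'a \<Rightarrow> ennreal)"
    using A(2) by (auto simp: incseq_def le_fun_def indicator_def)
  have sup: "(SUP n. indicator (A n) y :: ennreal) = indicator (\<Union>n. A n) y" for y
  proof (cases "y \<in> (\<Union>n. A n)")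
    case True
    then obtain n where n: "y \<in> A n" by blast
    have "(SUP n. indicator (A n) y :: ennreal) = 1"
    proof (rule antisym)
      show "1 \<le> (SUP n. indicator (A n) y :: ennreal)"
        using n by (intro SUP_upper2[of n]) auto
    qed (auto intro!: SUP_least simp: indicator_def)
    then show ?thesis using True by simp
  next
    case False
    then have "y \<notin> A n" for n by blast
    then show ?thesis using False by simp
  qed
  have "?R (\<lambda>y. SUP n. indicator (A n) y) = (SUP n. ?R (indicator (A n)))"
    by (rule integral_functional_SUP[OF integral_functional_mild _ inc]) (use A(1) in simp)
  moreover have "?R (indicator (A n)) = emeasure (mu t) (A n)" for n
    using mild[of n] unfolding mild_def by (simp only:)
  moreover have "(SUP n. emeasure (mu t) (A n)) = emeasure (mu t) (\<Union>n. A n)"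
    using A by (intro SUP_emeasure_incseq) (auto simp: sets_mu)
  ultimately show ?thesis unfolding mild_def by (simp only: sup)
qed

text \<open>Splits the initial mass and the influx by the first ring after entry, with density
  \<open>lam y \<theta> * E y w \<theta>\<close>. The part without a ring is the right-hand side of
  \<open>mild\<close> at \<open>t\<close>. The part with first ring at \<theta> is the right-hand
  side of \<open>mild\<close> at \<theta>, tested with the rate on \<open>B\<close>, hence the
  outflow at \<theta>.\<close>

theorem mild_imp_balance:
  assumes mild: "\<And>\<theta> C. u < \<theta> \<Longrightarrow> \<theta> \<le> t \<Longrightarrow> C \<in> sets M \<Longrightarrow> mild \<theta> C"
    and "u < t" and B[measurable]: "B \<in> sets M"
  shows "balance t B"
proof -
  have "indicator B x + (\<integral>\<^sup>+w\<in>{u<..<t}. flux w (indicator B) \<partial>lborel) =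
    (indicator B x * E x u t + (\<integral>\<^sup>+w\<in>{u<..<t}. flux w (\<lambda>y. indicator B y * E y w t) \<partial>lborel)) +
    (\<integral>\<^sup>+\<theta>\<in>{u<..<t}. (indicator B x * (lam x \<theta> * E x u \<theta>) +
      (\<integral>\<^sup>+w\<in>{u<..<\<theta>}. flux w (\<lambda>y. indicator B y * (lam y \<theta> * E y w \<theta>)) \<partial>lborel)) \<partial>lborel)"
    by (rule flux_split[where K="\<lambda>y w \<theta>. lam y \<theta> * E y w \<theta>"])
      (use E_right \<open>u < t\<close> in \<open>auto\<close>)
  also have "(\<integral>\<^sup>+\<theta>\<in>{u<..<t}. (indicator B x * (lam x \<theta> * E x u \<theta>) +
      (\<integral>\<^sup>+w\<in>{u<..<\<theta>}. flux w (\<lambda>y. indicator B y * (lam y \<theta> * E y w \<theta>)) \<partial>lborel)) \<partial>lborel) =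
      (\<integral>\<^sup>+\<theta>\<in>{u<..<t}. (\<integral>\<^sup>+y. indicator B y * lam y \<theta> \<partial>mu \<theta>) \<partial>lborel)"
  proof (rule nn_integral_cong)
    fix \<theta>
    show "(indicator B x * (lam x \<theta> * E x u \<theta>) +
      (\<integral>\<^sup>+w\<in>{u<..<\<theta>}. flux w (\<lambda>y. indicator B y * (lam y \<theta> * E y w \<theta>)) \<partial>lborel)) * indicator {u<..<t} \<theta> =
      (\<integral>\<^sup>+y. indicator B y * lam y \<theta> \<partial>mu \<theta>) * indicator {u<..<t} \<theta>"
    proof (cases "\<theta> \<in> {u<..<t}")
      case True
      have "(\<integral>\<^sup>+y. indicator B y * lam y \<theta> \<partial>mu \<theta>) = indicator B x * lam x \<theta> * E x u \<theta> +
        (\<integral>\<^sup>+w\<in>{u<..<\<theta>}. flux w (\<lambda>y. indicator B y * lam y \<theta> * E y w \<theta>) \<partial>lborel)"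
        using True by (intro mild_nn_integral mild) auto
      then show ?thesis by (simp add: mult.assoc)
    qed simp
  qed
  also have "indicator B x * E x u t + (\<integral>\<^sup>+w\<in>{u<..<t}. flux w (\<lambda>y. indicator B y * E y w t) \<partial>lborel) = emeasure (mu t) B"
    using mild[OF \<open>u < t\<close> order_refl B] by (simp add: mild_def)
  finally show ?thesis by (simp add: balance_def)
qed

text \<open>The factor \<open>indicator B\<close> in the test function reduces every set to its part
  inside \<open>B\<close>, so the balance equation is demanded for subsets of \<open>B\<close>
  only.\<close>

lemma balance_nn_integral:
  assumes bal: "\<And>C. C \<in> sets M \<Longrightarrow> C \<subseteq> B \<Longrightarrow> balance t C" and B[measurable]: "B \<in> sets M"
    and f: "f \<in> borel_measurable M"
  shows "(\<integral>\<^sup>+y. f y * indicator B y \<partial>mu t) + (\<integral>\<^sup>+w\<in>{u<..<t}. (\<integral>\<^sup>+y. f y * (indicator B y * lam y w) \<partial>mu w) \<partial>lborel) =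
      f x * indicator B x + (\<integral>\<^sup>+w\<in>{u<..<t}. flux w (\<lambda>y. f y * indicator B y) \<partial>lborel)"
proof (rule integral_functional_eqI[OF _ _ _ f, where
      L="\<lambda>f. (\<integral>\<^sup>+y. f y * indicator B y \<partial>mu t) + (\<integral>\<^sup>+w\<in>{u<..<t}. (\<integral>\<^sup>+y. f y * (indicator B y * lam y w) \<partial>mu w) \<partial>lborel)" and
      R="\<lambda>f. f x * indicator B x + (\<integral>\<^sup>+w\<in>{u<..<t}. flux w (\<lambda>y. f y * indicator B y) \<partial>lborel)"])
  show "integral_functional M (\<lambda>f. (\<integral>\<^sup>+y. f y * indicator B y \<partial>mu t) + (\<integral>\<^sup>+w\<in>{u<..<t}. (\<integral>\<^sup>+y. f y * (indicator B y * lam y w) \<partial>mu w) \<partial>lborel))"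
  proof (rule integral_functional_add)
    show "integral_functional M (\<lambda>f. \<integral>\<^sup>+y. f y * indicator B y \<partial>mu t)"
      by (rule integral_functional_mult[OF integral_functional_nn_integral[OF sets_mu]]) measurable
    show "integral_functional M (\<lambda>f. \<integral>\<^sup>+w\<in>{u<..<t}. (\<integral>\<^sup>+y. f y * (indicator B y * lam y w) \<partial>mu w) \<partial>lborel)"
    proof (rule integral_functional_integral)
      show "integral_functional M (\<lambda>f. (\<integral>\<^sup>+y. f y * (indicator B y * lam y w) \<partial>mu w) * indicator {u<..<t} w)" for w
        by (rule integral_functional_cmultr, rule integral_functional_mult[OF integral_functional_nn_integral[OF sets_mu]]) measurable
      fix f :: "'a \<Rightarrow> ennreal" assume [measurable]: "f \<in> borel_measurable M"
      show "(\<lambda>w. (\<integral>\<^sup>+y. f y * (indicator B y * lam y w) \<partial>mu w) * indicator {u<..<t} w) \<in> borel_measurable lborel"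
        by measurable
    qed
  qed
  show "integral_functional M (\<lambda>f. f x * indicator B x + (\<integral>\<^sup>+w\<in>{u<..<t}. flux w (\<lambda>y. f y * indicator B y) \<partial>lborel))"
  proof (intro integral_functional_add integral_functional_cmultr integral_functional_point x integral_functional_integral
      integral_functional_mult[OF integral_functional_flux])
    fix f :: "'a \<Rightarrow> ennreal" assume [measurable]: "f \<in> borel_measurable M"
    show "(\<lambda>w. flux w (\<lambda>y. f y * indicator B y) * indicator {u<..<t} w) \<in> borel_measurable lborel"
      by measurable
  qed measurable
  fix C assume C: "C \<in> sets M"
  have "balance t (C \<inter> B)" using C by (intro bal) auto
  moreover have "emeasure (mu t) (C \<inter> B) = (\<integral>\<^sup>+y. indicator C y * indicator B y \<partial>mu t)"
    using C by (simp add: sets_mu nn_integral_indicator[symmetric] indicator_inter_arith del: nn_integral_indicator)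
  ultimately show "(\<integral>\<^sup>+y. indicator C y * indicator B y \<partial>mu t) + (\<integral>\<^sup>+w\<in>{u<..<t}. (\<integral>\<^sup>+y. indicator C y * (indicator B y * lam y w) \<partial>mu w) \<partial>lborel) =
      indicator C x * indicator B x + (\<integral>\<^sup>+w\<in>{u<..<t}. flux w (\<lambda>y. indicator C y * indicator B y) \<partial>lborel)"
    unfolding balance_def indicator_inter_arith[abs_def] by (simp add: mult.assoc)
qed

text \<open>Splits the initial mass and the influx by the last ring before \<open>t\<close>, with
  density \<open>lam y \<theta> * E y \<theta> t\<close>. For fixed \<theta> the balance equation up
  to \<theta>, tested with this function on \<open>B\<close>, turns the part with a ring into
  weighted mass at \<theta> plus weighted outflow before \<theta>. Integrated over \<theta>, the two
  reassemble to the total outflow, which is then cancelled.\<close>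

theorem balance_imp_mild:
  assumes bal: "\<And>\<theta> C. u < \<theta> \<Longrightarrow> \<theta> \<le> t \<Longrightarrow> C \<in> sets M \<Longrightarrow> C \<subseteq> B \<Longrightarrow> balance \<theta> C"
    and "u < t" and B[measurable]: "B \<in> sets M"
    and fin: "(\<integral>\<^sup>+w\<in>{u<..<t}. (\<integral>\<^sup>+y. indicator B y * lam y w \<partial>mu w) \<partial>lborel) < \<infinity>"
  shows "mild t B"
proof -
  let ?R = "indicator B x * E x u t + (\<integral>\<^sup>+w\<in>{u<..<t}. flux w (\<lambda>y. indicator B y * E y w t) \<partial>lborel)"
  let ?F = "\<integral>\<^sup>+w\<in>{u<..<t}. (\<integral>\<^sup>+y. indicator B y * lam y w \<partial>mu w) \<partial>lborel"
  let ?G = "\<lambda>w \<theta>. \<integral>\<^sup>+y. indicator B y * lam y w * (lam y \<theta> * E y \<theta> t) \<partial>mu w"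
  have "indicator B x + (\<integral>\<^sup>+w\<in>{u<..<t}. flux w (indicator B) \<partial>lborel) = ?R +
    (\<integral>\<^sup>+\<theta>\<in>{u<..<t}. (indicator B x * (lam x \<theta> * E x \<theta> t) +
      (\<integral>\<^sup>+w\<in>{u<..<\<theta>}. flux w (\<lambda>y. indicator B y * (lam y \<theta> * E y \<theta> t)) \<partial>lborel)) \<partial>lborel)"
    by (rule flux_split[where K="\<lambda>y w \<theta>. lam y \<theta> * E y \<theta> t"])
      (use E_left \<open>u < t\<close> in \<open>auto\<close>)
  also have "(\<integral>\<^sup>+\<theta>\<in>{u<..<t}. (indicator B x * (lam x \<theta> * E x \<theta> t) +
      (\<integral>\<^sup>+w\<in>{u<..<\<theta>}. flux w (\<lambda>y. indicator B y * (lam y \<theta> * E y \<theta> t)) \<partial>lborel)) \<partial>lborel) =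
      (\<integral>\<^sup>+\<theta>\<in>{u<..<t}. ((\<integral>\<^sup>+y. indicator B y * lam y \<theta> * E y \<theta> t \<partial>mu \<theta>) + (\<integral>\<^sup>+w\<in>{u<..<\<theta>}. ?G w \<theta> \<partial>lborel)) \<partial>lborel)"
  proof (rule nn_integral_cong)
    fix \<theta>
    show "(indicator B x * (lam x \<theta> * E x \<theta> t) +
      (\<integral>\<^sup>+w\<in>{u<..<\<theta>}. flux w (\<lambda>y. indicator B y * (lam y \<theta> * E y \<theta> t)) \<partial>lborel)) * indicator {u<..<t} \<theta> =
      ((\<integral>\<^sup>+y. indicator B y * lam y \<theta> * E y \<theta> t \<partial>mu \<theta>) + (\<integral>\<^sup>+w\<in>{u<..<\<theta>}. ?G w \<theta> \<partial>lborel)) * indicator {u<..<t} \<theta>"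
    proof (cases "\<theta> \<in> {u<..<t}")
      case True
      have e: "lam y \<theta> * E y \<theta> t * indicator B y = indicator B y * (lam y \<theta> * E y \<theta> t)"
        "lam y \<theta> * E y \<theta> t * (indicator B y * lam y w) = indicator B y * lam y w * (lam y \<theta> * E y \<theta> t)"
        "indicator B y * lam y \<theta> * E y \<theta> t = indicator B y * (lam y \<theta> * E y \<theta> t)" for y w
        by (simp_all only: mult.assoc mult.commute mult.left_commute)
      have [measurable]: "(\<lambda>y. lam y \<theta> * E y \<theta> t) \<in> borel_measurable M" by measurable
      have "(\<integral>\<^sup>+y. lam y \<theta> * E y \<theta> t * indicator B y \<partial>mu \<theta>) +
          (\<integral>\<^sup>+w\<in>{u<..<\<theta>}. (\<integral>\<^sup>+y. lam y \<theta> * E y \<theta> t * (indicator B y * lam y w) \<partial>mu w) \<partial>lborel) =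
          lam x \<theta> * E x \<theta> t * indicator B x +
          (\<integral>\<^sup>+w\<in>{u<..<\<theta>}. flux w (\<lambda>y. lam y \<theta> * E y \<theta> t * indicator B y) \<partial>lborel)"
      proof (rule balance_nn_integral[where f="\<lambda>y. lam y \<theta> * E y \<theta> t" and B=B and t=\<theta>])
        show "balance \<theta> C" if "C \<in> sets M" "C \<subseteq> B" for C
          by (rule bal) (use True that in auto)
      qed measurable
      then show ?thesis unfolding e by (simp only:)
    qed simp
  qed
  also have "\<dots> = (\<integral>\<^sup>+\<theta>. (\<integral>\<^sup>+y. indicator B y * lam y \<theta> * E y \<theta> t \<partial>mu \<theta>) * indicator {u<..<t} \<theta> \<partial>lborel) +
      (\<integral>\<^sup>+\<theta>\<in>{u<..<t}. (\<integral>\<^sup>+w\<in>{u<..<\<theta>}. ?G w \<theta> \<partial>lborel) \<partial>lborel)"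
    unfolding distrib_right by (rule nn_integral_add) measurable
  also have "(\<integral>\<^sup>+\<theta>\<in>{u<..<t}. (\<integral>\<^sup>+w\<in>{u<..<\<theta>}. ?G w \<theta> \<partial>lborel) \<partial>lborel) =
      (\<integral>\<^sup>+w\<in>{u<..<t}. (\<integral>\<^sup>+\<theta>\<in>{w<..<t}. ?G w \<theta> \<partial>lborel) \<partial>lborel)"
    by (rule lborel_triangle_swap[symmetric]) measurable
  also have "(\<integral>\<^sup>+\<theta>. (\<integral>\<^sup>+y. indicator B y * lam y \<theta> * E y \<theta> t \<partial>mu \<theta>) * indicator {u<..<t} \<theta> \<partial>lborel) +
      (\<integral>\<^sup>+w\<in>{u<..<t}. (\<integral>\<^sup>+\<theta>\<in>{w<..<t}. ?G w \<theta> \<partial>lborel) \<partial>lborel) =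
      (\<integral>\<^sup>+w. (\<integral>\<^sup>+y. indicator B y * lam y w * E y w t \<partial>mu w) * indicator {u<..<t} w +
        (\<integral>\<^sup>+\<theta>\<in>{w<..<t}. ?G w \<theta> \<partial>lborel) * indicator {u<..<t} w \<partial>lborel)"
    by (rule nn_integral_add[symmetric]) measurable
  \<comment> \<open>\<open>E_left\<close> a second time: outflow at time \<open>w\<close> is counted
    once with weight \<open>E y w t\<close> and once with the weights of all last rings \<theta>
    after \<open>w\<close>, in total with weight 1.\<close>
  also have "\<dots> = ?F"
  proof (rule nn_integral_cong)
    fix w
    have "(\<integral>\<^sup>+y. indicator B y * lam y w * E y w t \<partial>mu w) + (\<integral>\<^sup>+\<theta>\<in>{w<..<t}. ?G w \<theta> \<partial>lborel) =
        (\<integral>\<^sup>+y. indicator B y * lam y w \<partial>mu w)" if "w < t"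
    proof -
      note m = measurable_cong_sets[OF sets_mu[of w] refl]
      have "(\<integral>\<^sup>+\<theta>\<in>{w<..<t}. ?G w \<theta> \<partial>lborel) =
          (\<integral>\<^sup>+\<theta>. \<integral>\<^sup>+y. indicator B y * lam y w * (lam y \<theta> * E y \<theta> t) * indicator {w<..<t} \<theta> \<partial>mu w \<partial>lborel)"
        by (rule nn_integral_cong, rule nn_integral_multc[symmetric], unfold m) measurable
      also have "\<dots> = (\<integral>\<^sup>+y. \<integral>\<^sup>+\<theta>. indicator B y * lam y w * (lam y \<theta> * E y \<theta> t) * indicator {w<..<t} \<theta> \<partial>lborel \<partial>mu w)"
        by (rule mu_Fubini[symmetric]) measurable
      also have "\<dots> = (\<integral>\<^sup>+y. indicator B y * lam y w * (\<integral>\<^sup>+\<theta>\<in>{w<..<t}. lam y \<theta> * E y \<theta> t \<partial>lborel) \<partial>mu w)"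
      proof (rule nn_integral_cong)
        fix y assume "y \<in> space (mu w)"
        then have y: "y \<in> space M" by (simp add: space_mu)
        show "(\<integral>\<^sup>+\<theta>. indicator B y * lam y w * (lam y \<theta> * E y \<theta> t) * indicator {w<..<t} \<theta> \<partial>lborel) =
            indicator B y * lam y w * (\<integral>\<^sup>+\<theta>\<in>{w<..<t}. lam y \<theta> * E y \<theta> t \<partial>lborel)"
          using y by (subst nn_integral_cmult[symmetric]) (auto simp: mult.assoc)
      qed
      finally have 1: "(\<integral>\<^sup>+\<theta>\<in>{w<..<t}. ?G w \<theta> \<partial>lborel) =
          (\<integral>\<^sup>+y. indicator B y * lam y w * (\<integral>\<^sup>+\<theta>\<in>{w<..<t}. lam y \<theta> * E y \<theta> t \<partial>lborel) \<partial>mu w)" .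
      have "(\<integral>\<^sup>+y. indicator B y * lam y w * E y w t \<partial>mu w) + (\<integral>\<^sup>+\<theta>\<in>{w<..<t}. ?G w \<theta> \<partial>lborel) =
          (\<integral>\<^sup>+y. indicator B y * lam y w * E y w t + indicator B y * lam y w * (\<integral>\<^sup>+\<theta>\<in>{w<..<t}. lam y \<theta> * E y \<theta> t \<partial>lborel) \<partial>mu w)"
        unfolding 1 by (rule nn_integral_add[symmetric]; unfold m) measurable
      also have "\<dots> = (\<integral>\<^sup>+y. indicator B y * lam y w \<partial>mu w)"
        using E_left[of _ w t] that
        by (intro nn_integral_cong) (simp add: space_mu distrib_left[symmetric])
      finally show ?thesis .
    qed
    then show "(\<integral>\<^sup>+y. indicator B y * lam y w * E y w t \<partial>mu w) * indicator {u<..<t} w +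
        (\<integral>\<^sup>+\<theta>\<in>{w<..<t}. ?G w \<theta> \<partial>lborel) * indicator {u<..<t} w =
        (\<integral>\<^sup>+y. indicator B y * lam y w \<partial>mu w) * indicator {u<..<t} w"
      by (auto simp: indicator_def)
  qed
  finally have "indicator B x + (\<integral>\<^sup>+w\<in>{u<..<t}. flux w (indicator B) \<partial>lborel) = ?R + ?F" .
  moreover have "emeasure (mu t) B + ?F = indicator B x + (\<integral>\<^sup>+w\<in>{u<..<t}. flux w (indicator B) \<partial>lborel)"
    using bal[OF \<open>u < t\<close> order_refl B order_refl] by (simp add: balance_def)
  ultimately have "?F + emeasure (mu t) B = ?F + ?R" by (simp add: add.commute)
  moreover have "?F \<noteq> \<infinity>" using fin by (rule less_imp_neq)
  ultimately show ?thesis unfolding mild_def ennreal_add_left_cancel by blast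
qed

end

section \<open>Q-functions\<close>

lemma signed_measure_Un:
  assumes sm: "signed_measure M \<nu>" and A: "A \<in> sets M" "B \<in> sets M" "A \<inter> B = {}"
  shows "\<nu> (A \<union> B) = \<nu> A + \<nu> B"
proof -
  have "range (binaryset A B) \<subseteq> sets M" "disjoint_family (binaryset A B)"
    using A by (auto simp: range_binaryset_eq disjoint_family_on_def binaryset_def)
  then have "(\<lambda>i. \<nu> (binaryset A B i)) sums \<nu> (\<Union>i. binaryset A B i)"
    using sm unfolding signed_measure_def by blast
  moreover have "(\<lambda>i. \<nu> (binaryset A B i)) sums (\<nu> A + \<nu> B)"
    using sm by (intro binaryset_sums) (simp add: signed_measure_def)
  ultimately show ?thesis by (simp add: UN_binaryset_eq sums_unique2)
qed

locale Q_process =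
  fixes M :: "'a measure" and T0 :: real and T1 :: ereal and q :: "'a \<Rightarrow> real \<Rightarrow> 'a set \<Rightarrow> real"
  assumes standard_borel: "standard_borel M"
    and Q_function: "Q_function M T0 T1 q"
    and conservative: "conservative M T0 T1 q"
begin

lemma signed: "y \<in> space M \<Longrightarrow> t \<in> ico T0 T1 \<Longrightarrow> signed_measure M (q y t)"
  and q_plus_nonneg: "y \<in> space M \<Longrightarrow> t \<in> ico T0 T1 \<Longrightarrow> B \<in> sets M \<Longrightarrow> 0 \<le> q_plus q y t B"
  and q_measurable: "B \<in> sets M \<Longrightarrow>
    (\<lambda>(y, t). q y t B) \<in> borel_measurable (M \<Otimes>\<^sub>M restrict_space borel (ico T0 T1))"
  using Q_function by (auto simp: Q_function_def q_plus_def)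

lemma separating_family:
  "\<exists>E::nat \<Rightarrow> 'a set. (\<forall>i. E i \<in> sets M) \<and>
    (\<forall>x\<in>space M. \<forall>y\<in>space M. x \<noteq> y \<longrightarrow> (\<exists>i. x \<in> E i \<and> y \<notin> E i))"
proof (cases "space M = {}")
  case False
  show ?thesis
  proof (rule standard_borel_parametrization[OF standard_borel False])
    fix E :: "nat \<Rightarrow> 'a set"
    assume "\<And>i. E i \<in> sets M" "\<And>x y. x \<in> space M \<Longrightarrow> y \<in> space M \<Longrightarrow> x \<noteq> y \<Longrightarrow> \<exists>i. x \<in> E i \<and> y \<notin> E i"
    then show ?thesis by blast
  qed
qed (auto intro: exI[of _ "\<lambda>i. {}"])

text \<open>Points of a standard Borel space are measurable: \<open>{y}\<close> is the intersection
  of those members of a countable separating family that contain \<open>y\<close>.\<close>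

lemma sets_singleton: assumes y: "y \<in> space M" shows "{y} \<in> sets M"
proof -
  obtain E :: "nat \<Rightarrow> 'a set" where E: "\<And>i. E i \<in> sets M"
    "\<And>x y. x \<in> space M \<Longrightarrow> y \<in> space M \<Longrightarrow> x \<noteq> y \<Longrightarrow> \<exists>i. x \<in> E i \<and> y \<notin> E i"
    using separating_family by blast
  have "{y} = (\<Inter>i. if y \<in> E i then E i \<inter> space M else space M)"
  proof (intro equalityI subsetI)
    fix z assume z: "z \<in> (\<Inter>i. if y \<in> E i then E i \<inter> space M else space M)"
    have zi: "z \<in> (if y \<in> E i then E i \<inter> space M else space M)" for i using z by blast
    have "z \<in> space M" using zi[of 0] by (simp split: if_splits)
    moreover have "z \<in> E i" if "y \<in> E i" for i using zi[of i] that by simp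
    ultimately have "z = y" using E(2)[OF y] by blast
    then show "z \<in> {y}" by simp
  qed (use y in auto)
  moreover have "(\<Inter>i. if y \<in> E i then E i \<inter> space M else space M) \<in> sets M"
    using E(1) by (intro sets.countable_INT) auto
  ultimately show ?thesis by (simp only:)
qed

lemma q_split:
  assumes y: "y \<in> space M" and t: "t \<in> ico T0 T1" and B: "B \<in> sets M"
  shows "q y t B = q_plus q y t B - indicator B y * q_rate q y t"
proof (cases "y \<in> B")
  case True
  have "q y t ((B - {y}) \<union> {y}) = q y t (B - {y}) + q y t {y}"
    using sets_singleton[OF y] B by (intro signed_measure_Un[OF signed[OF y t]]) auto
  moreover have "(B - {y}) \<union> {y} = B" using True by blast
  ultimately show ?thesis using True by (simp add: q_plus_def q_rate_def)
qed (simp add: q_plus_def)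

lemma q_rate_eq: "y \<in> space M \<Longrightarrow> t \<in> ico T0 T1 \<Longrightarrow> q_rate q y t = q_plus q y t (space M)"
  using q_split[of y t "space M"] conservative by (simp add: conservative_def)

lemma q_rate_nonneg: "y \<in> space M \<Longrightarrow> t \<in> ico T0 T1 \<Longrightarrow> 0 \<le> q_rate q y t"
  using q_plus_nonneg[of y t "space M"] by (simp add: q_rate_eq)

lemma sets_q_plus_measure: "sets (q_plus_measure M q y t) = sets M"
  and space_q_plus_measure: "space (q_plus_measure M q y t) = space M"
  unfolding q_plus_measure_def using sets.space_closed[of M] by (simp_all add: sets.sigma_sets_eq)

lemma emeasure_q_plus_measure:
  assumes y: "y \<in> space M" and t: "t \<in> ico T0 T1" and B: "B \<in> sets M"
  shows "emeasure (q_plus_measure M q y t) B = ennreal (q_plus q y t B)"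
proof (rule emeasure_measure_of[OF q_plus_measure_def[of M q y t]])
  show "sets M \<subseteq> Pow (space M)" by (rule sets.space_closed)
  show "B \<in> sets (q_plus_measure M q y t)" by (simp add: sets_q_plus_measure B)
  have "q y t {} = 0" using signed[OF y t] by (simp add: signed_measure_def)
  then show "positive (sets (q_plus_measure M q y t)) (\<lambda>B. ennreal (q_plus q y t B))"
    by (simp add: positive_def q_plus_def)
  show "countably_additive (sets (q_plus_measure M q y t)) (\<lambda>B. ennreal (q_plus q y t B))"
    unfolding sets_q_plus_measure countably_additive_def
  proof (intro allI impI)
    fix A :: "nat \<Rightarrow> 'a set"
    assume A: "range A \<subseteq> sets M" "disjoint_family A" "\<Union> (range A) \<in> sets M"
    have Ai: "A i \<in> sets M" for i using A(1) by blast
    have "range (\<lambda>i. A i - {y}) \<subseteq> sets M" using Ai sets_singleton[OF y] by auto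
    moreover have "disjoint_family (\<lambda>i. A i - {y})"
      using A(2) unfolding disjoint_family_on_def by blast
    ultimately have "(\<lambda>i. q y t (A i - {y})) sums q y t (\<Union>i. A i - {y})"
      using signed[OF y t] unfolding signed_measure_def by blast
    moreover have "(\<Union>i. A i - {y}) = \<Union> (range A) - {y}" by blast
    ultimately have s: "(\<lambda>i. q_plus q y t (A i)) sums q_plus q y t (\<Union> (range A))"
      by (simp add: q_plus_def)
    have "(\<Sum>i. ennreal (q_plus q y t (A i))) = ennreal (\<Sum>i. q_plus q y t (A i))"
      using s Ai by (intro suminf_ennreal2 q_plus_nonneg[OF y t]) (auto simp: sums_iff)
    then show "(\<Sum>i. ennreal (q_plus q y t (A i))) = ennreal (q_plus q y t (\<Union> (range A)))"
      using s by (simp add: sums_iff)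
  qed
qed

lemma finite_q_plus_measure:
  assumes "y \<in> space M" "t \<in> ico T0 T1"
  shows "finite_measure (q_plus_measure M q y t)"
  by (rule finite_measureI) (simp add: space_q_plus_measure emeasure_q_plus_measure[OF assms])

text \<open>The diagonal values q(x,t,{x}) are limits of values on shrinking cells of a countable
  separating family, each of which is a finite combination of measurable functions.\<close>

lemma q_rate_measurable:
  "(\<lambda>(y, t). q_rate q y t) \<in> borel_measurable (M \<Otimes>\<^sub>M restrict_space borel (ico T0 T1))"
proof -
  let ?N = "M \<Otimes>\<^sub>M restrict_space borel (ico T0 T1)"
  obtain E :: "nat \<Rightarrow> 'a set" where E: "\<And>i. E i \<in> sets M"
    "\<And>x y. x \<in> space M \<Longrightarrow> y \<in> space M \<Longrightarrow> x \<noteq> y \<Longrightarrow> \<exists>i. x \<in> E i \<and> y \<notin> E i"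
    using separating_family by blast
  \<comment> \<open>The atom containing \<open>y\<close> of the finite algebra generated by the
    first \<open>n\<close> separating sets.\<close>
  define cell where "cell n y = {z\<in>space M. \<forall>i<n. z \<in> E i \<longleftrightarrow> y \<in> E i}" for n :: nat and y
  have cell_Suc: "cell (Suc n) y = (if y \<in> E n then cell n y \<inter> E n else cell n y - E n)" for n y
    by (auto simp: cell_def less_Suc_eq)
  have cell_sets: "cell n y \<in> sets M" for n y
  proof (induction n)
    case 0 show ?case by (simp add: cell_def)
  next
    case (Suc n) then show ?case using E(1)[of n] by (simp add: cell_Suc)
  qed
  \<comment> \<open>The set depends on the state, so joint measurability is not immediate. With
    \<open>C\<close> arbitrary, splitting by membership of the state in \<open>E n\<close> replaces
    \<open>C\<close> by one of the fixed sets \<open>C \<inter> E n\<close> and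
    \<open>C - E n\<close> and lowers \<open>n\<close>.\<close>
  have meas: "(\<lambda>p. q (fst p) (snd p) (C \<inter> cell n (fst p))) \<in> borel_measurable ?N" if "C \<in> sets M" for n C
    using that
  proof (induction n arbitrary: C)
    case 0
    then have "C \<inter> cell 0 y = C" for y using sets.sets_into_space[OF 0] by (auto simp: cell_def)
    then show ?case using q_measurable[OF 0] by (simp add: case_prod_beta')
  next
    case (Suc n)
    have eq: "q (fst p) (snd p) (C \<inter> cell (Suc n) (fst p)) =
        (if fst p \<in> E n then q (fst p) (snd p) ((C \<inter> E n) \<inter> cell n (fst p))
         else q (fst p) (snd p) ((C - E n) \<inter> cell n (fst p)))" for p
    proof (cases "fst p \<in> E n")
      case True
      have "C \<inter> (cell n (fst p) \<inter> E n) = (C \<inter> E n) \<inter> cell n (fst p)" by blast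
      then show ?thesis using True by (simp add: cell_Suc)
    next
      case False
      have "C \<inter> (cell n (fst p) - E n) = (C - E n) \<inter> cell n (fst p)" by blast
      then show ?thesis using False by (simp add: cell_Suc)
    qed
    have [measurable]: "E n \<in> sets M" by (rule E(1))
    have "(\<lambda>p. if fst p \<in> E n then q (fst p) (snd p) ((C \<inter> E n) \<inter> cell n (fst p))
         else q (fst p) (snd p) ((C - E n) \<inter> cell n (fst p))) \<in> borel_measurable ?N"
    proof (rule measurable_If)
      show "(\<lambda>p. q (fst p) (snd p) ((C \<inter> E n) \<inter> cell n (fst p))) \<in> borel_measurable ?N"
        using Suc.prems E(1) by (intro Suc.IH) auto
      show "(\<lambda>p. q (fst p) (snd p) ((C - E n) \<inter> cell n (fst p))) \<in> borel_measurable ?N"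
        using Suc.prems E(1) by (intro Suc.IH) auto
      show "{p \<in> space ?N. fst p \<in> E n} \<in> sets ?N" by measurable
    qed
    then show ?case unfolding eq .
  qed
  \<comment> \<open>Continuity from above is applied to the finite measure \<open>q_plus\<close>,
    which gives the point \<open>y\<close> mass 0; on sets containing \<open>y\<close> it differs
    from \<open>q\<close> by the rate only.\<close>
  have lim: "(\<lambda>n. q y t (space M \<inter> cell n y)) \<longlonglongrightarrow> q y t {y}" if y: "y \<in> space M" and t: "t \<in> ico T0 T1" for y t
  proof -
    interpret finite_measure "q_plus_measure M q y t" by (rule finite_q_plus_measure[OF y t])
    have dec: "decseq (\<lambda>n. cell n y)"
    proof (rule decseq_SucI)
      show "cell (Suc n) y \<subseteq> cell n y" for n unfolding cell_Suc by (cases "y \<in> E n") auto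
    qed
    have inter: "(\<Inter>n. cell n y) = {y}"
    proof (intro equalityI subsetI)
      fix z assume z: "z \<in> (\<Inter>n. cell n y)"
      have zn: "z \<in> cell n y" for n using z by blast
      have "z \<in> space M" using zn[of 0] by (simp add: cell_def)
      moreover have "z \<in> E i" if "y \<in> E i" for i using zn[of "Suc i"] that by (simp add: cell_def)
      ultimately have "z = y" using E(2)[OF y] by blast
      then show "z \<in> {y}" by simp
    qed (use y in \<open>auto simp: cell_def\<close>)
    have meq: "measure (q_plus_measure M q y t) B = q_plus q y t B" if "B \<in> sets M" for B
      using emeasure_q_plus_measure[OF y t that] q_plus_nonneg[OF y t that] by (simp add: measure_def)
    have "(\<lambda>n. measure (q_plus_measure M q y t) (cell n y)) \<longlonglongrightarrow> measure (q_plus_measure M q y t) (\<Inter>n. cell n y)"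
      by (rule finite_Lim_measure_decseq[OF _ dec]) (simp add: sets_q_plus_measure cell_sets image_subset_iff)
    moreover have "measure (q_plus_measure M q y t) (\<Inter>n. cell n y) = 0"
      unfolding inter meq[OF sets_singleton[OF y]]
      using signed[OF y t] by (simp add: q_plus_def signed_measure_def)
    ultimately have "(\<lambda>n. q_plus q y t (cell n y)) \<longlonglongrightarrow> 0"
      by (simp only: meq[OF cell_sets])
    then have "(\<lambda>n. q_plus q y t (cell n y) - q_rate q y t) \<longlonglongrightarrow> 0 - q_rate q y t"
      by (intro tendsto_diff tendsto_const)
    moreover have eq: "q y t (space M \<inter> cell n y) = q_plus q y t (cell n y) - q_rate q y t" for n
    proof -
      have 1: "indicator (cell n y) y = (1::real)" using y by (simp add: cell_def)
      have 2: "space M \<inter> cell n y = cell n y"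
        using sets.sets_into_space[OF cell_sets[of n y]] by (rule Int_absorb1)
      show ?thesis unfolding 2 q_split[OF y t cell_sets[of n y]] 1 mult_1 ..
    qed
    moreover have "0 - q_rate q y t = q y t {y}" by (simp only: q_rate_def diff_0 minus_minus)
    ultimately show ?thesis unfolding eq by (simp only:)
  qed
  have "(\<lambda>p. q (fst p) (snd p) {fst p}) \<in> borel_measurable ?N"
  proof (rule borel_measurable_LIMSEQ_real)
    show "(\<lambda>p. q (fst p) (snd p) (space M \<inter> cell n (fst p))) \<in> borel_measurable ?N" for n
      by (rule meas) simp
    show "(\<lambda>n. q (fst p) (snd p) (space M \<inter> cell n (fst p))) \<longlonglongrightarrow> q (fst p) (snd p) {fst p}"
      if "p \<in> space ?N" for p
      using that by (intro lim) (auto simp: space_pair_measure space_restrict_space)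
  qed
  then show ?thesis by (simp add: q_rate_def case_prod_beta')
qed

lemma q_plus_measurable:
  assumes B: "B \<in> sets M"
  shows "(\<lambda>(y, t). q_plus q y t B) \<in> borel_measurable (M \<Otimes>\<^sub>M restrict_space borel (ico T0 T1))"
proof -
  let ?N = "M \<Otimes>\<^sub>M restrict_space borel (ico T0 T1)"
  have [measurable]: "B \<in> sets M" by fact
  have [measurable]: "(\<lambda>p. q (fst p) (snd p) B) \<in> borel_measurable ?N"
    using q_measurable[OF B] by (simp add: case_prod_beta')
  have [measurable]: "(\<lambda>p. q_rate q (fst p) (snd p)) \<in> borel_measurable ?N"
    using q_rate_measurable by (simp add: case_prod_beta')
  have "(\<lambda>p. q (fst p) (snd p) B + indicator B (fst p) * q_rate q (fst p) (snd p)) \<in> borel_measurable ?N"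
    by measurable
  moreover have "q (fst p) (snd p) B + indicator B (fst p) * q_rate q (fst p) (snd p) = q_plus q (fst p) (snd p) B"
    if "p \<in> space ?N" for p
    using that q_split[of "fst p" "snd p" B] B by (auto simp: space_pair_measure space_restrict_space)
  ultimately have "(\<lambda>p. q_plus q (fst p) (snd p) B) \<in> borel_measurable ?N"
    by (subst (asm) measurable_cong) auto
  then show ?thesis by (simp add: case_prod_beta')
qed

end

lemma (in Q_process) ico_real: "ereal s < T1 \<Longrightarrow> T0 \<le> \<theta> \<Longrightarrow> \<theta> < s \<Longrightarrow> \<theta> \<in> ico T0 T1"
  unfolding ico_def by (auto intro: less_trans[of "ereal \<theta>" "ereal s" T1])

section \<open>Transition functions on a fixed time horizon\<close>

text \<open>One initial condition and one horizon. The horizon \<open>s\<close> is a real number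
  even when \<open>T1\<close> is infinite; the theorem is obtained by varying it.\<close>

locale Q_transition = Q_process M T0 T1 q
  for M :: "'a measure" and T0 :: real and T1 :: ereal and q +
  fixes P :: "real \<Rightarrow> 'a \<Rightarrow> real \<Rightarrow> 'a measure" and u s :: real and x :: 'a
  assumes rate_bdd: "\<And>y. y \<in> space M \<Longrightarrow> bdd_above ((\<lambda>t. q_rate q y t) ` {T0..<s})"
    and P_hat: "P \<in> P_hat M T0 T1"
    and u: "T0 \<le> u" and us: "u < s" and s: "ereal s < T1"
    and x: "x \<in> space M"
begin

text \<open>The data are extended by zero outside the time interval [T0, s[, so that the abstract
  balance argument applies to kernels indexed by all reals.\<close>

definition rate :: "'a \<Rightarrow> real \<Rightarrow> real" where
  "rate y \<theta> = (if T0 \<le> \<theta> \<and> \<theta> < s then q_rate q y \<theta> else 0)"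

definition survival :: "'a \<Rightarrow> real \<Rightarrow> real \<Rightarrow> ennreal" where
  "survival y w t = ennreal (exp (- (LBINT \<theta>:{w..t}. rate y \<theta>)))"

definition jumps :: "'a \<Rightarrow> real \<Rightarrow> 'a measure" where
  "jumps z w = (if T0 \<le> w \<and> w < s then q_plus_measure M q z w else null_measure M)"

definition law :: "real \<Rightarrow> 'a measure" where
  "law w = (if u < w \<and> w < s then P u x w else null_measure M)"

lemma ico_s: "T0 \<le> \<theta> \<Longrightarrow> \<theta> < s \<Longrightarrow> \<theta> \<in> ico T0 T1"
  by (rule ico_real[OF s])

lemma u_ico: "u \<in> ico T0 T1"
  using u us by (rule ico_s)

lemma ioo_s: "u < w \<Longrightarrow> w < s \<Longrightarrow> w \<in> ioo u T1"
  using ico_s[of w] u by (simp add: ico_def ioo_def)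

lemma P_sets: "u < w \<Longrightarrow> w < s \<Longrightarrow> sets (P u x w) = sets M"
  and P_finite: "u < w \<Longrightarrow> w < s \<Longrightarrow> finite_measure (P u x w)"
  using P_hat u_ico ioo_s x unfolding P_hat_def by blast+

lemma P_space: "u < w \<Longrightarrow> w < s \<Longrightarrow> space (P u x w) = space M"
  using P_sets sets_eq_imp_space_eq by blast

lemma P_measurable: "B \<in> sets M \<Longrightarrow> (\<lambda>t. measure (P u x t) B) \<in> borel_measurable (restrict_space borel (ioo u T1))"
  using P_hat u_ico x unfolding P_hat_def by blast

text \<open>\<open>q\<close> is measurable on the admissible times only. A time outside
  \<open>[T0,s[\<close> is sent to \<open>T0\<close>, which is admissible; the value obtained there
  is discarded by the case distinctions in \<open>rate\<close> and \<open>jumps\<close>.\<close>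

definition clamp :: "real \<Rightarrow> real" where
  "clamp w = (if T0 \<le> w \<and> w < s then w else T0)"

lemma clamp_measurable: "(\<lambda>p. (fst p, clamp (snd p))) \<in> M \<Otimes>\<^sub>M borel \<rightarrow>\<^sub>M M \<Otimes>\<^sub>M restrict_space borel (ico T0 T1)"
proof (rule measurable_Pair)
  have "clamp w \<in> ico T0 T1" for w
    using ico_s[of w] ico_s[of T0] u us by (auto simp: clamp_def)
  moreover have [measurable]: "clamp \<in> borel_measurable borel" unfolding clamp_def by measurable
  ultimately have "clamp \<in> borel \<rightarrow>\<^sub>M restrict_space borel (ico T0 T1)"
    by (intro measurable_restrict_space2) auto
  then show "(\<lambda>p. clamp (snd p)) \<in> M \<Otimes>\<^sub>M borel \<rightarrow>\<^sub>M restrict_space borel (ico T0 T1)"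
    by (rule measurable_compose[OF measurable_snd])
qed simp

lemma rate_measurable: "(\<lambda>(y, \<theta>). rate y \<theta>) \<in> borel_measurable (M \<Otimes>\<^sub>M borel)"
proof -
  have [measurable]: "(\<lambda>p. q_rate q (fst p) (clamp (snd p))) \<in> borel_measurable (M \<Otimes>\<^sub>M borel)"
    using measurable_compose[OF clamp_measurable q_rate_measurable] by simp
  have "(\<lambda>p. if T0 \<le> snd p \<and> snd p < s then q_rate q (fst p) (clamp (snd p)) else 0) \<in> borel_measurable (M \<Otimes>\<^sub>M borel)"
    by measurable
  moreover have "rate (fst p) (snd p) = (if T0 \<le> snd p \<and> snd p < s then q_rate q (fst p) (clamp (snd p)) else 0)" for p
    by (simp add: rate_def clamp_def)
  ultimately show ?thesis by (simp add: case_prod_beta')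
qed

lemma rate_measurable1: "y \<in> space M \<Longrightarrow> rate y \<in> borel_measurable borel"
  using measurable_Pair2[OF rate_measurable] by simp

lemma rate_measurable2: "(\<lambda>y. rate y \<theta>) \<in> borel_measurable M"
  using measurable_Pair1[OF rate_measurable, of \<theta>] by simp

lemma rate_nonneg: "y \<in> space M \<Longrightarrow> 0 \<le> rate y \<theta>"
  by (simp add: rate_def q_rate_nonneg ico_s)

lemma rate_bounded: assumes y: "y \<in> space M" shows "\<exists>C. \<forall>\<theta>. rate y \<theta> \<le> C"
proof -
  obtain C where C: "\<And>\<theta>. \<theta> \<in> {T0..<s} \<Longrightarrow> q_rate q y \<theta> \<le> C"
    using rate_bdd[OF y] unfolding bdd_above_def by blast
  have "rate y \<theta> \<le> max C 0" for \<theta> using C[of \<theta>] by (auto simp: rate_def le_max_iff_disj)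
  then show ?thesis by blast
qed

lemma survival_measurable:
  "(\<lambda>(y, w, t). survival y w t) \<in> borel_measurable (M \<Otimes>\<^sub>M (borel \<Otimes>\<^sub>M borel))"
proof -
  have [measurable]: "(\<lambda>r. rate (fst (fst r)) (snd r)) \<in> borel_measurable ((M \<Otimes>\<^sub>M (borel \<Otimes>\<^sub>M borel)) \<Otimes>\<^sub>M borel)"
  proof -
    have "(\<lambda>r. (fst (fst r), snd r)) \<in> (M \<Otimes>\<^sub>M (borel \<Otimes>\<^sub>M borel)) \<Otimes>\<^sub>M borel \<rightarrow>\<^sub>M M \<Otimes>\<^sub>M borel" by measurable
    from measurable_compose[OF this rate_measurable] show ?thesis by simp
  qed
  have "(\<lambda>r. indicator {fst (snd (fst r))..snd (snd (fst r))} (snd r) *\<^sub>R rate (fst (fst r)) (snd r))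
      \<in> borel_measurable ((M \<Otimes>\<^sub>M (borel \<Otimes>\<^sub>M borel)) \<Otimes>\<^sub>M borel)"
  proof (intro borel_measurable_scaleR)
    let ?N = "(M \<Otimes>\<^sub>M (borel \<Otimes>\<^sub>M borel)) \<Otimes>\<^sub>M borel :: (('a \<times> real \<times> real) \<times> real) measure"
    have "(\<lambda>r. fst (snd (fst r))) \<in> borel_measurable ?N" "(\<lambda>r. snd (snd (fst r))) \<in> borel_measurable ?N"
      "snd \<in> borel_measurable ?N"
      by measurable
    then have "Measurable.pred ?N (\<lambda>r. snd r \<in> {fst (snd (fst r))..snd (snd (fst r))})"
      by (rule pred_atLeastAtMost)
    then show "(\<lambda>r. indicator {fst (snd (fst r))..snd (snd (fst r))} (snd r) :: real) \<in> borel_measurable ?N"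
      by (intro borel_measurable_indicator') (simp only: pred_def)
  qed measurable
  moreover have "sets ((M \<Otimes>\<^sub>M (borel \<Otimes>\<^sub>M borel)) \<Otimes>\<^sub>M (lborel::real measure)) = sets ((M \<Otimes>\<^sub>M (borel \<Otimes>\<^sub>M borel)) \<Otimes>\<^sub>M borel)"
    by (intro sets_pair_measure_cong) auto
  ultimately have "(\<lambda>(p, \<theta>). indicator {fst (snd p)..snd (snd p)} \<theta> *\<^sub>R rate (fst p) \<theta>)
      \<in> borel_measurable ((M \<Otimes>\<^sub>M (borel \<Otimes>\<^sub>M borel)) \<Otimes>\<^sub>M lborel)"
    using measurable_cong_sets by (fastforce simp: case_prod_beta')
  then have [measurable]: "(\<lambda>p. \<integral>\<theta>. indicator {fst (snd p)..snd (snd p)} \<theta> *\<^sub>R rate (fst p) \<theta> \<partial>lborel)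
      \<in> borel_measurable (M \<Otimes>\<^sub>M (borel \<Otimes>\<^sub>M borel))"
    by (rule lborel.borel_measurable_lebesgue_integral)
  have "(\<lambda>p. ennreal (exp (- (\<integral>\<theta>. indicator {fst (snd p)..snd (snd p)} \<theta> *\<^sub>R rate (fst p) \<theta> \<partial>lborel))))
      \<in> borel_measurable (M \<Otimes>\<^sub>M (borel \<Otimes>\<^sub>M borel))"
    by measurable
  then show ?thesis by (simp add: survival_def set_lebesgue_integral_def case_prod_beta')
qed

lemma kernel_jumps: "kernel (M \<Otimes>\<^sub>M borel) M (\<lambda>(z, w). jumps z w)"
  unfolding kernel_def
proof (intro conjI ballI)
  fix a assume "a \<in> space (M \<Otimes>\<^sub>M (borel :: real measure))"
  then have a: "fst a \<in> space M" by (auto simp: space_pair_measure)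
  show "sets ((\<lambda>(z, w). jumps z w) a) = sets M"
    by (simp add: jumps_def sets_q_plus_measure case_prod_beta)
  show "finite_measure ((\<lambda>(z, w). jumps z w) a)"
  proof (cases "T0 \<le> snd a \<and> snd a < s")
    case True
    then show ?thesis using finite_q_plus_measure[OF a ico_s] by (simp add: jumps_def case_prod_beta)
  next
    case False
    have "finite_measure (null_measure M)" by (rule finite_measureI) simp
    then show ?thesis using False by (auto simp: jumps_def case_prod_beta)
  qed
next
  fix B assume B: "B \<in> sets M"
  have [measurable]: "(\<lambda>p. q_plus q (fst p) (clamp (snd p)) B) \<in> borel_measurable (M \<Otimes>\<^sub>M borel)"
    using measurable_compose[OF clamp_measurable q_plus_measurable[OF B]] by simp
  have "(\<lambda>p. if T0 \<le> snd p \<and> snd p < s then ennreal (q_plus q (fst p) (clamp (snd p)) B) else 0) \<in> borel_measurable (M \<Otimes>\<^sub>M borel)"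
    by measurable
  moreover have "emeasure ((\<lambda>(z, w). jumps z w) p) B =
      (if T0 \<le> snd p \<and> snd p < s then ennreal (q_plus q (fst p) (clamp (snd p)) B) else 0)"
    if "p \<in> space (M \<Otimes>\<^sub>M borel)" for p
    using that B by (auto simp: jumps_def clamp_def case_prod_beta space_pair_measure emeasure_q_plus_measure ico_s)
  ultimately show "(\<lambda>a. emeasure ((\<lambda>(z, w). jumps z w) a) B) \<in> borel_measurable (M \<Otimes>\<^sub>M borel)"
    by (subst measurable_cong) auto
qed

lemma kernel_law: "kernel borel M law"
  unfolding kernel_def
proof (intro conjI ballI)
  fix w :: real
  show "sets (law w) = sets M" by (simp add: law_def P_sets)
  have "finite_measure (null_measure M)" by (rule finite_measureI) simp
  then show "finite_measure (law w)" by (simp add: law_def P_finite)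
next
  fix B assume B: "B \<in> sets M"
  \<comment> \<open>The device of \<open>clamp\<close> again, with the midpoint as default, since
    \<open>u\<close> itself is not an admissible time for the law.\<close>
  define c where "c w = (if u < w \<and> w < s then w else (u + s) / 2)" for w
  have "c w \<in> ioo u T1" for w using us ioo_s[of w] ioo_s[of "(u + s) / 2"] by (simp add: c_def)
  moreover have [measurable]: "c \<in> borel_measurable borel" unfolding c_def by measurable
  ultimately have "c \<in> borel \<rightarrow>\<^sub>M restrict_space borel (ioo u T1)"
    by (intro measurable_restrict_space2) auto
  from measurable_compose[OF this P_measurable[OF B]]
  have [measurable]: "(\<lambda>w. measure (P u x (c w)) B) \<in> borel_measurable borel" .
  have "(\<lambda>w. if u < w \<and> w < s then ennreal (measure (P u x (c w)) B) else 0) \<in> borel_measurable borel"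
    by measurable
  moreover have "emeasure (law w) B = (if u < w \<and> w < s then ennreal (measure (P u x (c w)) B) else 0)" for w
    using B by (simp add: law_def c_def finite_measure.emeasure_eq_measure[OF P_finite])
  ultimately show "(\<lambda>a. emeasure (law a) B) \<in> borel_measurable borel" by simp
qed

text \<open>The bound on the rate may depend on the state, because the survival identities are
  applied to one state at a time.\<close>

sublocale flux_balance M "\<lambda>y \<theta>. ennreal (rate y \<theta>)" survival jumps law x u
proof
  show "(\<lambda>(y, w). ennreal (rate y w)) \<in> borel_measurable (M \<Otimes>\<^sub>M borel)"
    using rate_measurable by (simp add: case_prod_beta')
  fix y w t assume y: "y \<in> space M" and wt: "(w::real) \<le> t"
  obtain C where C: "\<And>\<theta>. rate y \<theta> \<le> C" using rate_bounded[OF y] by blast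
  show "survival y w t + (\<integral>\<^sup>+\<theta>\<in>{w<..<t}. ennreal (rate y \<theta>) * survival y w \<theta> \<partial>lborel) = 1"
    unfolding survival_def by (rule exp_integral_identities(1)[OF rate_measurable1[OF y] rate_nonneg[OF y] C wt])
  show "survival y w t + (\<integral>\<^sup>+\<theta>\<in>{w<..<t}. ennreal (rate y \<theta>) * survival y \<theta> t \<partial>lborel) = 1"
    unfolding survival_def by (rule exp_integral_identities(2)[OF rate_measurable1[OF y] rate_nonneg[OF y] C wt])
qed (fact survival_measurable kernel_jumps kernel_law x)+

lemma survival_eq:
  assumes "T0 \<le> w" "t < s"
  shows "survival y w t = ennreal (exp (- (LBINT \<theta>:{w..t}. q_rate q y \<theta>)))"
proof -
  have "(LBINT \<theta>:{w..t}. rate y \<theta>) = (LBINT \<theta>:{w..t}. q_rate q y \<theta>)"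
    unfolding set_lebesgue_integral_def using assms
    by (intro Bochner_Integration.integral_cong) (auto simp: rate_def indicator_def)
  then show ?thesis by (simp add: survival_def)
qed

text \<open>All times occurring in the equation lie in \<open>[T0,s[\<close>, where the extended
  data agree with the original ones.\<close>

lemma mild_iff:
  assumes t: "u < t" "t < s" and B: "B \<in> sets M"
  shows "mild t B \<longleftrightarrow> ennreal (measure (P u x t) B) =
          ennreal (indicat_real B x * exp (- (LBINT \<theta>:{u..t}. q_rate q x \<theta>)))
          + (\<integral>\<^sup>+w\<in>{u<..<t}.
               (\<integral>\<^sup>+z.
                  (\<integral>\<^sup>+y\<in>B. ennreal (exp (- (LBINT \<theta>:{w..t}. q_rate q y \<theta>)))
                     \<partial>q_plus_measure M q z w)
                \<partial>P u x w)
             \<partial>lborel)"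
proof -
  have "emeasure (law t) B = ennreal (measure (P u x t) B)"
    using t by (simp add: law_def finite_measure.emeasure_eq_measure[OF P_finite])
  moreover have "indicator B x * survival x u t = ennreal (indicat_real B x * exp (- (LBINT \<theta>:{u..t}. q_rate q x \<theta>)))"
    using survival_eq[OF u t(2), of x] by (simp add: ennreal_mult ennreal_indicator)
  moreover have "(\<integral>\<^sup>+w\<in>{u<..<t}. flux w (\<lambda>y. indicator B y * survival y w t) \<partial>lborel) =
      (\<integral>\<^sup>+w\<in>{u<..<t}. (\<integral>\<^sup>+z. (\<integral>\<^sup>+y\<in>B. ennreal (exp (- (LBINT \<theta>:{w..t}. q_rate q y \<theta>)))
                     \<partial>q_plus_measure M q z w) \<partial>P u x w) \<partial>lborel)"
  proof (rule nn_integral_cong)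
    fix w
    show "flux w (\<lambda>y. indicator B y * survival y w t) * indicator {u<..<t} w =
      (\<integral>\<^sup>+z. (\<integral>\<^sup>+y\<in>B. ennreal (exp (- (LBINT \<theta>:{w..t}. q_rate q y \<theta>))) \<partial>q_plus_measure M q z w) \<partial>P u x w) *
      indicator {u<..<t} w"
    proof (cases "w \<in> {u<..<t}")
      case True
      then have w: "u < w" "w < s" "T0 \<le> w" using t u by auto
      show ?thesis
        unfolding flux_def using w
        by (simp add: law_def jumps_def survival_eq[OF w(3) t(2)] mult.commute)
    qed simp
  qed
  ultimately show ?thesis unfolding mild_def by (simp only:)
qed

lemma flux_indicator:
  assumes w: "u < w" "w < s" and B: "B \<in> sets M"
  shows "flux w (indicator B) = (\<integral>\<^sup>+z. ennreal (q_plus q z w B) \<partial>P u x w)"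
proof -
  have "flux w (indicator B) = (\<integral>\<^sup>+z. (\<integral>\<^sup>+y. indicator B y \<partial>q_plus_measure M q z w) \<partial>P u x w)"
    unfolding flux_def using w u by (simp add: law_def jumps_def)
  also have "\<dots> = (\<integral>\<^sup>+z. ennreal (q_plus q z w B) \<partial>P u x w)"
  proof (rule nn_integral_cong)
    fix z assume "z \<in> space (P u x w)"
    then have z: "z \<in> space M" by (simp add: P_space[OF w])
    show "(\<integral>\<^sup>+y. indicator B y \<partial>q_plus_measure M q z w) = ennreal (q_plus q z w B)"
      using B w u z by (simp add: sets_q_plus_measure emeasure_q_plus_measure ico_s)
  qed
  finally show ?thesis .
qed

lemma q_rate_section: assumes "u < w" "w < s" shows "(\<lambda>y. q_rate q y w) \<in> borel_measurable (P u x w)"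
proof -
  have "(\<lambda>y. rate y w) \<in> borel_measurable (P u x w)"
    using rate_measurable2[of w] measurable_cong_sets[OF P_sets[OF assms] refl] by blast
  then show ?thesis using assms u by (simp add: rate_def)
qed

lemma q_plus_section: assumes w: "u < w" "w < s" and B: "B \<in> sets M"
  shows "(\<lambda>y. q_plus q y w B) \<in> borel_measurable (P u x w)"
proof -
  have "w \<in> space (restrict_space borel (ico T0 T1))" using ico_s[of w] w u by (simp add: space_restrict_space)
  from measurable_Pair1[OF q_plus_measurable[OF B] this]
  have "(\<lambda>y. q_plus q y w B) \<in> borel_measurable M" by simp
  then show ?thesis using measurable_cong_sets[OF P_sets[OF w] refl] by blast
qed

lemma qs_bounded_rate:
  assumes "qs_bounded M T0 q (ereal r) B"
  obtains K where "K \<ge> 0" "B \<in> sets M" "\<And>y \<theta>. y \<in> B \<Longrightarrow> T0 \<le> \<theta> \<Longrightarrow> \<theta> < r \<Longrightarrow> q_rate q y \<theta> \<le> K"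
proof -
  have B: "B \<in> sets M" and bd: "bounded ((\<lambda>(x, t). q_rate q x t) ` (B \<times> ico T0 (ereal r)))"
    using assms by (auto simp: qs_bounded_def)
  obtain K where K: "K > 0" "\<And>z. z \<in> (\<lambda>(x, t). q_rate q x t) ` (B \<times> ico T0 (ereal r)) \<Longrightarrow> norm z \<le> K"
    using bd unfolding bounded_pos by blast
  have "q_rate q y \<theta> \<le> K" if "y \<in> B" "T0 \<le> \<theta>" "\<theta> < r" for y \<theta>
  proof -
    have "norm (q_rate q y \<theta>) \<le> K" using that by (intro K(2)) (auto simp: ico_def)
    then show ?thesis by simp
  qed
  then show ?thesis using K(1) B by (intro that[of K]) auto
qed

text \<open>\<open>drift\<close> and \<open>influx\<close> are the rates of outflow and influx as
  real functions of time. An infinite value becomes 0, so they carry information only at times where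
  the integrals are finite.\<close>

definition drift :: "'a set \<Rightarrow> real \<Rightarrow> real" where
  "drift B w = enn2real (\<integral>\<^sup>+y. indicator B y * ennreal (rate y w) \<partial>law w)"

definition influx :: "'a set \<Rightarrow> real \<Rightarrow> real" where
  "influx B w = enn2real (flux w (indicator B))"

lemma drift_nonneg: "0 \<le> drift B w" and influx_nonneg: "0 \<le> influx B w"
  by (simp_all add: drift_def influx_def)

text \<open>The equations hold in the infinite case too, because there the Bochner integral and
  \<open>enn2real\<close> both return 0.\<close>

lemma forward_integrals:
  assumes w: "u < w" "w < s" and B: "B \<in> sets M"
  shows "(LINT y:B|P u x w. q_rate q y w) = drift B w"
    and "(LINT y|P u x w. q_plus q y w B) = influx B w"
  unfolding drift_def influx_def
proof -
  have [measurable]: "(\<lambda>y. q_rate q y w) \<in> borel_measurable (P u x w)" "B \<in> sets (P u x w)"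
    using q_rate_section[OF w] B by (simp_all add: P_sets[OF w])
  have nn: "y \<in> space (P u x w) \<Longrightarrow> 0 \<le> q_rate q y w" for y
    using w u by (intro q_rate_nonneg ico_s) (auto simp: P_space[OF w])
  have "(LINT y:B|P u x w. q_rate q y w) = enn2real (\<integral>\<^sup>+y. ennreal (indicator B y *\<^sub>R q_rate q y w) \<partial>P u x w)"
    unfolding set_lebesgue_integral_def
    by (rule integral_eq_nn_integral) (auto intro!: AE_I2 mult_nonneg_nonneg nn)
  also have "(\<integral>\<^sup>+y. ennreal (indicator B y *\<^sub>R q_rate q y w) \<partial>P u x w) = (\<integral>\<^sup>+y. indicator B y * ennreal (rate y w) \<partial>law w)"
    using w u by (simp add: law_def rate_def ennreal_mult' ennreal_indicator)
  finally show "(LINT y:B|P u x w. q_rate q y w) = enn2real (\<integral>\<^sup>+y. indicator B y * ennreal (rate y w) \<partial>law w)" .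
  show "(LINT y|P u x w. q_plus q y w B) = enn2real (flux w (indicator B))"
    unfolding flux_indicator[OF w B] using q_plus_section[OF w B] w u B
    by (intro integral_eq_nn_integral AE_I2) (auto intro!: q_plus_nonneg ico_s simp: P_space[OF w])
qed

lemma ennreal_drift:
  assumes w: "u < w" "w < s" and B: "B \<in> sets M" and K: "K \<ge> 0" "\<And>y. y \<in> B \<Longrightarrow> q_rate q y w \<le> K"
  shows "ennreal (drift B w) = (\<integral>\<^sup>+y. indicator B y * ennreal (rate y w) \<partial>law w)"
    and "drift B w \<le> K * measure (P u x w) B"
proof -
  have "(\<integral>\<^sup>+y. indicator B y * ennreal (rate y w) \<partial>law w) \<le> (\<integral>\<^sup>+y. ennreal K * indicator B y \<partial>law w)"
    using K w by (intro nn_integral_mono) (auto simp: indicator_def rate_def intro!: ennreal_leI)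
  also have "\<dots> = ennreal K * emeasure (law w) B"
    using B by (intro nn_integral_cmult_indicator) (simp add: sets_mu)
  also have "\<dots> = ennreal (K * measure (P u x w) B)"
    using w K by (simp add: law_def finite_measure.emeasure_eq_measure[OF P_finite] ennreal_mult)
  finally have le: "(\<integral>\<^sup>+y. indicator B y * ennreal (rate y w) \<partial>law w) \<le> ennreal (K * measure (P u x w) B)" .
  then have "(\<integral>\<^sup>+y. indicator B y * ennreal (rate y w) \<partial>law w) < top"
    by (rule le_less_trans) simp
  then show "ennreal (drift B w) = (\<integral>\<^sup>+y. indicator B y * ennreal (rate y w) \<partial>law w)"
    unfolding drift_def by (rule ennreal_enn2real)
  then have "ennreal (drift B w) \<le> ennreal (K * measure (P u x w) B)" using le by simp
  then show "drift B w \<le> K * measure (P u x w) B" using K(1) by (subst (asm) ennreal_le_iff) auto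
qed

lemma drift_integral:
  assumes t: "t \<le> r" "r \<le> s" and B: "B \<in> sets M"
    and K: "K \<ge> 0" "\<And>y \<theta>. y \<in> B \<Longrightarrow> T0 \<le> \<theta> \<Longrightarrow> \<theta> < r \<Longrightarrow> q_rate q y \<theta> \<le> K"
  shows "(\<integral>\<^sup>+w\<in>{u<..<t}. ennreal (drift B w) \<partial>lborel) =
    (\<integral>\<^sup>+w\<in>{u<..<t}. (\<integral>\<^sup>+y. indicator B y * ennreal (rate y w) \<partial>law w) \<partial>lborel)"
proof (rule nn_integral_cong)
  fix w
  show "ennreal (drift B w) * indicator {u<..<t} w =
    (\<integral>\<^sup>+y. indicator B y * ennreal (rate y w) \<partial>law w) * indicator {u<..<t} w"
  proof (cases "w \<in> {u<..<t}")
    case True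
    then have w: "u < w" "w < s" "T0 \<le> w" "w < r" using t u by auto
    show ?thesis by (simp only: ennreal_drift(1)[OF w(1,2) B K(1) K(2)[OF _ w(3,4)]])
  qed simp
qed

lemma ennreal_influx: "flux w (indicator B) < top \<Longrightarrow> ennreal (influx B w) = flux w (indicator B)"
  unfolding influx_def by (rule ennreal_enn2real)

lemma influx_integral:
  assumes fin: "AE w in lborel. w \<in> {u<..<r} \<longrightarrow> flux w (indicator B) < top" and t: "t \<le> r"
  shows "(\<integral>\<^sup>+w\<in>{u<..<t}. ennreal (influx B w) \<partial>lborel) = (\<integral>\<^sup>+w\<in>{u<..<t}. flux w (indicator B) \<partial>lborel)"
proof (rule nn_integral_cong_AE)
  show "AE w in lborel. ennreal (influx B w) * indicator {u<..<t} w = flux w (indicator B) * indicator {u<..<t} w"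
    using fin
  proof eventually_elim
    case (elim w)
    show ?case
    proof (cases "w \<in> {u<..<t}")
      case True
      then have "w \<in> {u<..<r}" using t by simp
      then have "ennreal (influx B w) = flux w (indicator B)" using elim by (intro ennreal_influx) blast
      then show ?thesis by (simp only:)
    qed simp
  qed
qed

lemma rate_measurable_comp [measurable (raw)]:
  assumes "a \<in> N \<rightarrow>\<^sub>M M" "b \<in> borel_measurable N"
  shows "(\<lambda>p. rate (a p) (b p)) \<in> borel_measurable N"
  using measurable_compose[OF measurable_Pair[OF assms] rate_measurable] by simp

lemma flux_indicator_measurable:
  assumes [measurable]: "B \<in> sets M"
  shows "(\<lambda>w. flux w (indicator B)) \<in> borel_measurable borel"
  by measurable

lemma influx_measurable: "B \<in> sets M \<Longrightarrow> influx B \<in> borel_measurable borel"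
  unfolding influx_def[abs_def] by (intro borel_measurable_enn2real flux_indicator_measurable)

lemma drift_measurable:
  assumes [measurable]: "B \<in> sets M"
  shows "drift B \<in> borel_measurable borel"
proof -
  have "(\<lambda>w. \<integral>\<^sup>+y. indicator B y * ennreal (rate y w) \<partial>law w) \<in> borel_measurable borel"
    by measurable
  then show ?thesis unfolding drift_def[abs_def] by (rule borel_measurable_enn2real)
qed

lemma emeasure_law: "u < t \<Longrightarrow> t < s \<Longrightarrow> emeasure (law t) B = ennreal (measure (P u x t) B)"
  by (simp add: law_def finite_measure.emeasure_eq_measure[OF P_finite])

end

section \<open>The two implications on a fixed time horizon\<close>

context Q_transition
begin

text \<open>The suprema of the rates over time need not be Borel functions of the state; the exhaustion
  by bounded Borel sets comes from separating the analytic sets on which they exceed n.\<close>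

lemma bounded_exhaustion:
  obtains X where "\<And>n. qs_bounded M T0 q (ereal s) (X n)" "incseq X" "(\<Union>n. X n) = space M"
proof -
  define \<Gamma> where "\<Gamma> n = {p \<in> space (M \<Otimes>\<^sub>M borel). real n < rate (fst p) (snd p)}" for n :: nat
  have \<Gamma>: "\<Gamma> n \<in> sets (M \<Otimes>\<^sub>M borel)" for n
    unfolding \<Gamma>_def by measurable
  have "(\<Inter>n. fst ` \<Gamma> n) = {}"
  proof (rule ccontr)
    assume "(\<Inter>n. fst ` \<Gamma> n) \<noteq> {}"
    then obtain y where y: "\<And>n. y \<in> fst ` \<Gamma> n" by blast
    have "y \<in> space M" using y[of 0] by (auto simp: \<Gamma>_def space_pair_measure)
    then obtain C where C: "\<And>\<theta>. rate y \<theta> \<le> C" using rate_bounded by blast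
    obtain n :: nat where n: "C \<le> real n" using real_arch_simple by blast
    obtain p where "p \<in> \<Gamma> n" "y = fst p" using y[of n] by blast
    then have "real n < rate y (snd p)" by (simp add: \<Gamma>_def)
    then show False using C[of "snd p"] n by linarith
  qed
  from borel_projections_separation[OF standard_borel \<Gamma> this]
  obtain B where B: "\<And>n. B n \<in> sets M" "\<And>n. fst ` \<Gamma> n \<subseteq> B n" "(\<Inter>n. B n) = {}" by blast
  \<comment> \<open>The sets \<open>B k\<close> need not decrease. Removing the finite intersection
    makes \<open>X n\<close> increasing, and a point outside some \<open>B k\<close> with
    \<open>k \<le> n\<close> has rate at most \<open>k\<close>.\<close>
  define X where "X n = space M - (\<Inter>k\<in>{..n}. B k)" for n
  have X_sets: "X n \<in> sets M" for n
    unfolding X_def using B(1) by (intro sets.Diff sets.top sets.finite_INT) auto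
  have bound: "q_rate q y \<theta> \<le> real n" if y: "y \<in> X n" and \<theta>: "T0 \<le> \<theta>" "\<theta> < s" for y \<theta> n
  proof -
    obtain k where k: "k \<le> n" "y \<notin> B k" using y by (auto simp: X_def)
    have yM: "y \<in> space M" using y by (simp add: X_def)
    have "y \<notin> fst ` \<Gamma> k" using k(2) B(2) by blast
    then have "(y, \<theta>) \<notin> \<Gamma> k" by force
    then have "rate y \<theta> \<le> real k" using yM by (simp add: \<Gamma>_def space_pair_measure)
    then show ?thesis using k(1) \<theta> by (simp add: rate_def)
  qed
  show ?thesis
  proof (rule that[of X])
    fix n
    have "norm z \<le> real n" if zim: "z \<in> (\<lambda>(x, t). q_rate q x t) ` (X n \<times> ico T0 (ereal s))" for z
    proof -
      obtain y \<theta> where z: "y \<in> X n" "T0 \<le> \<theta>" "\<theta> < s" "z = q_rate q y \<theta>" using zim by (auto simp: ico_def)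
      have "y \<in> space M" using z(1) by (simp add: X_def)
      then have "0 \<le> z" unfolding z(4) using z(2,3) by (intro q_rate_nonneg ico_s)
      then show ?thesis using bound[OF z(1-3)] z(4) by simp
    qed
    then show "qs_bounded M T0 q (ereal s) (X n)"
      unfolding qs_bounded_def bounded_iff using X_sets by blast
  next
    show "incseq X"
    proof (rule incseq_SucI)
      show "X n \<subseteq> X (Suc n)" for n by (auto simp: X_def)
    qed
    show "(\<Union>n. X n) = space M"
    proof (intro equalityI subsetI)
      fix y assume y: "y \<in> space M"
      obtain k where "y \<notin> B k" using B(3) by blast
      then have "y \<in> X k" using y by (auto simp: X_def)
      then show "y \<in> (\<Union>n. X n)" by blast
    qed (auto simp: X_def)
  qed
qed

text \<open>Integrability of \<open>q_plus\<close> is part of the forward equation and makes the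
  influx finite almost everywhere. Boundedness of the rate on \<open>B\<close> bounds the outflow by
  a multiple of the measure of \<open>B\<close>, as \<open>abs_continuous_balance\<close>
  requires.\<close>

lemma forward_imp_balance:
  assumes t: "u < t" "t < s" and B: "qs_bounded M T0 q (ereal s) B"
    and lim: "((\<lambda>t. measure (P u x t) B) \<longlongrightarrow> indicat_real B x) (at_right u)"
    and ac: "abs_continuous_on {u<..<s} (\<lambda>t. measure (P u x t) B)"
    and fwd: "AE t\<in>{u<..<s} in lborel. forward_equation_at q P u x B t"
  shows "balance t B" "(\<integral>\<^sup>+w\<in>{u<..<t}. (\<integral>\<^sup>+y. indicator B y * ennreal (rate y w) \<partial>law w) \<partial>lborel) < \<infinity>"
proof -
  obtain K where K: "K \<ge> 0" "B \<in> sets M" "\<And>y \<theta>. y \<in> B \<Longrightarrow> T0 \<le> \<theta> \<Longrightarrow> \<theta> < s \<Longrightarrow> q_rate q y \<theta> \<le> K"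
    using qs_bounded_rate[OF B] by metis
  have flux_fin: "AE w in lborel. w \<in> {u<..<s} \<longrightarrow> flux w (indicator B) < top"
    using fwd
  proof eventually_elim
    case (elim w)
    show ?case
    proof
      assume wI: "w \<in> {u<..<s}"
      then have w: "u < w" "w < s" by auto
      have "integrable (P u x w) (\<lambda>y. q_plus q y w B)"
        using elim wI by (simp add: forward_equation_at_def)
      then have "(\<integral>\<^sup>+y. ennreal (norm (q_plus q y w B)) \<partial>P u x w) < \<infinity>"
        by (simp add: integrable_iff_bounded)
      moreover have "(\<integral>\<^sup>+y. ennreal (norm (q_plus q y w B)) \<partial>P u x w) = flux w (indicator B)"
        unfolding flux_indicator[OF w K(2)]
      proof (rule nn_integral_cong)
        fix y assume "y \<in> space (P u x w)"
        then have "0 \<le> q_plus q y w B"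
          using w u K(2) by (intro q_plus_nonneg ico_s) (auto simp: P_space)
        then show "ennreal (norm (q_plus q y w B)) = ennreal (q_plus q y w B)" by simp
      qed
      ultimately show "flux w (indicator B) < top" by simp
    qed
  qed
  have der: "AE w in lborel. w \<in> {u<..<s} \<longrightarrow>
      ((\<lambda>t. measure (P u x t) B) has_real_derivative (influx B w - drift B w)) (at w)"
    using fwd
  proof eventually_elim
    case (elim w)
    show ?case
    proof
      assume w: "w \<in> {u<..<s}"
      then have "((\<lambda>t. measure (P u x t) B) has_real_derivative
        (- (LINT y:B|P u x w. q_rate q y w) + (LINT y|P u x w. q_plus q y w B))) (at w)"
        using elim by (simp add: forward_equation_at_def)
      moreover have "- (LINT y:B|P u x w. q_rate q y w) + (LINT y|P u x w. q_plus q y w B) = influx B w - drift B w"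
        using forward_integrals[of w B] w K(2) by simp
      ultimately show "((\<lambda>t. measure (P u x t) B) has_real_derivative (influx B w - drift B w)) (at w)"
        by (simp only:)
    qed
  qed
  have drift_le: "drift B w \<le> K * measure (P u x w) B" if "w \<in> {u<..<s}" for w
    by (rule ennreal_drift(2)) (use that u K in auto)
  have dint: "(\<integral>\<^sup>+w\<in>{u<..<t}. ennreal (drift B w) \<partial>lborel) =
      (\<integral>\<^sup>+w\<in>{u<..<t}. (\<integral>\<^sup>+y. indicator B y * ennreal (rate y w) \<partial>law w) \<partial>lborel)"
    by (rule drift_integral[OF less_imp_le[OF t(2)] order_refl K(2,1)]) (rule K(3))
  note iint = influx_integral[OF flux_fin less_imp_le[OF t(2)]]
  note ftc = abs_continuous_balance[OF ac lim t drift_measurable[OF K(2)] influx_measurable[OF K(2)]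
      measure_nonneg drift_nonneg influx_nonneg _ drift_le K(1) der]
  have "ennreal (measure (P u x t) B) + (\<integral>\<^sup>+w\<in>{u<..<t}. ennreal (drift B w) \<partial>lborel) =
      ennreal (indicat_real B x) + (\<integral>\<^sup>+w\<in>{u<..<t}. ennreal (influx B w) \<partial>lborel)"
    by (rule ftc(1)) simp_all
  then show "balance t B"
    unfolding balance_def dint iint emeasure_law[OF t] by (simp only: ennreal_indicator)
  have "(\<integral>\<^sup>+w\<in>{u<..<t}. ennreal (drift B w) \<partial>lborel) < \<infinity>"
    by (rule ftc(2)) simp_all
  then show "(\<integral>\<^sup>+w\<in>{u<..<t}. (\<integral>\<^sup>+y. indicator B y * ennreal (rate y w) \<partial>law w) \<partial>lborel) < \<infinity>"
    unfolding dint .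
qed

lemma qs_bounded_subset:
  assumes "qs_bounded M T0 q r B" "C \<in> sets M" "C \<subseteq> B"
  shows "qs_bounded M T0 q r C"
proof -
  have "(\<lambda>(x, t). q_rate q x t) ` (C \<times> ico T0 r) \<subseteq> (\<lambda>(x, t). q_rate q x t) ` (B \<times> ico T0 r)"
    using assms(3) by (intro image_mono Sigma_mono) auto
  then show ?thesis using assms(1,2) unfolding qs_bounded_def by (metis bounded_subset)
qed

text \<open>The sets \<open>B \<inter> X n\<close> are bounded, and so are their measurable subsets,
  which provides the balance equation for all of these as well as a finite outflow. The integral
  equation then passes to the union.\<close>

lemma forward_imp_mild:
  assumes fwd: "\<And>B. qs_bounded M T0 q (ereal s) B \<Longrightarrow>
      ((\<lambda>t. measure (P u x t) B) \<longlongrightarrow> indicat_real B x) (at_right u) \<and>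
      abs_continuous_on {u<..<s} (\<lambda>t. measure (P u x t) B) \<and>
      (AE t\<in>{u<..<s} in lborel. forward_equation_at q P u x B t)"
    and t: "u < t" "t < s" and B: "B \<in> sets M"
  shows "mild t B"
proof -
  obtain X where X: "\<And>n. qs_bounded M T0 q (ereal s) (X n)" "incseq X" "(\<Union>n. X n) = space M"
    using bounded_exhaustion by metis
  have X_sets: "X n \<in> sets M" for n using X(1)[of n] by (simp add: qs_bounded_def)
  have "mild t (\<Union>n. B \<inter> X n)"
  proof (rule mild_UN)
    show "B \<inter> X n \<in> sets M" for n using B X_sets by blast
    show "incseq (\<lambda>n. B \<inter> X n)" using X(2) unfolding incseq_def by blast
    fix n
    have bdd: "qs_bounded M T0 q (ereal s) C" if "C \<in> sets M" "C \<subseteq> B \<inter> X n" for C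
      by (rule qs_bounded_subset[OF X(1)[of n]]) (use that in auto)
    show "mild t (B \<inter> X n)"
    proof (rule balance_imp_mild[OF _ t(1)])
      show BX: "B \<inter> X n \<in> sets M" using B X_sets by blast
      note f = fwd[OF bdd[OF BX order_refl]]
      show "(\<integral>\<^sup>+w\<in>{u<..<t}. (\<integral>\<^sup>+y. indicator (B \<inter> X n) y * ennreal (rate y w) \<partial>law w) \<partial>lborel) < \<infinity>"
        by (rule forward_imp_balance(2)[OF t bdd[OF BX order_refl]]) (use f in blast)+
      fix \<theta> C assume C: "u < \<theta>" "\<theta> \<le> t" "C \<in> sets M" "C \<subseteq> B \<inter> X n"
      have "\<theta> < s" using C(2) t(2) by linarith
      note f = fwd[OF bdd[OF C(3,4)]]
      show "balance \<theta> C"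
        by (rule forward_imp_balance(1)[OF C(1) \<open>\<theta> < s\<close> bdd[OF C(3,4)]]) (use f in blast)+
    qed
  qed
  moreover have "(\<Union>n. B \<inter> X n) = B" using X(3) sets.sets_into_space[OF B] by blast
  ultimately show ?thesis by simp
qed

text \<open>Mass landing in a bounded set before time r survives there until r with probability bounded
  below, so the influx up to r is controlled by the mass at r.\<close>

lemma mild_imp_influx_finite:
  assumes r: "u < r" "r < s" and mild: "mild r B" and B: "B \<in> sets M"
    and K: "\<And>y \<theta>. y \<in> B \<Longrightarrow> T0 \<le> \<theta> \<Longrightarrow> \<theta> < r \<Longrightarrow> q_rate q y \<theta> \<le> K" and K0: "K \<ge> 0"
  shows "(\<integral>\<^sup>+w\<in>{u<..<r}. flux w (indicator B) \<partial>lborel) < \<infinity>"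
proof -
  \<comment> \<open>A lower bound for the survival until \<open>r\<close> of mass that enters
    \<open>B\<close> after \<open>u\<close>, where the rate is at most \<open>K\<close>.\<close>
  define c where "c = exp (- (K * (r - u)))"
  have c: "c > 0" by (simp add: c_def)
  have surv: "ennreal c \<le> survival y w r" if y: "y \<in> B" and w: "u < w" "w < r" for y w
  proof -
    have yM: "y \<in> space M" using y sets.sets_into_space[OF B] by blast
    obtain C where C: "\<And>\<theta>. rate y \<theta> \<le> C" using rate_bounded[OF yM] by blast
    have si: "set_integrable lborel {w..r} (rate y)"
      unfolding set_integrable_def
    proof (rule integrableI_bounded_set_indicator[where B="max C 0"])
      show "AE \<theta> in lborel. \<theta> \<in> {w..r} \<longrightarrow> norm (rate y \<theta>) \<le> max C 0"
        using C rate_nonneg[OF yM] by (intro AE_I2 impI) (simp add: le_max_iff_disj)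
    qed (use rate_measurable1[OF yM] in \<open>auto simp: emeasure_lborel_Icc_eq\<close>)
    have "(LBINT \<theta>:{w..r}. rate y \<theta>) \<le> (LBINT \<theta>:{w..r}. K)"
      unfolding set_lebesgue_integral_def
    proof (rule integral_mono_AE)
      show "integrable lborel (\<lambda>\<theta>. indicator {w..r} \<theta> *\<^sub>R rate y \<theta>)"
        using si by (simp add: set_integrable_def)
      show "integrable lborel (\<lambda>\<theta>. indicator {w..r} \<theta> *\<^sub>R K)"
        by (intro integrableI_bounded_set_indicator[where B=K]) (use K0 in \<open>auto simp: emeasure_lborel_Icc_eq\<close>)
      \<comment> \<open>The bound \<open>K\<close> is known before \<open>r\<close> only; the end
        point is discarded as a null set.\<close>
      have "AE \<theta> in lborel. \<theta> \<noteq> r" by (rule AE_lborel_singleton)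
      then show "AE \<theta> in lborel. indicator {w..r} \<theta> *\<^sub>R rate y \<theta> \<le> indicator {w..r} \<theta> *\<^sub>R K"
      proof eventually_elim
        case (elim \<theta>)
        show ?case
        proof (cases "\<theta> \<in> {w..r}")
          case True
          then have "rate y \<theta> \<le> K" using elim w u r K[OF y, of \<theta>] by (simp add: rate_def)
          then show ?thesis using True by simp
        qed simp
      qed
    qed
    also have "\<dots> = K * (r - w)" using w by (simp add: set_lebesgue_integral_def)
    also have "\<dots> \<le> K * (r - u)" using w K0 by (intro mult_left_mono) auto
    finally show ?thesis unfolding survival_def c_def by (intro ennreal_leI) simp
  qed
  have "ennreal c * (\<integral>\<^sup>+w\<in>{u<..<r}. flux w (indicator B) \<partial>lborel) =
      (\<integral>\<^sup>+w. ennreal c * (flux w (indicator B) * indicator {u<..<r} w) \<partial>lborel)"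
    using flux_indicator_measurable[OF B] by (intro nn_integral_cmult[symmetric]) simp
  also have "\<dots> \<le> (\<integral>\<^sup>+w\<in>{u<..<r}. flux w (\<lambda>y. indicator B y * survival y w r) \<partial>lborel)"
  proof (rule nn_integral_mono)
    fix w
    show "ennreal c * (flux w (indicator B) * indicator {u<..<r} w) \<le>
        flux w (\<lambda>y. indicator B y * survival y w r) * indicator {u<..<r} w"
    proof (cases "w \<in> {u<..<r}")
      case True
      have [measurable]: "B \<in> sets M" by fact
      have "ennreal c * flux w (indicator B) = flux w (\<lambda>y. ennreal c * indicator B y)"
        by (rule integral_functional_cmult[OF integral_functional_flux, symmetric]) measurable
      also have "\<dots> \<le> flux w (\<lambda>y. indicator B y * survival y w r)"
      proof (rule integral_functional_mono[OF integral_functional_flux])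
        show "(\<lambda>y. ennreal c * indicator B y) \<le> (\<lambda>y. indicator B y * survival y w r)"
          using surv True by (auto simp: le_fun_def indicator_def)
      qed measurable
      finally show ?thesis using True by simp
    qed simp
  qed
  also have "\<dots> \<le> emeasure (law r) B" using mild unfolding mild_def by simp
  also have "\<dots> < \<infinity>" using finite_measure.emeasure_finite[OF finite_mu, of r B] by (simp add: less_top)
  finally have *: "ennreal c * (\<integral>\<^sup>+w\<in>{u<..<r}. flux w (indicator B) \<partial>lborel) < \<infinity>" .
  show ?thesis
  proof (rule ccontr)
    assume "\<not> ?thesis"
    then have "(\<integral>\<^sup>+w\<in>{u<..<r}. flux w (indicator B) \<partial>lborel) = top"
      unfolding infinity_ennreal_def top.not_eq_extremum[symmetric] by (rule notnotD)
    then show False using * c by (simp add: ennreal_mult_top)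
  qed
qed

text \<open>Since \<open>r < s\<close>, the integral equation holds at the right end
  \<open>r\<close> itself, which bounds the total influx; the balance equation at \<open>r\<close>
  then bounds the outflow. With both finite, the balance equation is an identity between indefinite
  integrals that can be differentiated.\<close>

lemma mild_imp_forward:
  assumes mild: "\<And>t B. u < t \<Longrightarrow> t < s \<Longrightarrow> B \<in> sets M \<Longrightarrow> mild t B"
    and r: "u < r" "r < s" and B: "qs_bounded M T0 q (ereal r) B"
  shows "((\<lambda>t. measure (P u x t) B) \<longlongrightarrow> indicat_real B x) (at_right u)"
    "abs_continuous_on {u<..<r} (\<lambda>t. measure (P u x t) B)"
    "AE t\<in>{u<..<r} in lborel. forward_equation_at q P u x B t"
proof -
  obtain K where K: "K \<ge> 0" "B \<in> sets M" "\<And>y \<theta>. y \<in> B \<Longrightarrow> T0 \<le> \<theta> \<Longrightarrow> \<theta> < r \<Longrightarrow> q_rate q y \<theta> \<le> K"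
    using qs_bounded_rate[OF B] by metis
  have bal: "balance t B" if "u < t" "t \<le> r" for t
    by (rule mild_imp_balance[OF mild that(1) K(2)]) (use that r in auto)
  have Vfin: "(\<integral>\<^sup>+w\<in>{u<..<r}. flux w (indicator B) \<partial>lborel) < \<infinity>"
    by (rule mild_imp_influx_finite[OF r mild[OF r K(2)] K(2) K(3) K(1)])
  have Ffin: "(\<integral>\<^sup>+w\<in>{u<..<r}. (\<integral>\<^sup>+y. indicator B y * ennreal (rate y w) \<partial>law w) \<partial>lborel) < \<infinity>"
  proof -
    have "(\<integral>\<^sup>+w\<in>{u<..<r}. (\<integral>\<^sup>+y. indicator B y * ennreal (rate y w) \<partial>law w) \<partial>lborel) \<le>
        emeasure (law r) B + (\<integral>\<^sup>+w\<in>{u<..<r}. (\<integral>\<^sup>+y. indicator B y * ennreal (rate y w) \<partial>law w) \<partial>lborel)"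
      by simp
    also have "\<dots> = indicator B x + (\<integral>\<^sup>+w\<in>{u<..<r}. flux w (indicator B) \<partial>lborel)"
      using bal[OF r(1) order_refl] unfolding balance_def .
    also have "\<dots> < \<infinity>" using Vfin by (simp add: indicator_def)
    finally show ?thesis .
  qed
  have v_fin: "AE w in lborel. w \<in> {u<..<r} \<longrightarrow> flux w (indicator B) < top"
  proof -
    have "AE w in lborel. flux w (indicator B) * indicator {u<..<r} w \<noteq> \<infinity>"
      using Vfin flux_indicator_measurable[OF K(2)] by (intro nn_integral_noteq_infinite) auto
    then show ?thesis
    proof eventually_elim
      case (elim w)
      then show ?case by (auto simp: less_top indicator_def)
    qed
  qed
  have dint: "(\<integral>\<^sup>+w\<in>{u<..<t}. ennreal (drift B w) \<partial>lborel) =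
      (\<integral>\<^sup>+w\<in>{u<..<t}. (\<integral>\<^sup>+y. indicator B y * ennreal (rate y w) \<partial>law w) \<partial>lborel)" if "t \<le> r" for t
    by (rule drift_integral[OF that less_imp_le[OF r(2)] K(2,1)]) (rule K(3))
  note iint = influx_integral[OF v_fin]
  have bal': "ennreal (measure (P u x t) B) + (\<integral>\<^sup>+w\<in>{u<..<t}. ennreal (drift B w) \<partial>lborel) =
      ennreal (indicat_real B x) + (\<integral>\<^sup>+w\<in>{u<..<t}. ennreal (influx B w) \<partial>lborel)" if tI: "t \<in> {u<..<r}" for t
  proof -
    have t: "u < t" "t < s" "t \<le> r" using tI r by auto
    show ?thesis
      using bal[OF t(1,3)] unfolding balance_def emeasure_law[OF t(1,2)] dint[OF t(3)] iint[OF t(3)] ennreal_indicator .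
  qed
  have fin: "(\<integral>\<^sup>+w\<in>{u<..<r}. ennreal (drift B w) \<partial>lborel) < \<infinity>"
    "(\<integral>\<^sup>+w\<in>{u<..<r}. ennreal (influx B w) \<partial>lborel) < \<infinity>"
    unfolding dint[OF order_refl] iint[OF order_refl] by (rule Ffin Vfin)+
  note res = balance_abs_continuous[OF r(1) drift_measurable[OF K(2)] influx_measurable[OF K(2)]
      measure_nonneg drift_nonneg influx_nonneg _ fin bal']
  show "((\<lambda>t. measure (P u x t) B) \<longlongrightarrow> indicat_real B x) (at_right u)"
    by (rule res(1)) auto
  show "abs_continuous_on {u<..<r} (\<lambda>t. measure (P u x t) B)"
    by (rule res(2)) auto
  have "AE t in lborel. t \<in> {u<..<r} \<longrightarrow> ((\<lambda>t. measure (P u x t) B) has_real_derivative (influx B t - drift B t)) (at t)"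
    by (rule res(3)) auto
  then show "AE t\<in>{u<..<r} in lborel. forward_equation_at q P u x B t"
    using v_fin
  proof eventually_elim
    case (elim w)
    show ?case
    proof
      assume wr: "w \<in> {u<..<r}"
      then have w: "u < w" "w < s" "w < r" using r by auto
      have M[measurable]: "(\<lambda>y. q_rate q y w) \<in> borel_measurable (P u x w)" "B \<in> sets (P u x w)"
        "(\<lambda>y. q_plus q y w B) \<in> borel_measurable (P u x w)"
        using q_rate_section[OF w(1,2)] K(2) q_plus_section[OF w(1,2) K(2)] by (simp_all add: P_sets[OF w(1,2)])
      interpret finite_measure "P u x w" by (rule P_finite[OF w(1,2)])
      show "forward_equation_at q P u x B w"
        unfolding forward_equation_at_def
      proof (intro conjI)
        show "set_integrable (P u x w) B (\<lambda>y. q_rate q y w)"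
          unfolding set_integrable_def
        proof (rule integrableI_bounded_set_indicator[where B=K])
          show "AE y in P u x w. y \<in> B \<longrightarrow> norm (q_rate q y w) \<le> K"
          proof (intro AE_I2 impI)
            fix y assume "y \<in> space (P u x w)" and y: "y \<in> B"
            then have "0 \<le> q_rate q y w" using w u by (intro q_rate_nonneg ico_s) (auto simp: P_space)
            then show "norm (q_rate q y w) \<le> K" using K(3)[OF y, of w] w u by simp
          qed
        qed (use M in \<open>auto simp: less_top[symmetric]\<close>)
        have nnp: "AE y in P u x w. 0 \<le> q_plus q y w B"
          using w u K(2) by (intro AE_I2 q_plus_nonneg ico_s) (auto simp: P_space)
        have "(\<integral>\<^sup>+y. ennreal (q_plus q y w B) \<partial>P u x w) < \<infinity>"
          using elim(2) wr by (simp add: flux_indicator[OF w(1,2) K(2)])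
        then show "integrable (P u x w) (\<lambda>y. q_plus q y w B)"
          using nnp by (intro integrableI_nonneg M)
        have "((\<lambda>t. measure (P u x t) B) has_real_derivative (influx B w - drift B w)) (at w)"
          using elim(1) wr by blast
        moreover have "influx B w - drift B w = - (LINT y:B|P u x w. q_rate q y w) + (LINT y|P u x w. q_plus q y w B)"
          unfolding forward_integrals[OF w(1,2) K(2)] by simp
        ultimately show "((\<lambda>\<tau>. measure (P u x \<tau>) B) has_real_derivative
          - (LINT y:B|P u x w. q_rate q y w) + (LINT y|P u x w. q_plus q y w B)) (at w)"
          by (simp only:)
      qed
    qed
  qed
qed

end

theorem theorem4:
  fixes M :: "'a measure" and T0 :: real and T1 :: ereal
    and q :: "'a \<Rightarrow> real \<Rightarrow> 'a set \<Rightarrow> real"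
    and P :: "real \<Rightarrow> 'a \<Rightarrow> real \<Rightarrow> 'a measure"
  assumes "standard_borel M"
    and "0 \<le> T0" and "ereal T0 < T1"
    and "Q_function M T0 T1 q"
    and "conservative M T0 T1 q"
    and "\<forall>s\<in>ioo T0 T1. \<forall>x\<in>space M. bdd_above ((\<lambda>t. q_rate q x t) ` {T0..<s})"
    and "P \<in> P_hat M T0 T1"
  shows
    "((\<forall>u\<in>ico T0 T1. \<forall>s\<in>ioo u T1. \<forall>x\<in>space M. \<forall>B. qs_bounded M T0 q (ereal s) B \<longrightarrow>
          ((\<lambda>t. measure (P u x t) B) \<longlongrightarrow> indicat_real B x) (at_right u) \<and>
          abs_continuous_on {u<..<s} (\<lambda>t. measure (P u x t) B)) \<and>
      (\<forall>u\<in>ico T0 T1. \<forall>s\<in>ioo u T1. \<forall>x\<in>space M. \<forall>B. qs_bounded M T0 q (ereal s) B \<longrightarrow>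
          (AE t\<in>{u<..<s} in lborel. forward_equation_at q P u x B t)))
     \<longleftrightarrow>
     (\<forall>u\<in>ico T0 T1. \<forall>t\<in>ioo u T1. \<forall>x\<in>space M. \<forall>B\<in>sets M.
        ennreal (measure (P u x t) B) =
          ennreal (indicat_real B x * exp (- (LBINT \<theta>:{u..t}. q_rate q x \<theta>)))
          + (\<integral>\<^sup>+w\<in>{u<..<t}.
               (\<integral>\<^sup>+z.
                  (\<integral>\<^sup>+y\<in>B. ennreal (exp (- (LBINT \<theta>:{w..t}. q_rate q y \<theta>)))
                     \<partial>q_plus_measure M q z w)
                \<partial>P u x w)
             \<partial>lborel))"
  (is "?fwd1 \<and> ?fwd2 \<longleftrightarrow> ?mild")
proof -
  have loc: "Q_transition M T0 T1 q P u s x"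
    if u: "u \<in> ico T0 T1" and s: "u < s" "ereal s < T1" and x: "x \<in> space M" for u s x
  proof unfold_locales
    show "bdd_above ((\<lambda>t. q_rate q y t) ` {T0..<s})" if "y \<in> space M" for y
      using assms(6) that u s by (auto simp: ico_def ioo_def)
  qed (use assms u s x in \<open>auto simp: ico_def\<close>)
  \<comment> \<open>Provides a real horizon strictly between the time considered and
    \<open>T1\<close>, which may be infinite.\<close>
  have later: "\<exists>s. t < s \<and> ereal s < T1" if "t \<in> ioo u T1" for t u
    using ereal_dense2[of "ereal t" T1] that by (auto simp: ioo_def)
  show ?thesis
  proof
    assume fwd: "?fwd1 \<and> ?fwd2"
    show ?mild
    proof (intro ballI)
      fix u t x B assume uI: "u \<in> ico T0 T1" and tI: "t \<in> ioo u T1" and xI: "x \<in> space M" and B: "B \<in> sets M"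
      obtain s where ts: "t < s" "ereal s < T1" using later[OF tI] by blast
      have ut: "u < t" using tI by (simp add: ioo_def)
      interpret Q_transition M T0 T1 q P u s x using ut ts by (intro loc uI xI) auto
      have sI: "s \<in> ioo u T1" using ut ts by (simp add: ioo_def)
      have "mild t B"
        by (rule forward_imp_mild[OF _ ut ts(1) B]) (use fwd uI sI xI in blast)
      then show "ennreal (measure (P u x t) B) =
          ennreal (indicat_real B x * exp (- (LBINT \<theta>:{u..t}. q_rate q x \<theta>)))
          + (\<integral>\<^sup>+w\<in>{u<..<t}. (\<integral>\<^sup>+z. (\<integral>\<^sup>+y\<in>B. ennreal (exp (- (LBINT \<theta>:{w..t}. q_rate q y \<theta>)))
                     \<partial>q_plus_measure M q z w) \<partial>P u x w) \<partial>lborel)"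
        by (simp only: mild_iff[OF ut ts(1) B])
    qed
  next
    assume mild: ?mild
    have *: "((\<lambda>t. measure (P u x t) B) \<longlongrightarrow> indicat_real B x) (at_right u) \<and>
          abs_continuous_on {u<..<r} (\<lambda>t. measure (P u x t) B) \<and>
          (AE t\<in>{u<..<r} in lborel. forward_equation_at q P u x B t)"
      if uI: "u \<in> ico T0 T1" and rI: "r \<in> ioo u T1" and xI: "x \<in> space M" and B: "qs_bounded M T0 q (ereal r) B" for u r x B
    proof -
      obtain s where rs: "r < s" "ereal s < T1" using later[OF rI] by blast
      have ur: "u < r" using rI by (simp add: ioo_def)
      interpret Q_transition M T0 T1 q P u s x using ur rs by (intro loc uI xI) auto
      have "mild t B" if "u < t" "t < s" "B \<in> sets M" for t B
        unfolding mild_iff[OF that] using mild uI xI ioo_s[OF that(1,2)] that(3) by blast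
      from mild_imp_forward[OF this ur rs(1) B] show ?thesis by blast
    qed
    then show "?fwd1 \<and> ?fwd2" by blast
  qed
qed

end
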